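(* Let $A$ be a Poincaré duality cdga over $\mathbb{R}$ of formal dimension $2n$. Suppose that for some $j\ge1$ we have $\langle H^{\le j}(A)\rangle\cap H^{j+1}(A)=0$ and that $A$ admits a $j$-controlled $d^c$-diagram $(B,\varphi_A,\varphi_H)$. Then $$0\le r_j^k-d_j^k\le\ell_k\qquad\text{for all }k>j.$$
   Context: All cdgas (graded-commutative differential graded algebras) are over $\mathbb{R}$, concentrated in non-negative degrees and connected ($\dim A^0=1$ or, for the purposes here, $H^0=\mathbb{R}$). A Poincaré duality cdga of formal dimension $2n$ is a cdga $A$ with finite-dimensional cohomology, $H^{2n}(A)\cong\mathbb{R}$ and nondegenerate pairings $H^k(A)\times H^{2n-k}(A)\to H^{2n}(A)$. Cones: for a map of complexes $\varphi:B\to A$, $cone(\varphi)^m=B^{m+1}\oplus A^m$ with $d(b,a)=(-d b,\,d a-\varphi(b))$. If $\varphi$ is a cdga map, $cone(\varphi)$ is a dg module over $B$ via $b\cdot(b',a)=((-1)^{|b|}bb',\varphi(b)a)$, so $H(cone(\varphi))$ is an $H(B)$-module. $d^c$-diagram for $A$: a triple $(B,\varphi_A,\varphi_H)$ of a connected, cohomologically finite-dimensional cdga $B$ and cdga maps $\varphi_A:B\to A$, $\varphi_H:B\to H(A)$ (zero differential on $H(A)$) such that: (Symmetry) the long exact cohomology sequences associated with $\varphi_A$ and $\varphi_H$ (via their cones) are isomorphic; (Connectivity) $H^0(\varphi_A)$ is an isomorphism and $H^1(\varphi_A)$ is injective; (Duality) for $\varphi=(\varphi_A,\varphi_H):B\to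 A\oplus H(A)$, $H^{2n}(cone(\varphi))\cong\mathbb{R}$ and the pairing $H^k(B)\otimes H^{2n-k}(cone(\varphi))\to H^{2n}(cone(\varphi))$ given by the module structure is nondegenerate for every $k$. The $d^c$-diagram is $j$-controlled if $H^s(\varphi_A)$ is an isomorphism for all $s\le j$ and $H^{j+1}(\varphi)$ is injective. Minimal models: a cdga is minimal if it is free as a graded-commutative algebra, $\Lambda V$, and $V$ has a well-ordered basis $\{x_i\}$ with $x_i<x_k$ whenever $\deg x_i<\deg x_k$ such that each $dx_i$ is a sum of products of lower-order generators. A $j$-minimal model of $A$ is a cdga map $\psi:\mathcal{M}^j\to A$, with $\mathcal{M}^j$ minimal and generated in degrees $\le j$, such that $H^s(\psi)$ is an isomorphism for $s\le j$ and $H^{j+1}(\psi)$ is injective; it exists and is unique up to isomorphism. Invariants: $\langle H^{\le j}(A)\rangle\subseteq H(A)$ is the subring generated by classes of degree $\le j$. For $k>j\ge1$, $r_j^k=r_j^k(A)=\operatorname{rank}(H^k(\mathcal{M}^j)\to H^k(A))$ for a $j$-minimal model $\mathcal{M}^j\to A$, $d_j^k=d_j^k(A)=\dim(\langle H^{\le j}(A)\rangle\cap H^k(A))$, and $\ell_k=\dim\operatorname{Ker}H^k(\varphi_A)=\dim\operatorname{Ker}H^k(\varphi_H)$. *)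

theory Defs
  imports "Jordan_Normal_Form.VS_Connect" "HOL-Algebra.Generated_Rings" "HOL-Algebra.QuotRing"
begin

section \<open>Graded vector spaces and cochain complexes over the reals\<close>

abbreviation RR :: "real ring" where
  "RR \<equiv> class_ring"

definition real_line :: "(real, real) module" where
  "real_line = \<lparr>carrier = UNIV, mult = (*), one = 1, zero = 0, add = (+), smult = (*)\<rparr>"

definition lin_iso ::
  "(real, 'a, 'c) module_scheme \<Rightarrow> (real, 'b, 'd) module_scheme \<Rightarrow> ('a \<Rightarrow> 'b) \<Rightarrow> bool" where
  "lin_iso V W f \<longleftrightarrow> f \<in> LinearCombinations.module_hom RR V W \<and> bij_betw f (carrier V) (carrier W)"

definition iso_reals :: "(real, 'a, 'c) module_scheme \<Rightarrow> bool" where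
  "iso_reals V \<longleftrightarrow> (\<exists>f. lin_iso V real_line f)"

definition nondegenerate ::
  "(real, 'a, 'd) module_scheme \<Rightarrow> (real, 'b, 'e) module_scheme \<Rightarrow> (real, 'c, 'f) module_scheme
    \<Rightarrow> ('a \<Rightarrow> 'b \<Rightarrow> 'c) \<Rightarrow> bool" where
  "nondegenerate V W U p \<longleftrightarrow>
    (\<forall>v\<in>carrier V. (\<forall>w\<in>carrier W. p v w = \<zero>\<^bsub>U\<^esub>) \<longrightarrow> v = \<zero>\<^bsub>V\<^esub>) \<and>
    (\<forall>w\<in>carrier W. (\<forall>v\<in>carrier V. p v w = \<zero>\<^bsub>U\<^esub>) \<longrightarrow> w = \<zero>\<^bsub>W\<^esub>)"

text \<open>
  Gradings are internal: \<^term>\<open>gr C k\<close> is the subspace of elements of degree \<open>k\<close>, and the carrier is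
  the direct sum of these subspaces. Degrees are integers because cones live in degrees
  \<open>\<ge> -1\<close> and because the duality pairings are required in every degree. As usual for
  \<^typ>\<open>(real, 'a) module\<close>, the fields \<^const>\<open>mult\<close> and \<^const>\<open>one\<close> are meaningless if
  the object is merely a complex.
\<close>

record 'a dg = "(real, 'a) module" +
  gr :: "int \<Rightarrow> 'a set"
  diff :: "'a \<Rightarrow> 'a"

locale graded_vectorspace = vectorspace RR C for C :: "'a dg" (structure) +
  assumes gr_submodule: "LinearCombinations.submodule RR (gr C k) C"
    and gr_sum: "x \<in> carrier C \<Longrightarrow>
      \<exists>F f. finite F \<and> (\<forall>k\<in>F. f k \<in> gr C k) \<and> x = (\<Oplus>\<^bsub>C\<^esub>k\<in>F. f k)"
    and gr_independent: "\<lbrakk>finite F; \<forall>k\<in>F. f k \<in> gr C k; (\<Oplus>\<^bsub>C\<^esub>k\<in>F. f k) = \<zero>\<^bsub>C\<^esub>\<rbrakk>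
      \<Longrightarrow> \<forall>k\<in>F. f k = \<zero>\<^bsub>C\<^esub>"

locale cochain_complex = graded_vectorspace +
  assumes diff_hom: "diff C \<in> LinearCombinations.module_hom RR C C"
    and diff_degree: "x \<in> gr C k \<Longrightarrow> diff C x \<in> gr C (k + 1)"
    and diff_diff: "x \<in> carrier C \<Longrightarrow> diff C (diff C x) = \<zero>\<^bsub>C\<^esub>"

definition cocycles :: "'a dg \<Rightarrow> 'a set" where
  "cocycles C = {x \<in> carrier C. diff C x = \<zero>\<^bsub>C\<^esub>}"

definition coboundaries :: "'a dg \<Rightarrow> 'a set" where
  "coboundaries C = diff C ` carrier C"

text \<open>
  The quotient of the cocycles by the coboundaries, with zero differential. The
  operations on cosets are those of \<^const>\<open>FactRing\<close>.
\<close>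

definition cohomology :: "'a dg \<Rightarrow> 'a set dg" where
  "cohomology C = \<lparr>
     carrier = (\<lambda>z. coboundaries C +>\<^bsub>C\<^esub> z) ` cocycles C,
     mult = rcoset_mult C (coboundaries C),
     one = coboundaries C +>\<^bsub>C\<^esub> \<one>\<^bsub>C\<^esub>,
     zero = coboundaries C,
     add = set_add C,
     smult = (\<lambda>r X. \<Union>x\<in>X. coboundaries C +>\<^bsub>C\<^esub> (r \<odot>\<^bsub>C\<^esub> x)),
     gr = (\<lambda>k. (\<lambda>z. coboundaries C +>\<^bsub>C\<^esub> z) ` (cocycles C \<inter> gr C k)),
     diff = (\<lambda>_. coboundaries C)\<rparr>"

definition Hdeg :: "int \<Rightarrow> 'a dg \<Rightarrow> 'a set dg" where
  "Hdeg k C = (cohomology C)\<lparr>carrier := gr (cohomology C) k\<rparr>"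

text \<open>
  The map induced on cohomology by \<open>f : C \<rightarrow> D\<close>, that is \<open>[z] \<mapsto> [f z]\<close>; the source \<open>C\<close> is not needed
  as an argument, and \<open>f\<close> may shift degrees and anticommute with the differentials.
\<close>

definition coh_map :: "'b dg \<Rightarrow> ('a \<Rightarrow> 'b) \<Rightarrow> 'a set \<Rightarrow> 'b set" where
  "coh_map D f X = (\<Union>x\<in>X. coboundaries D +>\<^bsub>D\<^esub> f x)"

definition H_iso :: "int \<Rightarrow> 'a dg \<Rightarrow> 'b dg \<Rightarrow> ('a \<Rightarrow> 'b) \<Rightarrow> bool" where
  "H_iso k C D f \<longleftrightarrow> lin_iso (Hdeg k C) (Hdeg k D) (coh_map D f)"

definition H_inj :: "int \<Rightarrow> 'a dg \<Rightarrow> 'b dg \<Rightarrow> ('a \<Rightarrow> 'b) \<Rightarrow> bool" where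
  "H_inj k C D f \<longleftrightarrow> inj_on (coh_map D f) (carrier (Hdeg k C))"

text \<open>Only used for subspaces of finite-dimensional spaces; elsewhere the library value is arbitrary.\<close>

abbreviation vdim :: "(real, 'a, 'c) module_scheme \<Rightarrow> nat" where
  "vdim V \<equiv> vectorspace.dim RR V"

definition H_rank :: "int \<Rightarrow> 'a dg \<Rightarrow> 'b dg \<Rightarrow> ('a \<Rightarrow> 'b) \<Rightarrow> nat" where
  "H_rank k C D f = vdim ((cohomology D)\<lparr>carrier := coh_map D f ` carrier (Hdeg k C)\<rparr>)"

definition H_ker_dim :: "int \<Rightarrow> 'a dg \<Rightarrow> 'b dg \<Rightarrow> ('a \<Rightarrow> 'b) \<Rightarrow> nat" where
  "H_ker_dim k C D f =
    vdim ((cohomology C)\<lparr>carrier := {x \<in> carrier (Hdeg k C). coh_map D f x = \<zero>\<^bsub>cohomology D\<^esub>}\<rparr>)"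


section \<open>Cdgas\<close>

locale cdga = cochain_complex A + ring A for A :: "'a dg" (structure) +
  assumes smult_mult_left:
      "\<lbrakk>x \<in> carrier A; y \<in> carrier A\<rbrakk> \<Longrightarrow> (r \<odot>\<^bsub>A\<^esub> x) \<otimes>\<^bsub>A\<^esub> y = r \<odot>\<^bsub>A\<^esub> (x \<otimes>\<^bsub>A\<^esub> y)"
    and smult_mult_right:
      "\<lbrakk>x \<in> carrier A; y \<in> carrier A\<rbrakk> \<Longrightarrow> x \<otimes>\<^bsub>A\<^esub> (r \<odot>\<^bsub>A\<^esub> y) = r \<odot>\<^bsub>A\<^esub> (x \<otimes>\<^bsub>A\<^esub> y)"
    and one_degree: "\<one>\<^bsub>A\<^esub> \<in> gr A 0"
    and mult_degree: "\<lbrakk>x \<in> gr A p; y \<in> gr A q\<rbrakk> \<Longrightarrow> x \<otimes>\<^bsub>A\<^esub> y \<in> gr A (p + q)"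
    and graded_comm: "\<lbrakk>x \<in> gr A p; y \<in> gr A q\<rbrakk>
      \<Longrightarrow> x \<otimes>\<^bsub>A\<^esub> y = ((-1) powi (p * q)) \<odot>\<^bsub>A\<^esub> (y \<otimes>\<^bsub>A\<^esub> x)"
    and leibniz: "\<lbrakk>x \<in> gr A p; y \<in> carrier A\<rbrakk>
      \<Longrightarrow> diff A (x \<otimes>\<^bsub>A\<^esub> y) = (diff A x \<otimes>\<^bsub>A\<^esub> y) \<oplus>\<^bsub>A\<^esub> ((-1) powi p) \<odot>\<^bsub>A\<^esub> (x \<otimes>\<^bsub>A\<^esub> diff A y)"
    and nonneg_degrees: "k < 0 \<Longrightarrow> gr A k = {\<zero>\<^bsub>A\<^esub>}"

definition connected_cdga :: "'a dg \<Rightarrow> bool" where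
  "connected_cdga A \<longleftrightarrow> cdga A \<and> iso_reals (Hdeg 0 A)"

definition cdga_hom :: "'a dg \<Rightarrow> 'b dg \<Rightarrow> ('a \<Rightarrow> 'b) set" where
  "cdga_hom B A = {f. f \<in> Ring.ring_hom B A \<and> f \<in> LinearCombinations.module_hom RR B A \<and>
     (\<forall>k. f ` gr B k \<subseteq> gr A k) \<and> (\<forall>x\<in>carrier B. f (diff B x) = diff A (f x))}"

definition poincare_duality_cdga :: "int \<Rightarrow> 'a dg \<Rightarrow> bool" where
  "poincare_duality_cdga N A \<longleftrightarrow>
     connected_cdga A \<and> vectorspace.fin_dim RR (cohomology A) \<and> iso_reals (Hdeg N A) \<and>
     (\<forall>k. nondegenerate (Hdeg k A) (Hdeg (N - k) A) (Hdeg N A) (mult (cohomology A)))"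

definition dg_prod :: "'a dg \<Rightarrow> 'b dg \<Rightarrow> ('a \<times> 'b) dg" where
  "dg_prod A B = \<lparr>
     carrier = carrier A \<times> carrier B,
     mult = (\<lambda>(a, b) (a', b'). (a \<otimes>\<^bsub>A\<^esub> a', b \<otimes>\<^bsub>B\<^esub> b')),
     one = (\<one>\<^bsub>A\<^esub>, \<one>\<^bsub>B\<^esub>),
     zero = (\<zero>\<^bsub>A\<^esub>, \<zero>\<^bsub>B\<^esub>),
     add = (\<lambda>(a, b) (a', b'). (a \<oplus>\<^bsub>A\<^esub> a', b \<oplus>\<^bsub>B\<^esub> b')),
     smult = (\<lambda>r (a, b). (r \<odot>\<^bsub>A\<^esub> a, r \<odot>\<^bsub>B\<^esub> b)),
     gr = (\<lambda>k. gr A k \<times> gr B k),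
     diff = (\<lambda>(a, b). (diff A a, diff B b))\<rparr>"


section \<open>Cones and the long exact sequence\<close>

definition cone :: "'b dg \<Rightarrow> 'a dg \<Rightarrow> ('b \<Rightarrow> 'a) \<Rightarrow> ('b \<times> 'a) dg" where
  "cone B A \<phi> = \<lparr>
     carrier = carrier B \<times> carrier A,
     mult = undefined,
     one = undefined,
     zero = (\<zero>\<^bsub>B\<^esub>, \<zero>\<^bsub>A\<^esub>),
     add = (\<lambda>(b, a) (b', a'). (b \<oplus>\<^bsub>B\<^esub> b', a \<oplus>\<^bsub>A\<^esub> a')),
     smult = (\<lambda>r (b, a). (r \<odot>\<^bsub>B\<^esub> b, r \<odot>\<^bsub>A\<^esub> a)),
     gr = (\<lambda>m. gr B (m + 1) \<times> gr A m),
     diff = (\<lambda>(b, a). (\<ominus>\<^bsub>B\<^esub> diff B b, diff A a \<ominus>\<^bsub>A\<^esub> \<phi> b))\<rparr>"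

text \<open>
  Isomorphism of the sequences
  \<open>\<cdots> \<rightarrow> H\<^sup>m(B) \<rightarrow> H\<^sup>m(A) \<rightarrow> H\<^sup>m(cone \<phi>) \<rightarrow> H\<^sup>m\<^sup>+\<^sup>1(B) \<rightarrow> \<cdots>\<close> of \<open>\<phi> : B \<rightarrow> A\<close> and \<open>\<psi> : B' \<rightarrow> A'\<close>, whose maps are
  induced by \<open>\<phi>\<close>, \<open>a \<mapsto> (0, a)\<close> and \<open>(b, a) \<mapsto> b\<close>.
\<close>

definition les_isomorphic ::
  "'b dg \<Rightarrow> 'a dg \<Rightarrow> ('b \<Rightarrow> 'a) \<Rightarrow> 'd dg \<Rightarrow> 'c dg \<Rightarrow> ('d \<Rightarrow> 'c) \<Rightarrow> bool" where
  "les_isomorphic B A \<phi> B' A' \<psi> \<longleftrightarrow> (\<exists>\<alpha> \<beta> \<gamma>. \<forall>m.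
     lin_iso (Hdeg m B) (Hdeg m B') (\<alpha> m) \<and>
     lin_iso (Hdeg m A) (Hdeg m A') (\<beta> m) \<and>
     lin_iso (Hdeg m (cone B A \<phi>)) (Hdeg m (cone B' A' \<psi>)) (\<gamma> m) \<and>
     (\<forall>x\<in>carrier (Hdeg m B). \<beta> m (coh_map A \<phi> x) = coh_map A' \<psi> (\<alpha> m x)) \<and>
     (\<forall>x\<in>carrier (Hdeg m A).
        \<gamma> m (coh_map (cone B A \<phi>) (\<lambda>a. (\<zero>\<^bsub>B\<^esub>, a)) x) =
        coh_map (cone B' A' \<psi>) (\<lambda>a. (\<zero>\<^bsub>B'\<^esub>, a)) (\<beta> m x)) \<and>
     (\<forall>x\<in>carrier (Hdeg m (cone B A \<phi>)).
        \<alpha> (m + 1) (coh_map B fst x) = coh_map B' fst (\<gamma> m x)))"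

definition cone_act :: "'b dg \<Rightarrow> 'a dg \<Rightarrow> ('b \<Rightarrow> 'a) \<Rightarrow> int \<Rightarrow> 'b \<Rightarrow> 'b \<times> 'a \<Rightarrow> 'b \<times> 'a" where
  "cone_act B A \<phi> k b = (\<lambda>(b', a). (((-1) powi k) \<odot>\<^bsub>B\<^esub> (b \<otimes>\<^bsub>B\<^esub> b'), \<phi> b \<otimes>\<^bsub>A\<^esub> a))"

text \<open>
  The action of \<open>H\<^sup>k(B)\<close> on \<open>H(cone \<phi>)\<close>. The sign depends on the degree, so representatives
  from \<open>B\<close> have to be taken homogeneous; a coset also contains inhomogeneous elements.
\<close>

definition cone_pairing ::
  "'b dg \<Rightarrow> 'a dg \<Rightarrow> ('b \<Rightarrow> 'a) \<Rightarrow> int \<Rightarrow> 'b set \<Rightarrow> ('b \<times> 'a) set \<Rightarrow> ('b \<times> 'a) set" where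
  "cone_pairing B A \<phi> k X Y =
    (\<Union>b\<in>X \<inter> gr B k. \<Union>c\<in>Y. coboundaries (cone B A \<phi>) +>\<^bsub>cone B A \<phi>\<^esub> cone_act B A \<phi> k b c)"


section \<open>Diagrams of \<open>d\<^sup>c\<close> type\<close>

abbreviation dc_target :: "'a dg \<Rightarrow> ('a \<times> 'a set) dg" where
  "dc_target A \<equiv> dg_prod A (cohomology A)"

abbreviation dc_map :: "('b \<Rightarrow> 'a) \<Rightarrow> ('b \<Rightarrow> 'a set) \<Rightarrow> 'b \<Rightarrow> 'a \<times> 'a set" where
  "dc_map \<phi>A \<phi>H \<equiv> (\<lambda>b. (\<phi>A b, \<phi>H b))"

definition dc_diagram ::
  "int \<Rightarrow> 'a dg \<Rightarrow> 'b dg \<Rightarrow> ('b \<Rightarrow> 'a) \<Rightarrow> ('b \<Rightarrow> 'a set) \<Rightarrow> bool" where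
  "dc_diagram N A B \<phi>A \<phi>H \<longleftrightarrow>
     connected_cdga B \<and> vectorspace.fin_dim RR (cohomology B) \<and>
     \<phi>A \<in> cdga_hom B A \<and> \<phi>H \<in> cdga_hom B (cohomology A) \<and>
     \<comment> \<open>symmetry\<close>
     les_isomorphic B A \<phi>A B (cohomology A) \<phi>H \<and>
     \<comment> \<open>connectivity\<close>
     H_iso 0 B A \<phi>A \<and> H_inj 1 B A \<phi>A \<and>
     \<comment> \<open>duality\<close>
     (let C = cone B (dc_target A) (dc_map \<phi>A \<phi>H) in
        iso_reals (Hdeg N C) \<and>
        (\<forall>k. nondegenerate (Hdeg k B) (Hdeg (N - k) C) (Hdeg N C)
               (cone_pairing B (dc_target A) (dc_map \<phi>A \<phi>H) k)))"

definition controlled ::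
  "int \<Rightarrow> 'a dg \<Rightarrow> 'b dg \<Rightarrow> ('b \<Rightarrow> 'a) \<Rightarrow> ('b \<Rightarrow> 'a set) \<Rightarrow> bool" where
  "controlled j A B \<phi>A \<phi>H \<longleftrightarrow>
     (\<forall>s\<le>j. H_iso s B A \<phi>A) \<and> H_inj (j + 1) B (dc_target A) (dc_map \<phi>A \<phi>H)"


section \<open>Free graded-commutative algebras and minimal models\<close>

text \<open>
  The tensor algebra on the vector space with basis \<open>X\<close>: finitely supported functions on words
  in \<open>X\<close>, multiplied by concatenation of words.
\<close>

definition tensor_algebra :: "'x set \<Rightarrow> ('x list \<Rightarrow> real) ring" where
  "tensor_algebra X = \<lparr>
     carrier = {c. finite {w. c w \<noteq> 0} \<and> {w. c w \<noteq> 0} \<subseteq> lists X},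
     mult = (\<lambda>c c' w. \<Sum>i\<le>length w. c (take i w) * c' (drop i w)),
     one = (\<lambda>w. if w = [] then 1 else 0),
     zero = (\<lambda>_. 0),
     add = (\<lambda>c c' w. c w + c' w)\<rparr>"

definition tensor_eval :: "'m dg \<Rightarrow> ('m list \<Rightarrow> real) \<Rightarrow> 'm" where
  "tensor_eval M c =
     (\<Oplus>\<^bsub>M\<^esub>w\<in>{w. c w \<noteq> 0}. c w \<odot>\<^bsub>M\<^esub> foldr (\<lambda>x y. x \<otimes>\<^bsub>M\<^esub> y) w \<one>\<^bsub>M\<^esub>)"

text \<open>The elements \<open>x \<otimes> y - (-1)\<^sup>|\<^sup>x\<^sup>|\<^sup>|\<^sup>y\<^sup>| y \<otimes> x\<close> of the tensor algebra on \<open>X\<close>.\<close>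

definition gc_relations :: "'m dg \<Rightarrow> 'm set \<Rightarrow> ('m list \<Rightarrow> real) set" where
  "gc_relations M X =
     {(\<lambda>w. (if w = [x, y] then 1 else 0) - (-1) powi (p * q) * (if w = [y, x] then 1 else 0)) |
        x y p q. x \<in> X \<inter> gr M p \<and> y \<in> X \<inter> gr M q}"

text \<open>
  \<open>M = \<Lambda>V\<close>, where \<open>V\<close> has the homogeneous basis \<open>X \<subseteq> M\<close>: the algebra map \<open>T(V) \<rightarrow> M\<close> identifies \<open>M\<close> with
  \<open>\<Lambda>V\<close>, the quotient of \<open>T(V)\<close> by the ideal generated by the graded commutators.
\<close>

definition free_gc_algebra_on :: "'m dg \<Rightarrow> 'm set \<Rightarrow> bool" where
  "free_gc_algebra_on M X \<longleftrightarrow>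
     X \<subseteq> (\<Union>p. gr M p) \<and>
     tensor_eval M ` carrier (tensor_algebra X) = carrier M \<and>
     a_kernel (tensor_algebra X) M (tensor_eval M) = Idl\<^bsub>tensor_algebra X\<^esub> gc_relations M X"

text \<open>
  The well-order \<open>r\<close> is reflexive, so \<^term>\<open>underS r x\<close> is the set of generators of lower order
  than \<open>x\<close>. For degree reasons, linear and constant terms cannot contribute to \<open>dx\<close>.
\<close>

definition minimal_generators :: "'m dg \<Rightarrow> 'm set \<Rightarrow> bool" where
  "minimal_generators M X \<longleftrightarrow>
     free_gc_algebra_on M X \<and>
     (\<exists>r. well_order_on X r \<and>
        (\<forall>p q. \<forall>x\<in>X \<inter> gr M p. \<forall>y\<in>X \<inter> gr M q. p < q \<longrightarrow> (x, y) \<in> r) \<and>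
        (\<forall>x\<in>X. diff M x \<in> tensor_eval M ` carrier (tensor_algebra (underS r x))))"

definition minimal_model :: "int \<Rightarrow> 'a dg \<Rightarrow> 'm dg \<Rightarrow> ('m \<Rightarrow> 'a) \<Rightarrow> bool" where
  "minimal_model j A M \<psi> \<longleftrightarrow>
     connected_cdga M \<and>
     (\<exists>X. minimal_generators M X \<and> X \<subseteq> (\<Union>p\<in>{..j}. gr M p)) \<and>
     \<psi> \<in> cdga_hom M A \<and> (\<forall>s\<le>j. H_iso s M A \<psi>) \<and> H_inj (j + 1) M A \<psi>"


section \<open>Numerical invariants\<close>

text \<open>The subring generated by the cohomology classes of degree at most \<open>j\<close>.\<close>

definition gen_subring :: "int \<Rightarrow> 'a dg \<Rightarrow> 'a set set" where
  "gen_subring j A = generate_ring (cohomology A) (\<Union>s\<in>{..j}. gr (cohomology A) s)"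

definition d_inv :: "int \<Rightarrow> int \<Rightarrow> 'a dg \<Rightarrow> nat" where
  "d_inv j k A = vdim ((cohomology A)\<lparr>carrier := gen_subring j A \<inter> gr (cohomology A) k\<rparr>)"

end

theory Submission
  imports Defs "Jordan_Normal_Form.DL_Rank"
begin

text \<open>
  Suppose that the minimal model \<open>\<psi> : M \<rightarrow> A\<close> lifts to a cdga map \<open>f : M \<rightarrow> B\<close> such that \<open>\<phi>\<^sub>A \<circ> f\<close> and \<open>\<psi>\<close>
  agree on cohomology, and let \<open>I \<subseteq> H\<^sup>k(B)\<close> be the image of \<open>H\<^sup>k(f)\<close>. Then \<open>H(\<phi>\<^sub>A)\<close> maps \<open>I\<close> onto the image of
  \<open>H\<^sup>k(\<psi>)\<close>, so \<open>r \<le> dim I\<close>. On the other hand \<open>M\<close> is generated in degrees at most \<open>j\<close>, and hence the algebra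
  map \<open>\<phi>\<^sub>H \<circ> f : M \<rightarrow> H(A)\<close> takes values in the subring \<open>\<langle>H\<^sup>\<le>\<^sup>j(A)\<rangle>\<close>. Therefore \<open>H(\<phi>\<^sub>H)\<close> has rank at most \<open>d\<close>
  on \<open>I\<close>, and \<open>dim I \<le> d + dim Ker H\<^sup>k(\<phi>\<^sub>H)\<close>. By the symmetry of the diagram this kernel is isomorphic to that
  of \<open>H\<^sup>k(\<phi>\<^sub>A)\<close> (lemma \<open>kernel_dim_le\<close>), which gives \<open>r - d \<le> \<ell>\<close>. The inequality \<open>d \<le> r\<close> holds because the
  image of \<open>H(\<psi>)\<close> is a subring that contains all classes of degree at most \<open>j\<close> (lemma
  \<open>gen_subring_degree_in_image\<close>).

  The map \<open>f\<close> is constructed generator by generator, together with a homotopy from \<open>\<phi>\<^sub>A \<circ> f\<close> to \<open>\<psi>\<close>. The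
  obstruction at a generator \<open>x\<close> of degree \<open>s \<le> j\<close> is the class of the cocycle \<open>f(dx)\<close> in \<open>H\<^sup>s\<^sup>+\<^sup>1(B)\<close>. By
  means of the homotopy, \<open>\<phi>\<^sub>A\<close> sends it to the class of \<open>\<psi>(dx) = d(\<psi>x)\<close>, which is zero. If \<open>s < j\<close>, then
  \<open>H\<^sup>s\<^sup>+\<^sup>1(\<phi>\<^sub>A)\<close> is injective and the obstruction vanishes. If \<open>s = j\<close>, then \<open>\<phi>\<^sub>H\<close> sends \<open>f(dx)\<close> to
  \<open>\<langle>H\<^sup>\<le>\<^sup>j(A)\<rangle> \<inter> H\<^sup>j\<^sup>+\<^sup>1(A) = 0\<close>, and the obstruction vanishes because \<open>H\<^sup>j\<^sup>+\<^sup>1(\<phi>\<^sub>A, \<phi>\<^sub>H)\<close> is injective (lemma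
  \<open>controlled_lifting_problem\<close>). Surjectivity of \<open>H\<^sup>s(\<phi>\<^sub>A)\<close> serves to extend the homotopy (lemmas
  \<open>admissible_exists\<close> and \<open>lift_up_to_homotopy\<close>).

  Homotopies are algebra maps into polynomial forms \<open>A[t] \<oplus> dt A[t]\<close>. Polynomials are represented by
  functions of a real parameter \<open>t\<close>, so that multiplication is pointwise and for each fixed \<open>t\<close> a
  homotopy is an algebra map from \<open>M\<close> into triangular matrices over \<open>A\<close>; such maps are given by the
  universal property of \<open>M = \<Lambda>V\<close>. The differential of polynomial forms enters as a relation between the
  values at \<open>m\<close> and at \<open>dm\<close>, which passes from generators to products. The only fact about polynomials
  that needs an argument is that a polynomial with derivative zero is constant.
\<close>

section \<open>Real vector spaces and their dimensions\<close>

locale real_vs = vectorspace RR V for V :: "(real, 'a, 'c) module_scheme" (structure)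
begin

lemma scale_closed [simp, intro]: "x \<in> carrier V \<Longrightarrow> r \<odot>\<^bsub>V\<^esub> x \<in> carrier V"
  using smult_closed[of r x] by simp

lemma scale_add_left: "x \<in> carrier V \<Longrightarrow> (r + s) \<odot>\<^bsub>V\<^esub> x = r \<odot>\<^bsub>V\<^esub> x \<oplus>\<^bsub>V\<^esub> s \<odot>\<^bsub>V\<^esub> x"
  using smult_l_distr[of r s x] by simp

lemma scale_add_right:
  "x \<in> carrier V \<Longrightarrow> y \<in> carrier V \<Longrightarrow> r \<odot>\<^bsub>V\<^esub> (x \<oplus>\<^bsub>V\<^esub> y) = r \<odot>\<^bsub>V\<^esub> x \<oplus>\<^bsub>V\<^esub> r \<odot>\<^bsub>V\<^esub> y"
  using smult_r_distr[of r x y] by simp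

lemma scale_scale: "x \<in> carrier V \<Longrightarrow> r \<odot>\<^bsub>V\<^esub> (s \<odot>\<^bsub>V\<^esub> x) = (r * s) \<odot>\<^bsub>V\<^esub> x"
  using smult_assoc1[of r s x] by simp

lemma scale_one [simp]: "x \<in> carrier V \<Longrightarrow> 1 \<odot>\<^bsub>V\<^esub> x = x"
  using smult_one[of x] by simp

lemma scale_zero_left [simp]: "x \<in> carrier V \<Longrightarrow> 0 \<odot>\<^bsub>V\<^esub> x = \<zero>\<^bsub>V\<^esub>"
  using lmult_0[of x] by simp

lemma scale_zero_right [simp]: "r \<odot>\<^bsub>V\<^esub> \<zero>\<^bsub>V\<^esub> = \<zero>\<^bsub>V\<^esub>"
  using rmult_0[of r] by simp

lemma neg_eq_scale: "x \<in> carrier V \<Longrightarrow> \<ominus>\<^bsub>V\<^esub> x = (-1) \<odot>\<^bsub>V\<^esub> x"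
  using smult_minus_1[of x] by (simp add: class_ring_simps)

lemma minus_eq_scale: "y \<in> carrier V \<Longrightarrow> x \<ominus>\<^bsub>V\<^esub> y = x \<oplus>\<^bsub>V\<^esub> (-1) \<odot>\<^bsub>V\<^esub> y"
  by (simp add: a_minus_def neg_eq_scale)

lemma add_scale_minus_one: "x \<in> carrier V \<Longrightarrow> x \<oplus>\<^bsub>V\<^esub> (-1) \<odot>\<^bsub>V\<^esub> x = \<zero>\<^bsub>V\<^esub>"
  using scale_add_left[of x 1 "-1"] by simp

lemma scale_eq_zero_iff: "x \<in> carrier V \<Longrightarrow> r \<noteq> 0 \<Longrightarrow> r \<odot>\<^bsub>V\<^esub> x = \<zero>\<^bsub>V\<^esub> \<longleftrightarrow> x = \<zero>\<^bsub>V\<^esub>"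
  by (metis left_inverse scale_one scale_scale scale_zero_right)

lemma scale_finsum:
  "finite F \<Longrightarrow> f \<in> F \<rightarrow> carrier V \<Longrightarrow> r \<odot>\<^bsub>V\<^esub> (\<Oplus>\<^bsub>V\<^esub>i\<in>F. f i) = (\<Oplus>\<^bsub>V\<^esub>i\<in>F. r \<odot>\<^bsub>V\<^esub> f i)"
  using finsum_smult_ldistr[of F r f] by simp

lemma subspaceI:
  assumes "W \<subseteq> carrier V" "\<zero>\<^bsub>V\<^esub> \<in> W" "\<And>x y. x \<in> W \<Longrightarrow> y \<in> W \<Longrightarrow> x \<oplus>\<^bsub>V\<^esub> y \<in> W"
    "\<And>r x. x \<in> W \<Longrightarrow> r \<odot>\<^bsub>V\<^esub> x \<in> W"
  shows "VectorSpace.subspace RR W V"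
  by (intro VectorSpace.subspace.intro vectorspace_axioms LinearCombinations.submodule.intro module_axioms)
     (use assms in auto)

text \<open>
  A linearly independent subset of \<open>W\<close> is independent in \<open>V\<close>, so its size is at most \<open>dim V\<close>. Hence
  there is a maximal one, and it generates \<open>W\<close>.
\<close>

lemma fin_dim_subspace:
  assumes W: "VectorSpace.subspace RR W V" and fd: fin_dim
  shows "vectorspace.fin_dim RR (V\<lparr>carrier := W\<rparr>)"
proof -
  interpret W: vectorspace RR "V\<lparr>carrier := W\<rparr>" by (rule subspace_is_vs[OF W])
  have sub: "LinearCombinations.submodule RR W V" using W by (simp add: VectorSpace.subspace_def)
  have WV: "W \<subseteq> carrier V" using sub by (simp add: LinearCombinations.submodule_def)
  let ?P = "\<lambda>S. S \<subseteq> W \<and> W.lin_indpt S"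
  have bound: "finite S \<and> card S \<le> dim" if "?P S" for S
  proof -
    have "lin_indpt S" using that span_li_not_depend(2)[OF _ sub, of S] by simp
    then show ?thesis using li_le_dim[OF fd, of S] that WV by auto
  qed
  have "\<exists>S. maximal S ?P"
  proof -
    have "?P {}" unfolding W.lin_dep_def by blast
    moreover have "\<forall>S. ?P S \<longrightarrow> card S < Suc dim" using bound by (simp add: less_Suc_eq_le)
    ultimately have "\<exists>S. ?P S \<and> (\<forall>T. ?P T \<longrightarrow> card T \<le> card S)"
      by (rule ex_has_greatest_nat)
    then obtain S where S: "?P S" "\<forall>T. ?P T \<longrightarrow> card T \<le> card S" by (elim exE conjE) blast
    have "maximal S ?P"
      unfolding maximal_def
    proof (intro conjI allI impI)
      show "S \<subseteq> W" "W.lin_indpt S" using S(1) by auto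
      fix T assume "S \<subseteq> T \<and> ?P T"
      then show "T = S" using S(2) bound[of T] card_seteq[of T S] by auto
    qed
    then show ?thesis ..
  qed
  then obtain S where S: "maximal S ?P" ..
  then have "W.gen_set S" by (intro W.max_li_is_gen) (simp add: conj_commute)
  moreover have "S \<subseteq> W" "finite S" using S bound unfolding maximal_def by auto
  ultimately show ?thesis unfolding W.fin_dim_def by auto
qed

lemma dim_subspace_mono:
  assumes W: "VectorSpace.subspace RR W V" and U: "VectorSpace.subspace RR U V" and "W \<subseteq> U" and fd: fin_dim
  shows "vdim (V\<lparr>carrier := W\<rparr>) \<le> vdim (V\<lparr>carrier := U\<rparr>)"
proof -
  interpret U: vectorspace RR "V\<lparr>carrier := U\<rparr>" by (rule subspace_is_vs[OF U])
  interpret U: real_vs "V\<lparr>carrier := U\<rparr>" by unfold_locales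
  have "LinearCombinations.submodule RR W V" using W by (simp add: VectorSpace.subspace_def)
  then have WU: "VectorSpace.subspace RR W (V\<lparr>carrier := U\<rparr>)"
    by (intro U.subspaceI) (use \<open>W \<subseteq> U\<close> in \<open>auto simp: LinearCombinations.submodule_def\<close>)
  show ?thesis
    using U.subspace_dim[OF WU fin_dim_subspace[OF U fd]] U.fin_dim_subspace[OF WU fin_dim_subspace[OF U fd]]
    by simp
qed

end

lemma module_homI:
  assumes "\<And>x. x \<in> carrier V \<Longrightarrow> f x \<in> carrier W"
    "\<And>x y. x \<in> carrier V \<Longrightarrow> y \<in> carrier V \<Longrightarrow> f (x \<oplus>\<^bsub>V\<^esub> y) = f x \<oplus>\<^bsub>W\<^esub> f y"
    "\<And>r x. x \<in> carrier V \<Longrightarrow> f (r \<odot>\<^bsub>V\<^esub> x) = r \<odot>\<^bsub>W\<^esub> f x"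
  shows "f \<in> LinearCombinations.module_hom RR V W"
  using assms unfolding LinearCombinations.module_hom_def by auto

lemma subspace_image:
  assumes "vectorspace RR V" "vectorspace RR W" "f \<in> LinearCombinations.module_hom RR V W"
    "VectorSpace.subspace RR U V"
  shows "VectorSpace.subspace RR (f ` U) W"
proof -
  interpret W: real_vs W using assms(2) by (rule real_vs.intro)
  interpret V: real_vs V using assms(1) by (rule real_vs.intro)
  interpret f: linear_map RR V W f using assms by (unfold_locales) auto
  have U: "LinearCombinations.submodule RR U V" using assms(4) by (simp add: VectorSpace.subspace_def)
  then have UV: "U \<subseteq> carrier V" by (simp add: LinearCombinations.submodule_def)
  show ?thesis
  proof (rule W.subspaceI)
    show "f ` U \<subseteq> carrier W" using UV by auto
    show "\<zero>\<^bsub>W\<^esub> \<in> f ` U"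
      using U f.f0_is_0 by (metis image_eqI LinearCombinations.submodule_def)
    fix x y assume "x \<in> f ` U" "y \<in> f ` U"
    then obtain a b where ab: "x = f a" "y = f b" "a \<in> U" "b \<in> U" by auto
    then have "x \<oplus>\<^bsub>W\<^esub> y = f (a \<oplus>\<^bsub>V\<^esub> b)" using UV by (simp add: f.f_add subset_eq)
    moreover have "a \<oplus>\<^bsub>V\<^esub> b \<in> U" using U ab by (simp add: LinearCombinations.submodule_def)
    ultimately show "x \<oplus>\<^bsub>W\<^esub> y \<in> f ` U" by blast
  next
    fix r x assume "x \<in> f ` U"
    then obtain a where ab: "x = f a" "a \<in> U" by auto
    then have "r \<odot>\<^bsub>W\<^esub> x = f (r \<odot>\<^bsub>V\<^esub> a)" using UV f.f_smult[of r a] by (simp add: subset_eq)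
    moreover have "r \<odot>\<^bsub>V\<^esub> a \<in> U" using U ab by (simp add: LinearCombinations.submodule_def)
    ultimately show "r \<odot>\<^bsub>W\<^esub> x \<in> f ` U" by blast
  qed
qed

lemma rank_nullity_on_subspace:
  assumes "vectorspace RR V" "vectorspace RR W" "f \<in> LinearCombinations.module_hom RR V W"
    and U: "VectorSpace.subspace RR U V" and fd: "vectorspace.fin_dim RR V"
  shows "vdim (W\<lparr>carrier := f ` U\<rparr>) + vdim (V\<lparr>carrier := {x \<in> U. f x = \<zero>\<^bsub>W\<^esub>}\<rparr>)
    = vdim (V\<lparr>carrier := U\<rparr>)"
proof -
  interpret V: real_vs V using assms(1) by (rule real_vs.intro)
  interpret U: vectorspace RR "V\<lparr>carrier := U\<rparr>" by (rule V.subspace_is_vs[OF U])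
  interpret W: vectorspace RR W by fact
  have UV: "U \<subseteq> carrier V" using U by (simp add: VectorSpace.subspace_def LinearCombinations.submodule_def)
  have hom: "f \<in> LinearCombinations.module_hom RR (V\<lparr>carrier := U\<rparr>) W"
    using assms(3) UV unfolding LinearCombinations.module_hom_def subset_eq by auto
  interpret f: linear_map RR "V\<lparr>carrier := U\<rparr>" W f
    by unfold_locales (rule hom)
  show ?thesis
    using f.rank_nullity[OF V.fin_dim_subspace[OF U fd]]
    by (simp add: f.im_def f.ker_def)
qed

section \<open>Homogeneous components\<close>

sublocale graded_vectorspace \<subseteq> real_vs C
  by unfold_locales

lemma lin_hom_zero:
  assumes "vectorspace RR V" "vectorspace RR W" "f \<in> LinearCombinations.module_hom RR V W"
  shows "f \<zero>\<^bsub>V\<^esub> = \<zero>\<^bsub>W\<^esub>"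
proof -
  interpret V: vectorspace RR V by fact
  interpret W: vectorspace RR W by fact
  interpret f: mod_hom RR V W f by unfold_locales fact
  show ?thesis by (rule f.f0_is_0)
qed

lemma lin_hom_finsum:
  assumes V: "vectorspace RR V" and W: "vectorspace RR W"
    and f: "f \<in> LinearCombinations.module_hom RR V W"
    and "finite F" "g \<in> F \<rightarrow> carrier V"
  shows "f (\<Oplus>\<^bsub>V\<^esub>i\<in>F. g i) = (\<Oplus>\<^bsub>W\<^esub>i\<in>F. f (g i))"
proof -
  interpret V: vectorspace RR V by fact
  interpret W: vectorspace RR W by fact
  note [simp] = LinearCombinations.module_hom_add[OF f]
  have c: "f x \<in> carrier W" if "x \<in> carrier V" for x
    using LinearCombinations.module_hom_closed[OF f] that by auto
  show ?thesis
    using assms(4,5)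
    by (induction F) (auto simp: lin_hom_zero[OF V W f] c Pi_def)
qed

context graded_vectorspace
begin

lemma gr_closed: "x \<in> gr C k \<Longrightarrow> x \<in> carrier C"
  using gr_submodule[of k] by (auto simp: LinearCombinations.submodule_def)

lemma gr_zero [simp]: "\<zero> \<in> gr C k"
  using gr_submodule[of k] by (auto simp: LinearCombinations.submodule_def)

lemma gr_add: "x \<in> gr C k \<Longrightarrow> y \<in> gr C k \<Longrightarrow> x \<oplus> y \<in> gr C k"
  using gr_submodule[of k] by (auto simp: LinearCombinations.submodule_def)

lemma gr_scale: "x \<in> gr C k \<Longrightarrow> r \<odot> x \<in> gr C k"
  using gr_submodule[of k] by (auto simp: LinearCombinations.submodule_def)

text \<open>
  Only the existence of a finite set that contains the support of \<open>f\<close> is recorded, so that two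
  decompositions can be compared over the union of two such sets.
\<close>

definition decomposition :: "'a \<Rightarrow> (int \<Rightarrow> 'a) \<Rightarrow> bool" where
  "decomposition x f \<longleftrightarrow> (\<forall>k. f k \<in> gr C k) \<and>
     (\<exists>F. finite F \<and> (\<forall>k. k \<notin> F \<longrightarrow> f k = \<zero>) \<and> x = (\<Oplus>k\<in>F. f k))"

lemma finsum_supset:
  assumes "finite G" "F \<subseteq> G" "\<And>k. k \<notin> F \<Longrightarrow> f k = \<zero>" "\<And>k. f k \<in> carrier C"
  shows "(\<Oplus>k\<in>F. f k) = (\<Oplus>k\<in>G. f k)"
  by (rule add.finprod_mono_neutral_cong_left) (use assms in auto)

lemma decomposition_sum:
  assumes "decomposition x f"
  obtains F where "finite F" "\<forall>G. finite G \<longrightarrow> F \<subseteq> G \<longrightarrow> x = (\<Oplus>k\<in>G. f k)"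
    "\<forall>k. k \<notin> F \<longrightarrow> f k = \<zero>"
proof -
  obtain F where F: "finite F" "\<And>k. k \<notin> F \<Longrightarrow> f k = \<zero>" "x = (\<Oplus>k\<in>F. f k)"
    using assms unfolding decomposition_def by auto
  have "f k \<in> carrier C" for k using assms gr_closed unfolding decomposition_def by blast
  then show thesis using that[of F] F finsum_supset by metis
qed

lemma decomposition_closed: "decomposition x f \<Longrightarrow> f k \<in> gr C k"
  unfolding decomposition_def by blast

lemma decomposition_add:
  assumes f: "decomposition x f" and g: "decomposition y g"
  shows "decomposition (x \<oplus> y) (\<lambda>k. f k \<oplus> g k)"
proof -
  have c: "f k \<in> gr C k" "g k \<in> gr C k" for k
    using f g decomposition_closed by auto
  obtain F where F: "finite F" "\<forall>G. finite G \<longrightarrow> F \<subseteq> G \<longrightarrow> x = (\<Oplus>k\<in>G. f k)"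
    "\<forall>k. k \<notin> F \<longrightarrow> f k = \<zero>" by (rule decomposition_sum[OF f])
  obtain F' where F': "finite F'" "\<forall>G. finite G \<longrightarrow> F' \<subseteq> G \<longrightarrow> y = (\<Oplus>k\<in>G. g k)"
    "\<forall>k. k \<notin> F' \<longrightarrow> g k = \<zero>" by (rule decomposition_sum[OF g])
  have "x \<oplus> y = (\<Oplus>k\<in>F \<union> F'. f k) \<oplus> (\<Oplus>k\<in>F \<union> F'. g k)"
    using F(1) F(2)[rule_format, of "F \<union> F'"] F'(1) F'(2)[rule_format, of "F \<union> F'"] by simp
  also have "\<dots> = (\<Oplus>k\<in>F \<union> F'. f k \<oplus> g k)"
    by (rule finsum_addf[symmetric]) (use c gr_closed in auto)
  finally show ?thesis
    unfolding decomposition_def using c F F' gr_add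
    by (intro conjI exI[of _ "F \<union> F'"]) auto
qed

lemma decomposition_scale:
  assumes f: "decomposition x f"
  shows "decomposition (r \<odot> x) (\<lambda>k. r \<odot> f k)"
proof -
  have c: "f k \<in> gr C k" for k using f decomposition_closed by auto
  obtain F where F: "finite F" "\<forall>G. finite G \<longrightarrow> F \<subseteq> G \<longrightarrow> x = (\<Oplus>k\<in>G. f k)"
    "\<forall>k. k \<notin> F \<longrightarrow> f k = \<zero>" by (rule decomposition_sum[OF f])
  have x: "x = (\<Oplus>k\<in>F. f k)" using F(1) F(2)[rule_format, of F] by simp
  have "r \<odot> x = (\<Oplus>k\<in>F. r \<odot> f k)"
    unfolding x by (rule scale_finsum) (use F(1) c gr_closed in auto)
  then show ?thesis unfolding decomposition_def using c F gr_scale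
    by (intro conjI exI[of _ F]) auto
qed

lemma decomposition_zero:
  assumes f: "decomposition \<zero> f" shows "f k = \<zero>"
proof -
  obtain F where F: "finite F" "\<forall>G. finite G \<longrightarrow> F \<subseteq> G \<longrightarrow> \<zero> = (\<Oplus>k\<in>G. f k)"
    "\<forall>k. k \<notin> F \<longrightarrow> f k = \<zero>" by (rule decomposition_sum[OF f])
  have "(\<Oplus>k\<in>F. f k) = \<zero>" using F(1) F(2)[rule_format, of F] by (metis order_refl)
  with F(1) have "\<forall>k\<in>F. f k = \<zero>"
    by (intro gr_independent ballI decomposition_closed[OF f])
  then show ?thesis using F(3) by blast
qed

lemma decomposition_carrier: "decomposition x f \<Longrightarrow> x \<in> carrier C"
  unfolding decomposition_def by (auto intro!: finsum_closed intro: gr_closed)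

lemma decomposition_unique:
  assumes f: "decomposition x f" and g: "decomposition x g" shows "f = g"
proof
  fix k
  have x: "x \<in> carrier C" using decomposition_carrier f by auto
  have c: "f k \<in> carrier C" "g k \<in> carrier C"
    using f g decomposition_closed gr_closed by blast+
  have "decomposition \<zero> (\<lambda>k. f k \<oplus> (-1) \<odot> g k)"
    using decomposition_add[OF f decomposition_scale[OF g, of "-1"]] x
    by (simp add: add_scale_minus_one)
  then have "f k \<ominus> g k = \<zero>"
    using decomposition_zero[of _ k] c by (simp add: minus_eq_scale)
  then show "f k = g k" using c by simp
qed

lemma decomposition_exists:
  assumes "x \<in> carrier C" obtains f where "decomposition x f"
proof -
  obtain F f where Ff: "finite F" "\<forall>k\<in>F. f k \<in> gr C k" "x = (\<Oplus>k\<in>F. f k)"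
    using gr_sum[OF assms] by blast
  let ?g = "\<lambda>k. if k \<in> F then f k else \<zero>"
  have "(\<Oplus>k\<in>F. f k) = (\<Oplus>k\<in>F. ?g k)"
    by (rule finsum_cong') (use Ff gr_closed in auto)
  then have "decomposition x ?g"
    unfolding decomposition_def using Ff by (intro conjI exI[of _ F]) auto
  then show thesis by (rule that)
qed

definition component :: "int \<Rightarrow> 'a \<Rightarrow> 'a" where
  "component k x = (THE f. decomposition x f) k"

lemma component_eq: "decomposition x f \<Longrightarrow> component k x = f k"
  unfolding component_def using decomposition_unique by (metis the_equality)

lemma decomposition_component: "x \<in> carrier C \<Longrightarrow> decomposition x (\<lambda>k. component k x)"
  using decomposition_exists component_eq by (metis (no_types, lifting) ext)

lemma component_degree: "x \<in> carrier C \<Longrightarrow> component k x \<in> gr C k"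
  using decomposition_component decomposition_closed by fastforce

lemma component_closed [simp]: "x \<in> carrier C \<Longrightarrow> component k x \<in> carrier C"
  using component_degree gr_closed by blast

lemma component_add:
  "x \<in> carrier C \<Longrightarrow> y \<in> carrier C \<Longrightarrow> component k (x \<oplus> y) = component k x \<oplus> component k y"
  by (rule component_eq[OF decomposition_add]) (auto intro: decomposition_component)

lemma component_scale:
  "x \<in> carrier C \<Longrightarrow> component k (r \<odot> x) = r \<odot> component k x"
  by (rule component_eq[OF decomposition_scale]) (auto intro: decomposition_component)

lemma component_hom: "component k \<in> LinearCombinations.module_hom RR C C"
  by (rule module_homI) (auto simp: component_add component_scale)

lemma component_homogeneous:
  assumes x: "x \<in> gr C k" shows "component l x = (if l = k then x else \<zero>)"
proof -
  have "decomposition x (\<lambda>l. if l = k then x else \<zero>)"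
    unfolding decomposition_def using x gr_closed[OF x]
    by (intro conjI exI[of _ "{k}"]) auto
  then show ?thesis by (rule component_eq)
qed

lemma sum_of_components:
  assumes "x \<in> carrier C"
  obtains F where "finite F" "x = (\<Oplus>k\<in>F. component k x)"
  using decomposition_component[OF assms] that unfolding decomposition_def by auto

lemma homogeneous_induct [consumes 1, case_names zero add homogeneous]:
  assumes "x \<in> carrier C" and zero: "P \<zero>"
    and add: "\<And>x y. x \<in> carrier C \<Longrightarrow> y \<in> carrier C \<Longrightarrow> P x \<Longrightarrow> P y \<Longrightarrow> P (x \<oplus> y)"
    and hom: "\<And>x k. x \<in> gr C k \<Longrightarrow> P x"
  shows "P x"
proof -
  obtain F f where Ff: "finite F" "\<forall>k\<in>F. f k \<in> gr C k" "x = (\<Oplus>k\<in>F. f k)"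
    using gr_sum[OF assms(1)] by blast
  have "P (\<Oplus>k\<in>F. f k)" using Ff(1,2)
  proof (induction F)
    case empty show ?case using zero by simp
  next
    case (insert k F)
    have "(\<Oplus>k\<in>insert k F. f k) = f k \<oplus> (\<Oplus>k\<in>F. f k)"
      using insert gr_closed by (intro finsum_insert) auto
    moreover have "P (f k \<oplus> (\<Oplus>k\<in>F. f k))"
    proof (rule add)
      show "f k \<in> carrier C" "P (f k)" using insert gr_closed hom by auto
      show "(\<Oplus>k\<in>F. f k) \<in> carrier C" using insert gr_closed by (intro finsum_closed) auto
      show "P (\<Oplus>k\<in>F. f k)" using insert by auto
    qed
    ultimately show ?case by simp
  qed
  then show ?thesis using Ff by simp
qed

end

text \<open>A linear map of degree \<open>e\<close> permutes the components; on homogeneous elements this is clear,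
  and both sides are additive.\<close>

lemma component_of_graded_hom:
  assumes "graded_vectorspace C" "graded_vectorspace D"
    and L: "L \<in> LinearCombinations.module_hom RR C D"
    and deg: "\<And>k x. x \<in> gr C k \<Longrightarrow> L x \<in> gr D (k + e)"
    and x: "x \<in> carrier C"
  shows "graded_vectorspace.component D (k + e) (L x) = L (graded_vectorspace.component C k x)"
proof -
  interpret C: graded_vectorspace C by fact
  interpret D: graded_vectorspace D by fact
  have Lc: "L x \<in> carrier D" if "x \<in> carrier C" for x
    using L that unfolding LinearCombinations.module_hom_def by auto
  have L0: "L \<zero>\<^bsub>C\<^esub> = \<zero>\<^bsub>D\<^esub>"
    using lin_hom_zero[OF C.vectorspace_axioms D.vectorspace_axioms L] .
  show ?thesis using x
  proof (induction rule: C.homogeneous_induct)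
    case zero show ?case
      using C.component_homogeneous[of "\<zero>\<^bsub>C\<^esub>"] D.component_homogeneous[of "\<zero>\<^bsub>D\<^esub>"] by (simp add: L0)
  next
    case (add x y) then show ?case
      by (simp add: LinearCombinations.module_hom_add[OF L] C.component_add D.component_add Lc)
  next
    case (homogeneous x l) then show ?case
      using C.component_homogeneous[OF homogeneous] D.component_homogeneous[OF deg[OF homogeneous]]
      by (simp add: L0)
  qed
qed

lemma (in cochain_complex) component_diff:
  "x \<in> carrier C \<Longrightarrow> component (k + 1) (diff C x) = diff C (component k x)"
  using component_of_graded_hom[OF graded_vectorspace_axioms graded_vectorspace_axioms diff_hom diff_degree] .

section \<open>Cohomology classes\<close>

definition coh_class :: "'a dg \<Rightarrow> 'a \<Rightarrow> 'a set" where
  "coh_class C x = coboundaries C +>\<^bsub>C\<^esub> x"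

lemma cohomology_sel:
  "carrier (cohomology C) = coh_class C ` cocycles C"
  "\<one>\<^bsub>cohomology C\<^esub> = coh_class C \<one>\<^bsub>C\<^esub>"
  "\<zero>\<^bsub>cohomology C\<^esub> = coboundaries C"
  "gr (cohomology C) k = coh_class C ` (cocycles C \<inter> gr C k)"
  "carrier (Hdeg k C) = coh_class C ` (cocycles C \<inter> gr C k)"
  "diff (cohomology C) X = coboundaries C"
  by (simp_all add: cohomology_def Hdeg_def coh_class_def)

text \<open>
  The coset calculus modulo the image of a linear endomorphism \<open>d\<close>.
\<close>

locale diff_space = real_vs C for C :: "'a dg" (structure) +
  assumes d_hom: "diff C \<in> LinearCombinations.module_hom RR C C"
begin

lemma d_closed [simp]: "x \<in> carrier C \<Longrightarrow> diff C x \<in> carrier C"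
  using d_hom unfolding LinearCombinations.module_hom_def by auto

lemma d_add: "x \<in> carrier C \<Longrightarrow> y \<in> carrier C \<Longrightarrow> diff C (x \<oplus> y) = diff C x \<oplus> diff C y"
  using d_hom unfolding LinearCombinations.module_hom_def by auto

lemma d_scale: "x \<in> carrier C \<Longrightarrow> diff C (r \<odot> x) = r \<odot> diff C x"
  using d_hom unfolding LinearCombinations.module_hom_def by auto

lemma d_zero [simp]: "diff C \<zero> = \<zero>"
  by (rule lin_hom_zero[OF vectorspace_axioms vectorspace_axioms d_hom])

lemma mem_coh_class: "y \<in> coh_class C x \<longleftrightarrow> (\<exists>a\<in>carrier C. y = diff C a \<oplus> x)"
  unfolding coh_class_def a_r_coset_def' coboundaries_def by auto

lemma self_mem_coh_class: "x \<in> carrier C \<Longrightarrow> x \<in> coh_class C x"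
  unfolding mem_coh_class by (intro bexI[of _ "\<zero>"]) auto

lemma coh_class_eqI:
  assumes a: "a \<in> carrier C" and y: "y \<in> carrier C" and "x = diff C a \<oplus> y"
  shows "coh_class C x = coh_class C y"
proof (intro Set.set_eqI iffI)
  fix z assume "z \<in> coh_class C x"
  then obtain b where b: "b \<in> carrier C" "z = diff C b \<oplus> x" unfolding mem_coh_class by blast
  then have "z = diff C (b \<oplus> a) \<oplus> y" using assms by (simp add: d_add a_ac)
  then show "z \<in> coh_class C y" unfolding mem_coh_class using a b by blast
next
  fix z assume "z \<in> coh_class C y"
  then obtain b where b: "b \<in> carrier C" "z = diff C b \<oplus> y" unfolding mem_coh_class by blast
  have "y = diff C ((-1) \<odot> a) \<oplus> x"
  proof -
    have "diff C ((-1) \<odot> a) \<oplus> x = (diff C a \<oplus> (-1) \<odot> diff C a) \<oplus> y"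
      using assms by (simp add: d_scale a_ac)
    then show ?thesis using a y by (simp add: add_scale_minus_one)
  qed
  then have "z = diff C (b \<oplus> (-1) \<odot> a) \<oplus> x"
    using a b assms by (simp add: d_add a_assoc)
  then show "z \<in> coh_class C x" unfolding mem_coh_class using a b by blast
qed

lemma coh_class_eq_iff:
  assumes "x \<in> carrier C" "y \<in> carrier C"
  shows "coh_class C x = coh_class C y \<longleftrightarrow> (\<exists>a\<in>carrier C. x = diff C a \<oplus> y)"
  using coh_class_eqI[OF _ assms(2)] self_mem_coh_class[OF assms(1)] mem_coh_class by auto

lemma coh_class_zero: "coh_class C \<zero> = coboundaries C"
  by (auto simp: mem_coh_class coboundaries_def)

lemma coh_class_eq_zero_iff:
  "x \<in> carrier C \<Longrightarrow> coh_class C x = coboundaries C \<longleftrightarrow> (\<exists>a\<in>carrier C. x = diff C a)"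
  using coh_class_eq_iff[of x "\<zero>"] by (simp add: coh_class_zero)

lemma UN_coh_class:
  assumes x: "x \<in> carrier C" and "\<And>y. y \<in> coh_class C x \<Longrightarrow> g y = g x"
  shows "(\<Union>y\<in>coh_class C x. g y) = g x"
proof -
  have "(\<Union>y\<in>coh_class C x. g y) = (\<Union>y\<in>coh_class C x. g x)"
    by (intro SUP_cong refl assms(2))
  then show ?thesis using self_mem_coh_class[OF x] by auto
qed

lemma coh_class_add:
  assumes x: "x \<in> carrier C" and y: "y \<in> carrier C"
  shows "coh_class C x \<oplus>\<^bsub>cohomology C\<^esub> coh_class C y = coh_class C (x \<oplus> y)"
proof -
  have "coh_class C x <+>\<^bsub>C\<^esub> coh_class C y = coh_class C (x \<oplus> y)"
  proof (intro Set.set_eqI iffI)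
    fix z assume "z \<in> coh_class C x <+>\<^bsub>C\<^esub> coh_class C y"
    then obtain a b where "a \<in> carrier C" "b \<in> carrier C"
      "z = (diff C a \<oplus> x) \<oplus> (diff C b \<oplus> y)"
      unfolding set_add_def' by (auto simp: mem_coh_class)
    then show "z \<in> coh_class C (x \<oplus> y)"
      unfolding mem_coh_class using x y
      by (intro bexI[of _ "a \<oplus> b"]) (auto simp: d_add a_ac)
  next
    fix z assume "z \<in> coh_class C (x \<oplus> y)"
    then obtain a where a: "a \<in> carrier C" "z = diff C a \<oplus> (x \<oplus> y)"
      by (auto simp: mem_coh_class)
    then have "z = (diff C a \<oplus> x) \<oplus> y" using x y by (simp add: a_ac)
    moreover have "diff C a \<oplus> x \<in> coh_class C x" using a by (auto simp: mem_coh_class)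
    ultimately show "z \<in> coh_class C x <+>\<^bsub>C\<^esub> coh_class C y"
      unfolding set_add_def' using self_mem_coh_class[OF y] by auto
  qed
  then show ?thesis by (simp add: cohomology_def)
qed

lemma coh_class_scale:
  assumes x: "x \<in> carrier C"
  shows "r \<odot>\<^bsub>cohomology C\<^esub> coh_class C x = coh_class C (r \<odot> x)"
proof -
  have "(\<Union>y\<in>coh_class C x. coh_class C (r \<odot> y)) = coh_class C (r \<odot> x)"
  proof (rule UN_coh_class[OF x])
    fix y assume "y \<in> coh_class C x"
    then obtain a where "a \<in> carrier C" "y = diff C a \<oplus> x" by (auto simp: mem_coh_class)
    then show "coh_class C (r \<odot> y) = coh_class C (r \<odot> x)"
      using x by (intro coh_class_eqI[of "r \<odot> a"]) (auto simp: scale_add_right d_scale)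
  qed
  then show ?thesis by (simp add: cohomology_def coh_class_def)
qed

lemma cocycle_closed: "x \<in> cocycles C \<Longrightarrow> x \<in> carrier C"
  by (simp add: cocycles_def)

lemma cocycle_add: "x \<in> cocycles C \<Longrightarrow> y \<in> cocycles C \<Longrightarrow> x \<oplus> y \<in> cocycles C"
  by (simp add: cocycles_def d_add)

lemma cocycle_scale: "x \<in> cocycles C \<Longrightarrow> r \<odot> x \<in> cocycles C"
  by (simp add: cocycles_def d_scale)

lemma cocycle_zero: "\<zero> \<in> cocycles C"
  by (simp add: cocycles_def)

lemma cohomology_vectorspace: "vectorspace RR (cohomology C)"
proof (intro vectorspace.intro moduleI abelian_groupI)
  note cl = cocycle_closed cohomology_sel coh_class_zero[symmetric] coh_class_add coh_class_scale
  show "cring RR" by (rule class_cring.is_cring)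
  show "field RR" by (rule class_field)
  fix X assume X: "X \<in> carrier (cohomology C)"
  then obtain x where x: "x \<in> cocycles C" "X = coh_class C x" by (auto simp: cl)
  show "\<exists>Y\<in>carrier (cohomology C). Y \<oplus>\<^bsub>cohomology C\<^esub> X = \<zero>\<^bsub>cohomology C\<^esub>"
    using x by (intro bexI[of _ "coh_class C ((-1) \<odot> x)"])
      (auto simp: cl a_comm add_scale_minus_one cocycle_scale)
qed (auto simp: cocycle_closed cohomology_sel coh_class_zero[symmetric] coh_class_add coh_class_scale
    cocycle_add cocycle_scale cocycle_zero a_ac scale_add_left scale_add_right scale_scale)

lemma coh_class_neg:
  assumes "x \<in> cocycles C"
  shows "\<ominus>\<^bsub>cohomology C\<^esub> coh_class C x = coh_class C ((-1) \<odot> x)"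
proof -
  interpret H: real_vs "cohomology C" by (rule real_vs.intro[OF cohomology_vectorspace])
  show ?thesis using assms
    by (subst H.neg_eq_scale) (auto simp: cohomology_sel coh_class_scale cocycle_closed)
qed

end

text \<open>
  By definition \<^const>\<open>coh_map\<close> is a union over all representatives. A chain map changes the class of
  the image by a coboundary at most, so all members of this union are equal.
\<close>

lemma coh_map_class:
  assumes C: "diff_space C" and D: "diff_space D"
    and f: "f \<in> LinearCombinations.module_hom RR C D"
    and chain: "\<And>x. x \<in> carrier C \<Longrightarrow> f (diff C x) = diff D (f x)"
    and x: "x \<in> carrier C"
  shows "coh_map D f (coh_class C x) = coh_class D (f x)"
proof -
  interpret C: diff_space C by fact
  interpret D: diff_space D by fact
  have fc: "f y \<in> carrier D" if "y \<in> carrier C" for y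
    using f that unfolding LinearCombinations.module_hom_def by auto
  have "(\<Union>y\<in>coh_class C x. coh_class D (f y)) = coh_class D (f x)"
  proof (rule C.UN_coh_class[OF x])
    fix y assume "y \<in> coh_class C x"
    then obtain a where "a \<in> carrier C" "y = diff C a \<oplus>\<^bsub>C\<^esub> x" by (auto simp: C.mem_coh_class)
    then show "coh_class D (f y) = coh_class D (f x)"
      using x by (intro D.coh_class_eqI[of "f a"])
        (auto simp: fc LinearCombinations.module_hom_add[OF f] chain)
  qed
  then show ?thesis by (simp add: coh_map_def coh_class_def)
qed

lemma coh_map_hom:
  assumes C: "diff_space C" and D: "diff_space D"
    and f: "f \<in> LinearCombinations.module_hom RR C D"
    and chain: "\<And>x. x \<in> carrier C \<Longrightarrow> f (diff C x) = diff D (f x)"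
  shows "coh_map D f \<in> LinearCombinations.module_hom RR (cohomology C) (cohomology D)"
proof -
  interpret C: diff_space C by fact
  interpret D: diff_space D by fact
  have fc: "f y \<in> carrier D" if "y \<in> carrier C" for y
    using f that unfolding LinearCombinations.module_hom_def by auto
  have z: "f y \<in> cocycles D" if "y \<in> cocycles C" for y
    using that chain[of y] fc lin_hom_zero[OF C.vectorspace_axioms D.vectorspace_axioms f]
    by (auto simp: cocycles_def)
  show ?thesis
    by (rule module_homI) (auto simp: cohomology_sel coh_map_class[OF C D f chain] C.cocycle_closed
      C.coh_class_add D.coh_class_add C.coh_class_scale D.coh_class_scale fc z
      LinearCombinations.module_hom_add[OF f] LinearCombinations.module_hom_smult[OF f])
qed

sublocale cochain_complex \<subseteq> diff_space C
  by unfold_locales (rule diff_hom)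

context cochain_complex
begin

lemma cocycle_component: "x \<in> cocycles C \<Longrightarrow> component k x \<in> cocycles C"
  using component_diff[of x k] component_homogeneous[OF gr_zero]
  by (auto simp: cocycles_def)

lemma diff_cocycle: "x \<in> carrier C \<Longrightarrow> diff C x \<in> cocycles C"
  by (simp add: cocycles_def diff_diff)

lemma gr_cohomology_subspace: "VectorSpace.subspace RR (gr (cohomology C) k) (cohomology C)"
proof -
  interpret H: real_vs "cohomology C" by (rule real_vs.intro[OF cohomology_vectorspace])
  show ?thesis
  proof (rule H.subspaceI)
    show "\<zero>\<^bsub>cohomology C\<^esub> \<in> gr (cohomology C) k"
      using cocycle_zero by (auto simp: cohomology_sel coh_class_zero[symmetric])
  qed (auto simp: cohomology_sel coh_class_add coh_class_scale cocycle_closed cocycle_add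
      cocycle_scale gr_add gr_scale)
qed

text \<open>Since \<open>d\<close> has degree one, the components of \<open>a\<close> in other degrees are cocycles and may be dropped.\<close>

lemma homogeneous_primitive:
  assumes "a \<in> carrier C" "diff C a \<in> gr C (k + 1)"
  shows "component k a \<in> gr C k" "diff C (component k a) = diff C a"
  using assms component_degree[of a k] component_diff[of a k] component_homogeneous[OF assms(2)]
  by auto

end

section \<open>The universal property of free graded-commutative algebras\<close>

definition monomial :: "'x list \<Rightarrow> real \<Rightarrow> 'x list \<Rightarrow> real" where
  "monomial w r = (\<lambda>v. if v = w then r else 0)"

text \<open>
  The deconcatenations of a word: summing over them instead of over cut positions makes the product
  of the tensor algebra a convolution, and its associativity a bijection between triples of words.
\<close>

definition splittings :: "'x list \<Rightarrow> ('x list \<times> 'x list) set" where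
  "splittings w = {(u, v). u @ v = w}"

lemma mem_splittings: "(u, v) \<in> splittings w \<longleftrightarrow> u @ v = w"
  by (simp add: splittings_def)

lemma splittings_eq: "splittings w = (\<lambda>i. (take i w, drop i w)) ` {..length w}"
proof (rule Set.set_eqI, rule iffI)
  fix p assume "p \<in> splittings w"
  then have "p = (take (length (fst p)) w, drop (length (fst p)) w)" "length (fst p) \<le> length w"
    by (auto simp: splittings_def)
  then show "p \<in> (\<lambda>i. (take i w, drop i w)) ` {..length w}" by blast
qed (auto simp: splittings_def)

lemma finite_splittings [simp]: "finite (splittings w)"
  by (simp add: splittings_eq)

lemma tensor_mult_splittings:
  "(c \<otimes>\<^bsub>tensor_algebra X\<^esub> c') w = (\<Sum>(u, v)\<in>splittings w. c u * c' v)"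
proof -
  have "inj_on (\<lambda>i. (take i w, drop i w)) {..length w}"
    by (rule inj_onI) (metis Pair_inject atMost_iff length_take min.absorb2)
  then show ?thesis
    by (simp add: splittings_eq sum.reindex tensor_algebra_def)
qed

lemma tensor_sel:
  "c \<in> carrier (tensor_algebra X) \<longleftrightarrow> finite {w. c w \<noteq> 0} \<and> {w. c w \<noteq> 0} \<subseteq> lists X"
  "\<one>\<^bsub>tensor_algebra X\<^esub> = monomial [] 1"
  "\<zero>\<^bsub>tensor_algebra X\<^esub> = (\<lambda>_. 0)"
  "c \<oplus>\<^bsub>tensor_algebra X\<^esub> c' = (\<lambda>w. c w + c' w)"
  by (auto simp: tensor_algebra_def monomial_def)

lemma tensor_add_closed:
  assumes "c \<in> carrier (tensor_algebra X)" "c' \<in> carrier (tensor_algebra X)"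
  shows "(\<lambda>w. c w + c' w) \<in> carrier (tensor_algebra X)"
proof -
  have "{w. c w + c' w \<noteq> 0} \<subseteq> {w. c w \<noteq> 0} \<union> {w. c' w \<noteq> 0}" by auto
  then show ?thesis using assms unfolding tensor_sel
    by (meson finite_UnI finite_subset order_trans Un_least)
qed

lemma tensor_scale_closed:
  "c \<in> carrier (tensor_algebra X) \<Longrightarrow> (\<lambda>w. r * c w) \<in> carrier (tensor_algebra X)"
  unfolding tensor_sel by (auto intro: rev_finite_subset)

lemma monomial_closed: "w \<in> lists X \<Longrightarrow> monomial w r \<in> carrier (tensor_algebra X)"
  unfolding tensor_sel monomial_def by (auto intro: rev_finite_subset[of "{w}"])

lemma tensor_mult_closed:
  assumes c: "c \<in> carrier (tensor_algebra X)" and c': "c' \<in> carrier (tensor_algebra X)"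
  shows "c \<otimes>\<^bsub>tensor_algebra X\<^esub> c' \<in> carrier (tensor_algebra X)"
proof -
  let ?S = "(\<lambda>(u, v). u @ v) ` ({w. c w \<noteq> 0} \<times> {w. c' w \<noteq> 0})"
  have "{w. (c \<otimes>\<^bsub>tensor_algebra X\<^esub> c') w \<noteq> 0} \<subseteq> ?S"
  proof
    fix w assume "w \<in> {w. (c \<otimes>\<^bsub>tensor_algebra X\<^esub> c') w \<noteq> 0}"
    then have "(\<Sum>(u, v)\<in>splittings w. c u * c' v) \<noteq> 0" by (simp add: tensor_mult_splittings)
    then obtain p where "p \<in> splittings w" "(case p of (u, v) \<Rightarrow> c u * c' v) \<noteq> 0"
      by (meson sum.not_neutral_contains_not_neutral)
    then show "w \<in> ?S" by (force simp: splittings_def)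
  qed
  moreover have "finite ?S" "?S \<subseteq> lists X" using c c' unfolding tensor_sel subset_eq by auto
  ultimately show ?thesis unfolding tensor_sel by (meson finite_subset order_trans)
qed

lemma tensor_mult_assoc:
  "(a \<otimes>\<^bsub>tensor_algebra X\<^esub> b) \<otimes>\<^bsub>tensor_algebra X\<^esub> c =
    a \<otimes>\<^bsub>tensor_algebra X\<^esub> (b \<otimes>\<^bsub>tensor_algebra X\<^esub> c)"
proof
  fix w
  have "((a \<otimes>\<^bsub>tensor_algebra X\<^esub> b) \<otimes>\<^bsub>tensor_algebra X\<^esub> c) w =
      (\<Sum>(p, z)\<in>splittings w. \<Sum>(u, v)\<in>splittings p. a u * b v * c z)"
    by (simp add: tensor_mult_splittings sum_distrib_right case_prod_unfold)
  also have "\<dots> = (\<Sum>(s, t)\<in>Sigma (splittings w) (\<lambda>s. splittings (fst s)). a (fst t) * b (snd t) * c (snd s))"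
    by (simp add: sum.Sigma case_prod_unfold)
  also have "\<dots> = (\<Sum>(s, t)\<in>Sigma (splittings w) (\<lambda>s. splittings (snd s)). a (fst s) * (b (fst t) * c (snd t)))"
    by (rule sum.reindex_bij_witness
        [of _ "\<lambda>(s, t). ((fst s @ fst t, snd t), (fst s, fst t))"
              "\<lambda>(s, t). ((fst t, snd t @ snd s), (snd t, snd s))"])
       (auto simp: splittings_def)
  also have "\<dots> = (\<Sum>(u, p)\<in>splittings w. \<Sum>(v, z)\<in>splittings p. a u * (b v * c z))"
    by (simp add: sum.Sigma case_prod_unfold)
  also have "\<dots> = (a \<otimes>\<^bsub>tensor_algebra X\<^esub> (b \<otimes>\<^bsub>tensor_algebra X\<^esub> c)) w"
    by (simp add: tensor_mult_splittings sum_distrib_left case_prod_unfold)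
  finally show "((a \<otimes>\<^bsub>tensor_algebra X\<^esub> b) \<otimes>\<^bsub>tensor_algebra X\<^esub> c) w =
    (a \<otimes>\<^bsub>tensor_algebra X\<^esub> (b \<otimes>\<^bsub>tensor_algebra X\<^esub> c)) w" .
qed

lemma tensor_mult_distrib:
  "(\<lambda>w. a w + b w) \<otimes>\<^bsub>tensor_algebra X\<^esub> c =
    (\<lambda>w. (a \<otimes>\<^bsub>tensor_algebra X\<^esub> c) w + (b \<otimes>\<^bsub>tensor_algebra X\<^esub> c) w)"
  "c \<otimes>\<^bsub>tensor_algebra X\<^esub> (\<lambda>w. a w + b w) =
    (\<lambda>w. (c \<otimes>\<^bsub>tensor_algebra X\<^esub> a) w + (c \<otimes>\<^bsub>tensor_algebra X\<^esub> b) w)"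
  by (simp_all add: tensor_mult_splittings fun_eq_iff case_prod_unfold algebra_simps sum.distrib)

lemma tensor_mult_zero:
  "(\<lambda>_. 0) \<otimes>\<^bsub>tensor_algebra X\<^esub> c = (\<lambda>_. 0)" "c \<otimes>\<^bsub>tensor_algebra X\<^esub> (\<lambda>_. 0) = (\<lambda>_. 0)"
  by (simp_all add: tensor_mult_splittings fun_eq_iff case_prod_unfold)

lemma monomial_mult:
  "monomial u r \<otimes>\<^bsub>tensor_algebra X\<^esub> monomial v s = monomial (u @ v) (r * s)"
proof
  fix w
  have "(\<Sum>(a, b)\<in>splittings w. monomial u r a * monomial v s b) =
      (\<Sum>p\<in>splittings w. if p = (u, v) then r * s else 0)"
    by (rule sum.cong) (auto simp: monomial_def split: if_splits)
  also have "\<dots> = monomial (u @ v) (r * s) w"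
    by (auto simp: monomial_def mem_splittings)
  finally show "(monomial u r \<otimes>\<^bsub>tensor_algebra X\<^esub> monomial v s) w = monomial (u @ v) (r * s) w"
    by (simp add: tensor_mult_splittings)
qed

lemma tensor_induct [consumes 1, case_names zero add]:
  assumes "c \<in> carrier (tensor_algebra X)" and "P (\<lambda>_. 0)"
    and add: "\<And>c w r. c \<in> carrier (tensor_algebra X) \<Longrightarrow> w \<in> lists X \<Longrightarrow> P c \<Longrightarrow>
      P (\<lambda>v. monomial w r v + c v)"
  shows "P c"
proof -
  have "\<forall>c. {w. c w \<noteq> 0} \<subseteq> F \<longrightarrow> F \<subseteq> lists X \<longrightarrow> P c" if "finite F" for F
    using that
  proof (induction F)
    case empty
    have "c = (\<lambda>_. 0)" if "{w. c w \<noteq> 0} \<subseteq> {}" for c :: "'a list \<Rightarrow> real" using that by auto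
    then show ?case using assms(2) by blast
  next
    case (insert w F)
    show ?case
    proof (intro allI impI)
      fix c :: "'a list \<Rightarrow> real"
      assume c: "{w. c w \<noteq> 0} \<subseteq> insert w F" "insert w F \<subseteq> lists X"
      let ?c = "\<lambda>v. if v = w then 0 else c v"
      have s: "{w. ?c w \<noteq> 0} \<subseteq> F" using c by auto
      have "P ?c" by (rule insert.IH[rule_format, OF s]) (use c(2) in simp)
      moreover have "?c \<in> carrier (tensor_algebra X)" unfolding tensor_sel
        using finite_subset[OF s insert.hyps(1)] order_trans[OF s] c(2) by simp
      ultimately have "P (\<lambda>v. monomial w (c w) v + ?c v)" using c(2) add[of ?c w "c w"] by simp
      moreover have "(\<lambda>v. monomial w (c w) v + ?c v) = c" by (auto simp: monomial_def)
      ultimately show "P c" by simp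
    qed
  qed
  then show ?thesis using assms(1) unfolding tensor_sel by blast
qed

lemma tensor_algebra_ring: "ring (tensor_algebra X)"
proof (intro ringI abelian_groupI monoidI)
  fix c assume c: "c \<in> carrier (tensor_algebra X)"
  show "\<exists>c'\<in>carrier (tensor_algebra X). c' \<oplus>\<^bsub>tensor_algebra X\<^esub> c = \<zero>\<^bsub>tensor_algebra X\<^esub>"
    using tensor_scale_closed[OF c, of "-1"] by (auto simp: tensor_sel intro!: bexI[of _ "\<lambda>w. -1 * c w"])
  show "\<one>\<^bsub>tensor_algebra X\<^esub> \<otimes>\<^bsub>tensor_algebra X\<^esub> c = c"
  proof
    fix w
    have "(\<Sum>(a, b)\<in>splittings w. monomial [] 1 a * c b) = (\<Sum>p\<in>splittings w. if p = ([], w) then c w else 0)"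
      by (rule sum.cong) (auto simp: monomial_def mem_splittings split: if_splits)
    then show "(\<one>\<^bsub>tensor_algebra X\<^esub> \<otimes>\<^bsub>tensor_algebra X\<^esub> c) w = c w"
      by (simp add: tensor_mult_splittings tensor_sel mem_splittings)
  qed
  show "c \<otimes>\<^bsub>tensor_algebra X\<^esub> \<one>\<^bsub>tensor_algebra X\<^esub> = c"
  proof
    fix w
    have "(\<Sum>(a, b)\<in>splittings w. c a * monomial [] 1 b) = (\<Sum>p\<in>splittings w. if p = (w, []) then c w else 0)"
      by (rule sum.cong) (auto simp: monomial_def mem_splittings split: if_splits)
    then show "(c \<otimes>\<^bsub>tensor_algebra X\<^esub> \<one>\<^bsub>tensor_algebra X\<^esub>) w = c w"
      by (simp add: tensor_mult_splittings tensor_sel mem_splittings)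
  qed
qed (auto simp: tensor_add_closed tensor_mult_closed tensor_mult_assoc tensor_mult_distrib
    tensor_sel(2-4) monomial_closed fun_eq_iff algebra_simps intro: tensor_sel(1)[THEN iffD2])

text \<open>
  The targets of the universal property. They are more general than cdgas because the algebra of
  homotopies below is not spanned by its homogeneous elements.
\<close>

locale gc_algebra = real_vs A + ring A for A :: "'a dg" (structure) +
  assumes scale_mult_left:
      "\<lbrakk>x \<in> carrier A; y \<in> carrier A\<rbrakk> \<Longrightarrow> (r \<odot> x) \<otimes> y = r \<odot> (x \<otimes> y)"
    and scale_mult_right:
      "\<lbrakk>x \<in> carrier A; y \<in> carrier A\<rbrakk> \<Longrightarrow> x \<otimes> (r \<odot> y) = r \<odot> (x \<otimes> y)"
    and homogeneous_closed: "x \<in> gr A p \<Longrightarrow> x \<in> carrier A"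
    and homogeneous_zero: "\<zero> \<in> gr A p"
    and homogeneous_add: "\<lbrakk>x \<in> gr A p; y \<in> gr A p\<rbrakk> \<Longrightarrow> x \<oplus> y \<in> gr A p"
    and homogeneous_scale: "x \<in> gr A p \<Longrightarrow> r \<odot> x \<in> gr A p"
    and homogeneous_one: "\<one> \<in> gr A 0"
    and homogeneous_mult: "\<lbrakk>x \<in> gr A p; y \<in> gr A q\<rbrakk> \<Longrightarrow> x \<otimes> y \<in> gr A (p + q)"
    and homogeneous_comm: "\<lbrakk>x \<in> gr A p; y \<in> gr A q\<rbrakk>
      \<Longrightarrow> x \<otimes> y = ((-1) powi (p * q)) \<odot> (y \<otimes> x)"

sublocale cdga \<subseteq> gc_algebra
proof unfold_locales
  fix x y p q r
  show "x \<in> carrier A \<Longrightarrow> y \<in> carrier A \<Longrightarrow> r \<odot> x \<otimes> y = r \<odot> (x \<otimes> y)"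
    by (rule smult_mult_left)
  show "x \<in> carrier A \<Longrightarrow> y \<in> carrier A \<Longrightarrow> x \<otimes> (r \<odot> y) = r \<odot> (x \<otimes> y)"
    by (rule smult_mult_right)
  show "x \<in> gr A p \<Longrightarrow> x \<in> carrier A" by (rule gr_closed)
  show "\<zero> \<in> gr A p" by (rule gr_zero)
  show "x \<in> gr A p \<Longrightarrow> y \<in> gr A p \<Longrightarrow> x \<oplus> y \<in> gr A p" by (rule gr_add)
  show "x \<in> gr A p \<Longrightarrow> r \<odot> x \<in> gr A p" by (rule gr_scale)
  show "\<one> \<in> gr A 0" by (rule one_degree)
  show "x \<in> gr A p \<Longrightarrow> y \<in> gr A q \<Longrightarrow> x \<otimes> y \<in> gr A (p + q)" by (rule mult_degree)
  show "x \<in> gr A p \<Longrightarrow> y \<in> gr A q \<Longrightarrow> x \<otimes> y = ((-1) powi (p * q)) \<odot> (y \<otimes> x)"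
    by (rule graded_comm)
qed

definition word_value :: "'c dg \<Rightarrow> ('x \<Rightarrow> 'c) \<Rightarrow> 'x list \<Rightarrow> 'c" where
  "word_value C g w = foldr (\<lambda>x y. g x \<otimes>\<^bsub>C\<^esub> y) w \<one>\<^bsub>C\<^esub>"

text \<open>The value of a noncommutative polynomial at \<open>g\<close>; for \<open>g = id\<close> this is \<^const>\<open>tensor_eval\<close>.\<close>

definition poly_value :: "'c dg \<Rightarrow> ('x \<Rightarrow> 'c) \<Rightarrow> ('x list \<Rightarrow> real) \<Rightarrow> 'c" where
  "poly_value C g c = (\<Oplus>\<^bsub>C\<^esub>w\<in>{w. c w \<noteq> 0}. c w \<odot>\<^bsub>C\<^esub> word_value C g w)"

lemma tensor_eval_eq: "tensor_eval M c = poly_value M (\<lambda>x. x) c"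
  by (simp add: tensor_eval_def poly_value_def word_value_def)

context gc_algebra
begin

lemma word_value_closed:
  "g \<in> X \<rightarrow> carrier A \<Longrightarrow> w \<in> lists X \<Longrightarrow> word_value A g w \<in> carrier A"
  by (induction w) (auto simp: word_value_def)

lemma word_value_append:
  "g \<in> X \<rightarrow> carrier A \<Longrightarrow> u \<in> lists X \<Longrightarrow> v \<in> lists X \<Longrightarrow>
    word_value A g (u @ v) = word_value A g u \<otimes> word_value A g v"
  using word_value_closed[of g X]
  by (induction u) (auto simp: word_value_def m_assoc Pi_def)

lemma poly_value_superset:
  assumes "g \<in> X \<rightarrow> carrier A" "finite F" "{w. c w \<noteq> 0} \<subseteq> F" "F \<subseteq> lists X"
  shows "poly_value A g c = (\<Oplus>w\<in>F. c w \<odot> word_value A g w)"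
proof -
  have "word_value A g w \<in> carrier A" if "w \<in> F" for w
    using word_value_closed[OF assms(1)] assms(4) that by blast
  then show ?thesis
    unfolding poly_value_def
    by (intro add.finprod_mono_neutral_cong_left) (use assms(2,3) in auto)
qed

lemma poly_value_zero [simp]: "poly_value A g (\<lambda>_. 0) = \<zero>"
  by (simp add: poly_value_def)

lemma poly_value_closed:
  "g \<in> X \<rightarrow> carrier A \<Longrightarrow> c \<in> carrier (tensor_algebra X) \<Longrightarrow> poly_value A g c \<in> carrier A"
  unfolding poly_value_def tensor_sel using word_value_closed[of g X]
  by (intro finsum_closed) (auto simp: subset_eq)

lemma poly_value_add:
  assumes g: "g \<in> X \<rightarrow> carrier A"
    and c: "c \<in> carrier (tensor_algebra X)" and c': "c' \<in> carrier (tensor_algebra X)"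
  shows "poly_value A g (\<lambda>w. c w + c' w) = poly_value A g c \<oplus> poly_value A g c'"
proof -
  let ?F = "{w. c w \<noteq> 0} \<union> {w. c' w \<noteq> 0}"
  have F: "finite ?F" "?F \<subseteq> lists X" using c c' unfolding tensor_sel by auto
  have cl: "w \<in> ?F \<Longrightarrow> word_value A g w \<in> carrier A" for w
    using word_value_closed[OF g] F(2) by blast
  have "poly_value A g (\<lambda>w. c w + c' w) = (\<Oplus>w\<in>?F. (c w + c' w) \<odot> word_value A g w)"
    by (rule poly_value_superset[OF g F(1) _ F(2)]) auto
  also have "\<dots> = (\<Oplus>w\<in>?F. c w \<odot> word_value A g w \<oplus> c' w \<odot> word_value A g w)"
    by (rule finsum_cong') (use cl in \<open>auto simp: scale_add_left\<close>)
  also have "\<dots> = (\<Oplus>w\<in>?F. c w \<odot> word_value A g w) \<oplus> (\<Oplus>w\<in>?F. c' w \<odot> word_value A g w)"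
    by (rule finsum_addf) (use cl in auto)
  also have "\<dots> = poly_value A g c \<oplus> poly_value A g c'"
    using poly_value_superset[OF g F(1) _ F(2), of c] poly_value_superset[OF g F(1) _ F(2), of c'] by simp
  finally show ?thesis .
qed

lemma poly_value_monomial:
  assumes g: "g \<in> X \<rightarrow> carrier A" and w: "w \<in> lists X"
  shows "poly_value A g (monomial w r) = r \<odot> word_value A g w"
proof -
  have "poly_value A g (monomial w r) = (\<Oplus>v\<in>{w}. monomial w r v \<odot> word_value A g v)"
    by (rule poly_value_superset[OF g]) (use w in \<open>auto simp: monomial_def\<close>)
  also have "\<dots> = r \<odot> word_value A g w"
    using word_value_closed[OF g w] by (simp add: monomial_def)
  finally show ?thesis .
qed

lemma poly_value_scale:
  assumes g: "g \<in> X \<rightarrow> carrier A" and c: "c \<in> carrier (tensor_algebra X)"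
  shows "poly_value A g (\<lambda>w. r * c w) = r \<odot> poly_value A g c"
  using c
proof (induction c rule: tensor_induct)
  case zero show ?case by simp
next
  case (add c w s)
  have e: "(\<lambda>v. r * (monomial w s v + c v)) = (\<lambda>v. monomial w (r * s) v + r * c v)"
    by (auto simp: monomial_def algebra_simps)
  show ?case unfolding e
    using poly_value_add[OF g monomial_closed[OF add(2), of "r * s"] tensor_scale_closed[OF add(1), of r]]
      poly_value_add[OF g monomial_closed[OF add(2), of s] add(1)] add
      word_value_closed[OF g add(2)] poly_value_closed[OF g add(1)]
    by (simp add: poly_value_monomial[OF g] scale_add_right scale_scale)
qed

lemma poly_value_mult:
  assumes g: "g \<in> X \<rightarrow> carrier A"
    and c: "c \<in> carrier (tensor_algebra X)" and c': "c' \<in> carrier (tensor_algebra X)"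
  shows "poly_value A g (c \<otimes>\<^bsub>tensor_algebra X\<^esub> c') = poly_value A g c \<otimes> poly_value A g c'"
  using c
proof (induction c rule: tensor_induct)
  case zero show ?case using poly_value_closed[OF g c'] by (simp add: tensor_mult_zero)
next
  case (add c u r)
  have mono: "poly_value A g (monomial u r \<otimes>\<^bsub>tensor_algebra X\<^esub> c') =
      poly_value A g (monomial u r) \<otimes> poly_value A g c'"
    using c'
  proof (induction c' rule: tensor_induct)
    case zero show ?case
      using poly_value_closed[OF g monomial_closed[OF add(2)]] by (simp add: tensor_mult_zero)
  next
    case (add c v s)
    note u = \<open>u \<in> lists X\<close> and v = \<open>v \<in> lists X\<close>
    have uv: "u @ v \<in> lists X" using u v by simp
    have "poly_value A g (monomial u r \<otimes>\<^bsub>tensor_algebra X\<^esub> (\<lambda>w. monomial v s w + c w)) =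
        poly_value A g (monomial (u @ v) (r * s)) \<oplus> poly_value A g (monomial u r \<otimes>\<^bsub>tensor_algebra X\<^esub> c)"
      unfolding tensor_mult_distrib monomial_mult
      by (intro poly_value_add[OF g] monomial_closed[OF uv] tensor_mult_closed monomial_closed[OF u] add(1))
    also have "poly_value A g (monomial (u @ v) (r * s)) =
        poly_value A g (monomial u r) \<otimes> poly_value A g (monomial v s)"
      using word_value_closed[OF g u] word_value_closed[OF g v]
      by (simp add: poly_value_monomial[OF g] u v word_value_append[OF g u v]
          scale_mult_left scale_mult_right scale_scale mult.commute)
    finally show ?case
      using poly_value_closed[OF g monomial_closed[OF u]] poly_value_closed[OF g monomial_closed[OF v]]
        poly_value_closed[OF g add(1)]
      by (simp add: add(3) poly_value_add[OF g monomial_closed[OF v] add(1)] r_distr)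
  qed
  have "poly_value A g ((\<lambda>w. monomial u r w + c w) \<otimes>\<^bsub>tensor_algebra X\<^esub> c') =
      poly_value A g (monomial u r \<otimes>\<^bsub>tensor_algebra X\<^esub> c') \<oplus> poly_value A g (c \<otimes>\<^bsub>tensor_algebra X\<^esub> c')"
    unfolding tensor_mult_distrib
    by (intro poly_value_add[OF g] tensor_mult_closed monomial_closed add c')
  then show ?case
    using poly_value_closed[OF g monomial_closed[OF add(2)]] poly_value_closed[OF g add(1)]
      poly_value_closed[OF g c']
    by (simp add: add(3) mono poly_value_add[OF g monomial_closed[OF add(2)] add(1)] l_distr)
qed

lemma poly_value_ring_hom:
  assumes g: "g \<in> X \<rightarrow> carrier A"
  shows "ring_hom_ring (tensor_algebra X) A (poly_value A g)"
proof (rule ring_hom_ringI[OF tensor_algebra_ring ring_axioms])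
  show "poly_value A g \<one>\<^bsub>tensor_algebra X\<^esub> = \<one>"
    using poly_value_monomial[OF g, of "[]" 1] by (simp add: tensor_sel(2) word_value_def)
qed (use g in \<open>auto simp: poly_value_closed poly_value_mult poly_value_add tensor_sel(4)\<close>)

text \<open>
  The kernel of evaluation at \<open>g\<close> is an ideal. If \<open>g\<close> respects degrees, it contains the graded
  commutators of generators, and therefore the ideal by which the tensor algebra is divided.
\<close>

lemma poly_value_relations:
  assumes g: "g \<in> X \<rightarrow> carrier A" and deg: "\<And>x p. x \<in> X \<Longrightarrow> x \<in> gr M p \<Longrightarrow> g x \<in> gr A p"
    and c: "c \<in> Idl\<^bsub>tensor_algebra X\<^esub> gc_relations M X"
  shows "c \<in> carrier (tensor_algebra X)" "poly_value A g c = \<zero>"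
proof -
  interpret T: ring "tensor_algebra X" by (rule tensor_algebra_ring)
  interpret h: ring_hom_ring "tensor_algebra X" A "poly_value A g"
    by (rule poly_value_ring_hom[OF g])
  have "gc_relations M X \<subseteq> a_kernel (tensor_algebra X) A (poly_value A g)"
  proof
    fix c assume "c \<in> gc_relations M X"
    then obtain x y p q where xy: "x \<in> X" "x \<in> gr M p" "y \<in> X" "y \<in> gr M q"
      and "c = (\<lambda>w. (if w = [x, y] then 1 else 0) - (-1) powi (p * q) * (if w = [y, x] then 1 else 0))"
      unfolding gc_relations_def by blast
    then have c: "c = (\<lambda>w. monomial [x, y] 1 w + monomial [y, x] (- ((-1) powi (p * q))) w)"
      by (auto simp: monomial_def fun_eq_iff)
    have l: "[x, y] \<in> lists X" "[y, x] \<in> lists X" using xy by auto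
    note gx = deg[OF xy(1,2)] and gy = deg[OF xy(3,4)]
    note gc = homogeneous_closed[OF gx] homogeneous_closed[OF gy]
    have "poly_value A g c = g x \<otimes> g y \<oplus> (- ((-1) powi (p * q))) \<odot> (g y \<otimes> g x)"
      unfolding c using poly_value_add[OF g monomial_closed[OF l(1)] monomial_closed[OF l(2)]] gc
      by (simp add: poly_value_monomial[OF g l(1)] poly_value_monomial[OF g l(2)] word_value_def)
    also have "\<dots> = ((-1) powi (p * q) + (- ((-1) powi (p * q)))) \<odot> (g y \<otimes> g x)"
      using gc by (subst scale_add_left) (auto simp: homogeneous_comm[OF gx gy])
    also have "\<dots> = \<zero>" using gc by simp
    finally have "poly_value A g c = \<zero>" .
    moreover have cc: "c \<in> carrier (tensor_algebra X)"
      unfolding c by (intro tensor_add_closed monomial_closed l)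
    ultimately show "c \<in> a_kernel (tensor_algebra X) A (poly_value A g)"
      unfolding a_kernel_def' using cc by simp
  qed
  then have "Idl\<^bsub>tensor_algebra X\<^esub> gc_relations M X \<subseteq> a_kernel (tensor_algebra X) A (poly_value A g)"
    by (intro T.genideal_minimal h.kernel_is_ideal)
  then have "c \<in> a_kernel (tensor_algebra X) A (poly_value A g)" using c by (rule subsetD)
  then show "c \<in> carrier (tensor_algebra X)" "poly_value A g c = \<zero>"
    unfolding a_kernel_def' by simp_all
qed

end

text \<open>The algebra map \<open>M = \<Lambda>V \<rightarrow> C\<close> that extends \<open>g\<close>.\<close>

definition free_lift :: "'m dg \<Rightarrow> 'm set \<Rightarrow> 'c dg \<Rightarrow> ('m \<Rightarrow> 'c) \<Rightarrow> 'm \<Rightarrow> 'c" where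
  "free_lift M X C g m =
    poly_value C g (SOME c. c \<in> carrier (tensor_algebra X) \<and> tensor_eval M c = m)"

text \<open>A generator can be homogeneous of several degrees only if it vanishes, so the condition on
  degrees also forces its image to vanish.\<close>

locale graded_assignment = M: cdga M + C: gc_algebra C
  for M :: "'m dg" and C :: "'c dg" and X :: "'m set" and g :: "'m \<Rightarrow> 'c" +
  assumes free: "free_gc_algebra_on M X"
    and degree: "x \<in> X \<Longrightarrow> x \<in> gr M p \<Longrightarrow> g x \<in> gr C p"
begin

lemma generator_closed: "x \<in> X \<Longrightarrow> x \<in> carrier M"
  using free M.gr_closed unfolding free_gc_algebra_on_def by blast

lemma inclusion: "(\<lambda>x. x) \<in> X \<rightarrow> carrier M"
  using generator_closed by auto

lemma assignment_closed: "g \<in> X \<rightarrow> carrier C"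
  using free degree C.homogeneous_closed unfolding free_gc_algebra_on_def by blast

abbreviation lift :: "'m \<Rightarrow> 'c" where
  "lift \<equiv> free_lift M X C g"

lemma representative:
  assumes "m \<in> carrier M"
  obtains c where "c \<in> carrier (tensor_algebra X)" "m = poly_value M (\<lambda>x. x) c"
proof -
  have "m \<in> tensor_eval M ` carrier (tensor_algebra X)"
    using assms free unfolding free_gc_algebra_on_def by simp
  then show thesis using that by (auto simp: tensor_eval_eq)
qed

text \<open>
  Two polynomials with the same value in \<open>M\<close> differ by an element of the ideal of relations, so the
  choice of a representative does not matter.
\<close>

lemma lift_eval:
  assumes c: "c \<in> carrier (tensor_algebra X)"
  shows "lift (poly_value M (\<lambda>x. x) c) = poly_value C g c"
proof -
  define c' where "c' = (SOME c'. c' \<in> carrier (tensor_algebra X) \<and> tensor_eval M c' = poly_value M (\<lambda>x. x) c)"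
  have "c' \<in> carrier (tensor_algebra X) \<and> tensor_eval M c' = poly_value M (\<lambda>x. x) c"
    unfolding c'_def by (rule someI[of _ c]) (simp add: c tensor_eval_eq)
  then have c': "c' \<in> carrier (tensor_algebra X)" "poly_value M (\<lambda>x. x) c' = poly_value M (\<lambda>x. x) c"
    by (auto simp: tensor_eval_eq)
  let ?e = "\<lambda>w. c' w + (-1) * c w"
  have sc: "(\<lambda>w. (-1) * c w) \<in> carrier (tensor_algebra X)"
    using tensor_scale_closed[OF c, of "-1"] .
  have e: "?e \<in> carrier (tensor_algebra X)" by (rule tensor_add_closed[OF c'(1) sc])
  have "poly_value M (\<lambda>x. x) ?e = \<zero>\<^bsub>M\<^esub>"
    using M.poly_value_add[OF inclusion c'(1) sc] M.poly_value_scale[OF inclusion c, of "-1"] c'(2)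
      M.poly_value_closed[OF inclusion c] by (simp add: M.add_scale_minus_one)
  then have "?e \<in> Idl\<^bsub>tensor_algebra X\<^esub> gc_relations M X"
    using e free unfolding free_gc_algebra_on_def a_kernel_def' by (auto simp: tensor_eval_eq)
  then have "poly_value C g ?e = \<zero>\<^bsub>C\<^esub>"
    by (rule C.poly_value_relations(2)[OF assignment_closed, rotated]) (rule degree)
  then have "poly_value C g c' \<ominus>\<^bsub>C\<^esub> poly_value C g c = \<zero>\<^bsub>C\<^esub>"
    using C.poly_value_add[OF assignment_closed c'(1) sc] C.poly_value_scale[OF assignment_closed c, of "-1"]
      C.poly_value_closed[OF assignment_closed c] by (simp add: C.minus_eq_scale)
  then show ?thesis
    using C.poly_value_closed[OF assignment_closed] c c'(1) unfolding free_lift_def c'_def[symmetric] by simp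
qed

lemma lift_closed: "m \<in> carrier M \<Longrightarrow> lift m \<in> carrier C"
  by (erule representative) (simp add: lift_eval C.poly_value_closed[OF assignment_closed])

lemma lift_add:
  assumes "m \<in> carrier M" "m' \<in> carrier M"
  shows "lift (m \<oplus>\<^bsub>M\<^esub> m') = lift m \<oplus>\<^bsub>C\<^esub> lift m'"
proof -
  obtain c where c: "c \<in> carrier (tensor_algebra X)" "m = poly_value M (\<lambda>x. x) c"
    using representative[OF assms(1)] .
  obtain c' where c': "c' \<in> carrier (tensor_algebra X)" "m' = poly_value M (\<lambda>x. x) c'"
    using representative[OF assms(2)] .
  show ?thesis
    using lift_eval[OF tensor_add_closed[OF c(1) c'(1)]] c c'
    by (simp add: lift_eval C.poly_value_add[OF assignment_closed] M.poly_value_add[OF inclusion])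
qed

lemma lift_scale:
  assumes "m \<in> carrier M"
  shows "lift (r \<odot>\<^bsub>M\<^esub> m) = r \<odot>\<^bsub>C\<^esub> lift m"
proof -
  obtain c where c: "c \<in> carrier (tensor_algebra X)" "m = poly_value M (\<lambda>x. x) c"
    using representative[OF assms(1)] .
  show ?thesis
    using lift_eval[OF tensor_scale_closed[OF c(1)], of r] c
    by (simp add: lift_eval C.poly_value_scale[OF assignment_closed] M.poly_value_scale[OF inclusion])
qed

lemma lift_mult:
  assumes "m \<in> carrier M" "m' \<in> carrier M"
  shows "lift (m \<otimes>\<^bsub>M\<^esub> m') = lift m \<otimes>\<^bsub>C\<^esub> lift m'"
proof -
  obtain c where c: "c \<in> carrier (tensor_algebra X)" "m = poly_value M (\<lambda>x. x) c"
    using representative[OF assms(1)] .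
  obtain c' where c': "c' \<in> carrier (tensor_algebra X)" "m' = poly_value M (\<lambda>x. x) c'"
    using representative[OF assms(2)] .
  show ?thesis
    using lift_eval[OF tensor_mult_closed[OF c(1) c'(1)]] c c'
    by (simp add: lift_eval C.poly_value_mult[OF assignment_closed] M.poly_value_mult[OF inclusion])
qed

lemma lift_word: "w \<in> lists X \<Longrightarrow> lift (word_value M (\<lambda>x. x) w) = word_value C g w"
  using lift_eval[OF monomial_closed, of w 1] M.word_value_closed[OF inclusion, of w]
    C.word_value_closed[OF assignment_closed, of w]
  by (simp add: M.poly_value_monomial[OF inclusion] C.poly_value_monomial[OF assignment_closed])

lemma lift_one: "lift \<one>\<^bsub>M\<^esub> = \<one>\<^bsub>C\<^esub>"
  using lift_word[of "[]"] by (simp add: word_value_def)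

lemma lift_zero: "lift \<zero>\<^bsub>M\<^esub> = \<zero>\<^bsub>C\<^esub>"
  using lift_scale[of "\<zero>\<^bsub>M\<^esub>" 0] lift_closed[of "\<zero>\<^bsub>M\<^esub>"] by simp

lemma lift_generator: "x \<in> X \<Longrightarrow> lift x = g x"
  using lift_word[of "[x]"] generator_closed[of x] assignment_closed
  by (simp add: word_value_def Pi_iff)

lemma lift_hom: "lift \<in> LinearCombinations.module_hom RR M C"
  by (rule module_homI) (auto simp: lift_closed lift_add lift_scale)

lemma word_degree:
  "w \<in> lists X \<Longrightarrow> \<exists>p. word_value M (\<lambda>x. x) w \<in> gr M p \<and> word_value C g w \<in> gr C p"
proof (induction w)
  case Nil show ?case
    using M.one_degree C.homogeneous_one by (auto simp: word_value_def)
next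
  case (Cons x w)
  then obtain p where p: "word_value M (\<lambda>x. x) w \<in> gr M p" "word_value C g w \<in> gr C p" by auto
  obtain q where q: "x \<in> gr M q" using Cons free unfolding free_gc_algebra_on_def by auto
  then have "g x \<in> gr C q" using degree Cons by auto
  with p q have "x \<otimes>\<^bsub>M\<^esub> word_value M (\<lambda>x. x) w \<in> gr M (q + p)" "g x \<otimes>\<^bsub>C\<^esub> word_value C g w \<in> gr C (q + p)"
    using M.mult_degree C.homogeneous_mult by auto
  then show ?case by (auto simp: word_value_def)
qed

text \<open>
  An element of degree \<open>k\<close> may be represented by a polynomial with words of several degrees. Taking
  the component of degree \<open>k\<close> in \<open>M\<close> removes the superfluous words and leaves the element unchanged.
\<close>

lemma lift_degree:
  assumes "m \<in> gr M k" shows "lift m \<in> gr C k"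
proof -
  obtain c where c: "c \<in> carrier (tensor_algebra X)" "m = poly_value M (\<lambda>x. x) c"
    using representative[OF M.gr_closed[OF assms]] .
  have "lift (M.component k (poly_value M (\<lambda>x. x) c)) \<in> gr C k"
    using c(1)
  proof (induction c rule: tensor_induct)
    case zero show ?case
      using M.component_homogeneous[OF M.gr_zero] by (simp add: lift_zero C.homogeneous_zero)
  next
    case (add c w r)
    obtain p where p: "word_value M (\<lambda>x. x) w \<in> gr M p" "word_value C g w \<in> gr C p"
      using word_degree[OF add(2)] by auto
    have w: "word_value M (\<lambda>x. x) w \<in> carrier M" using M.gr_closed p(1) by auto
    have "lift (M.component k (word_value M (\<lambda>x. x) w)) \<in> gr C k"
      using M.component_homogeneous[OF p(1)] p(2) lift_word[OF add(2)]
      by (simp add: lift_zero C.homogeneous_zero)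
    then show ?case
      using add(3) M.poly_value_closed[OF inclusion add(1)] w
      by (simp add: M.poly_value_add[OF inclusion monomial_closed[OF add(2)] add(1)]
          M.poly_value_monomial[OF inclusion add(2)] M.component_add M.component_scale lift_add lift_scale
          C.homogeneous_add C.homogeneous_scale)
  qed
  then show ?thesis using M.component_homogeneous[OF assms] c(2) by simp
qed

text \<open>
  On the subalgebra generated by \<open>Y\<close> only the values of \<open>g\<close> on \<open>Y\<close> matter. This lets a map on all of
  \<open>M\<close> be constructed by recursion over the generators.
\<close>

lemma lift_cong:
  assumes g': "graded_assignment M C X g'" and Y: "Y \<subseteq> X" and eq: "\<And>y. y \<in> Y \<Longrightarrow> g y = g' y"
    and m: "m \<in> tensor_eval M ` carrier (tensor_algebra Y)"
  shows "free_lift M X C g m = free_lift M X C g' m"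
proof -
  interpret g': graded_assignment M C X g' by fact
  obtain c where c: "c \<in> carrier (tensor_algebra Y)" "m = poly_value M (\<lambda>x. x) c"
    using m by (auto simp: tensor_eval_eq)
  have cX: "c \<in> carrier (tensor_algebra X)"
    using c(1) lists_mono[OF Y] unfolding tensor_sel by blast
  have word: "word_value C g w = word_value C g' w" if "w \<in> lists Y" for w
    using that by (induction w) (auto simp: word_value_def eq)
  have "poly_value C g c = poly_value C g' c" unfolding poly_value_def
  proof (rule C.finsum_cong')
    show "(\<lambda>w. c w \<odot>\<^bsub>C\<^esub> word_value C g' w) \<in> {w. c w \<noteq> 0} \<rightarrow> carrier C"
      using cX C.word_value_closed[OF g'.assignment_closed] unfolding tensor_sel by (auto simp: subset_eq)
  qed (use c(1) word in \<open>auto simp: tensor_sel subset_eq\<close>)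
  then show ?thesis using c(2) lift_eval[OF cX] g'.lift_eval[OF cX] by simp
qed

text \<open>It suffices to multiply by generators on the left, since words are bracketed to the right.\<close>

lemma subalgebra_induct [consumes 2, case_names one add scale mult]:
  assumes m: "m \<in> tensor_eval M ` carrier (tensor_algebra Y)" and Y: "Y \<subseteq> X"
    and one: "P \<one>\<^bsub>M\<^esub>"
    and add: "\<And>m m'. m \<in> carrier M \<Longrightarrow> m' \<in> carrier M \<Longrightarrow> P m \<Longrightarrow> P m' \<Longrightarrow> P (m \<oplus>\<^bsub>M\<^esub> m')"
    and scale: "\<And>r m. m \<in> carrier M \<Longrightarrow> P m \<Longrightarrow> P (r \<odot>\<^bsub>M\<^esub> m)"
    and mult: "\<And>y m. y \<in> Y \<Longrightarrow> m \<in> carrier M \<Longrightarrow> P m \<Longrightarrow> P (y \<otimes>\<^bsub>M\<^esub> m)"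
  shows "P m"
proof -
  have incl: "(\<lambda>x. x) \<in> Y \<rightarrow> carrier M" using Y generator_closed by auto
  obtain c where c: "c \<in> carrier (tensor_algebra Y)" "m = poly_value M (\<lambda>x. x) c"
    using m by (auto simp: tensor_eval_eq)
  have word: "P (word_value M (\<lambda>x. x) w)" if "w \<in> lists Y" for w
    using that
  proof (induction w)
    case Nil show ?case using one by (simp add: word_value_def)
  next
    case (Cons y w)
    then show ?case using mult[of y "word_value M (\<lambda>x. x) w"] M.word_value_closed[OF incl]
      by (simp add: word_value_def)
  qed
  have "P (poly_value M (\<lambda>x. x) c)" using c(1)
  proof (induction c rule: tensor_induct)
    case zero show ?case using scale[OF M.one_closed one, of 0] by simp
  next
    case (add c w r)
    then show ?case
      using assms(4)[of "r \<odot>\<^bsub>M\<^esub> word_value M (\<lambda>x. x) w"] scale[OF _ word[OF add(2)]]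
        M.word_value_closed[OF incl add(2)] M.poly_value_closed[OF incl add(1)]
      by (simp add: M.poly_value_add[OF incl monomial_closed[OF add(2)] add(1)]
          M.poly_value_monomial[OF incl add(2)])
  qed
  then show ?thesis using c(2) by simp
qed

end

section \<open>Polynomial paths in a vector space\<close>

text \<open>
  \<open>poly_deriv V p p'\<close> says that \<open>p\<close> is a polynomial function of a real parameter with coefficients in
  \<open>V\<close>, and that \<open>p'\<close> is its formal derivative. As a relation between functions it needs no coefficient
  sequences, so products of paths are pointwise products.
\<close>

inductive poly_deriv :: "(real, 'a, 'c) module_scheme \<Rightarrow> (real \<Rightarrow> 'a) \<Rightarrow> (real \<Rightarrow> 'a) \<Rightarrow> bool"
  for V where
  monomial: "a \<in> carrier V \<Longrightarrow>
    poly_deriv V (\<lambda>t. t ^ n \<odot>\<^bsub>V\<^esub> a) (\<lambda>t. (real n * t ^ (n - 1)) \<odot>\<^bsub>V\<^esub> a)"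
| add: "poly_deriv V p p' \<Longrightarrow> poly_deriv V q q' \<Longrightarrow>
    poly_deriv V (\<lambda>t. p t \<oplus>\<^bsub>V\<^esub> q t) (\<lambda>t. p' t \<oplus>\<^bsub>V\<^esub> q' t)"

context real_vs
begin

lemma poly_deriv_closed:
  assumes "poly_deriv V p p'" shows "p t \<in> carrier V" "p' t \<in> carrier V"
  using assms by (induction) auto

lemma poly_deriv_const: "a \<in> carrier V \<Longrightarrow> poly_deriv V (\<lambda>_. a) (\<lambda>_. \<zero>)"
  using poly_deriv.monomial[of a V 0] by simp

lemma poly_deriv_scale:
  assumes "poly_deriv V p p'" shows "poly_deriv V (\<lambda>t. r \<odot> p t) (\<lambda>t. r \<odot> p' t)"
  using assms
proof induction
  case (monomial a n)
  then show ?case using poly_deriv.monomial[of "r \<odot> a" V n] by (simp add: scale_scale mult.commute)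
next
  case (add p p' q q')
  then show ?case
    using poly_deriv.add[OF add.IH] poly_deriv_closed[OF add(1)] poly_deriv_closed[OF add(2)]
    by (simp add: scale_add_right)
qed

lemma poly_deriv_linear:
  assumes "poly_deriv V p p'" and W: "vectorspace RR W" and f: "f \<in> LinearCombinations.module_hom RR V W"
  shows "poly_deriv W (\<lambda>t. f (p t)) (\<lambda>t. f (p' t))"
  using assms(1)
proof induction
  case (monomial a n)
  then have "f a \<in> carrier W" using f unfolding LinearCombinations.module_hom_def by auto
  from poly_deriv.monomial[OF this, of n] show ?case
    using monomial LinearCombinations.module_hom_smult[OF f] by simp
next
  case (add p p' q q')
  then show ?case
    using poly_deriv.add[OF add.IH] poly_deriv_closed[OF add(1)] poly_deriv_closed[OF add(2)]
    by (simp add: LinearCombinations.module_hom_add[OF f])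
qed

lemma polynomial_antiderivative:
  assumes "poly_deriv V q q'" shows "\<exists>Q. poly_deriv V Q q \<and> Q 0 = \<zero>"
  using assms
proof induction
  case (monomial a n)
  have "real (Suc n) * (x * (1 / real (Suc n))) = x" for x by simp
  then show ?case
    using monomial poly_deriv.monomial[of "(1 / real (Suc n)) \<odot> a" V "Suc n"]
    by (intro exI[of _ "\<lambda>t. t ^ Suc n \<odot> ((1 / real (Suc n)) \<odot> a)"])
      (simp add: scale_scale del: of_nat_Suc)
next
  case (add p p' q q')
  then obtain P Q where PQ: "poly_deriv V P p" "P 0 = \<zero>" "poly_deriv V Q q" "Q 0 = \<zero>" by blast
  show ?case
    by (rule exI[of _ "\<lambda>t. P t \<oplus> Q t"]) (use PQ poly_deriv.add in auto)
qed

text \<open>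
  A common coefficient sequence for \<open>p\<close> and \<open>p'\<close>. The sums may be extended to any larger \<open>N\<close>, so that
  two paths can be added.
\<close>

lemma poly_deriv_coefficients:
  assumes "poly_deriv V p p'"
  shows "\<exists>n a. (\<forall>i. a i \<in> carrier V) \<and> (\<forall>N\<ge>n. \<forall>t. p t = (\<Oplus>i\<in>{..<N}. t ^ i \<odot> a i)
    \<and> p' t = (\<Oplus>i\<in>{..<N}. (real i * t ^ (i - 1)) \<odot> a i))"
  using assms
proof induction
  case (monomial a n)
  let ?a = "\<lambda>i. if i = n then a else \<zero>"
  have *: "(\<Oplus>i\<in>{..<N}. f i \<odot> ?a i) = f n \<odot> a" if "N \<ge> Suc n" for N f
  proof -
    have "(\<Oplus>i\<in>{..<N}. f i \<odot> ?a i) = (\<Oplus>i\<in>{..<N}. if n = i then f i \<odot> a else \<zero>)"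
      by (rule finsum_cong') (use monomial in auto)
    also have "\<dots> = f n \<odot> a"
      by (rule finsum_singleton) (use monomial that in auto)
    finally show ?thesis .
  qed
  show ?case
    by (rule exI[of _ "Suc n"], rule exI[of _ ?a])
      (use monomial *[of _ "\<lambda>i. _ ^ i"] *[of _ "\<lambda>i. real i * _ ^ (i - 1)"] in auto)
next
  case (add p p' q q')
  obtain n a where a: "\<forall>i. a i \<in> carrier V" "\<forall>N\<ge>n. \<forall>t. p t = (\<Oplus>i\<in>{..<N}. t ^ i \<odot> a i)
    \<and> p' t = (\<Oplus>i\<in>{..<N}. (real i * t ^ (i - 1)) \<odot> a i)" using add.IH(1) by blast
  obtain m b where b: "\<forall>i. b i \<in> carrier V" "\<forall>N\<ge>m. \<forall>t. q t = (\<Oplus>i\<in>{..<N}. t ^ i \<odot> b i)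
    \<and> q' t = (\<Oplus>i\<in>{..<N}. (real i * t ^ (i - 1)) \<odot> b i)" using add.IH(2) by blast
  have *: "(\<Oplus>i\<in>{..<N}. f i \<odot> (a i \<oplus> b i)) =
      (\<Oplus>i\<in>{..<N}. f i \<odot> a i) \<oplus> (\<Oplus>i\<in>{..<N}. f i \<odot> b i)" for f and N :: nat
  proof -
    have "(\<Oplus>i\<in>{..<N}. f i \<odot> (a i \<oplus> b i)) =
        (\<Oplus>i\<in>{..<N}. f i \<odot> a i \<oplus> f i \<odot> b i)"
      by (rule finsum_cong') (use a(1) b(1) in \<open>auto simp: scale_add_right\<close>)
    also have "\<dots> = (\<Oplus>i\<in>{..<N}. f i \<odot> a i) \<oplus> (\<Oplus>i\<in>{..<N}. f i \<odot> b i)"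
      by (rule finsum_addf) (use a(1) b(1) in auto)
    finally show ?thesis .
  qed
  show ?case
  proof (rule exI[of _ "max n m"], rule exI[of _ "\<lambda>i. a i \<oplus> b i"], intro conjI allI impI)
    fix N t assume "max n m \<le> N"
    then have N: "n \<le> N" "m \<le> N" by auto
    show "p t \<oplus> q t = (\<Oplus>i\<in>{..<N}. t ^ i \<odot> (a i \<oplus> b i))"
      unfolding * using a(2) b(2) N by simp
    show "p' t \<oplus> q' t = (\<Oplus>i\<in>{..<N}. (real i * t ^ (i - 1)) \<odot> (a i \<oplus> b i))"
      unfolding * using a(2) b(2) N by simp
  qed (use a(1) b(1) in auto)
qed

text \<open>
  A polynomial \<open>f\<close> with coefficients \<open>a\<^sub>0, \<dots>, a\<^sub>n\<close> that vanishes at every real number has no nonzero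
  coefficient: \<open>f(2t) - 2\<^sup>n f(t)\<close> has lower degree and vanishes as well.
\<close>

lemma vanishing_polynomial:
  assumes "\<forall>i. a i \<in> carrier V" "\<forall>t. (\<Oplus>i\<in>{..<n}. t ^ i \<odot> a i) = \<zero>" "i < n"
  shows "a i = \<zero>"
  using assms
proof (induction n arbitrary: a i)
  case (Suc n)
  note a = Suc.prems(1)[rule_format]
  define S where "S t = (\<Oplus>i\<in>{..<n}. t ^ i \<odot> a i)" for t
  have S: "S t \<in> carrier V" for t unfolding S_def using a by (intro finsum_closed) auto
  have split: "t ^ n \<odot> a n \<oplus> S t = \<zero>" for t
    using Suc.prems(2)[rule_format, of t] a
    by (simp add: S_def lessThan_Suc finsum_insert Pi_def)
  let ?b = "\<lambda>i. (2 ^ i - 2 ^ n) \<odot> a i"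
  have "(\<Oplus>i\<in>{..<n}. t ^ i \<odot> ?b i) = \<zero>" for t
  proof -
    have "(\<Oplus>i\<in>{..<n}. t ^ i \<odot> ?b i) =
        (\<Oplus>i\<in>{..<n}. (2 * t) ^ i \<odot> a i \<oplus> (- (2 ^ n)) \<odot> (t ^ i \<odot> a i))"
      using a by (intro finsum_cong')
        (auto simp: scale_scale scale_add_left[symmetric] power_mult_distrib algebra_simps)
    also have "\<dots> = S (2 * t) \<oplus> (\<Oplus>i\<in>{..<n}. (- (2 ^ n)) \<odot> (t ^ i \<odot> a i))"
      unfolding S_def using a by (intro finsum_addf) auto
    also have "\<dots> = S (2 * t) \<oplus> (- (2 ^ n)) \<odot> S t"
      unfolding S_def using a by (subst scale_finsum) auto
    also have "\<dots> = ((2 * t) ^ n \<odot> a n \<oplus> S (2 * t)) \<oplus> (- (2 ^ n)) \<odot> (t ^ n \<odot> a n \<oplus> S t)"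
    proof -
      have "(2 * t) ^ n \<odot> a n \<oplus> (- (2 ^ n)) \<odot> (t ^ n \<odot> a n) = \<zero>"
        using a by (simp add: scale_scale scale_add_left[symmetric] power_mult_distrib)
      then have "(S (2 * t) \<oplus> (- (2 ^ n)) \<odot> S t) =
        ((2 * t) ^ n \<odot> a n \<oplus> (- (2 ^ n)) \<odot> (t ^ n \<odot> a n)) \<oplus>
          (S (2 * t) \<oplus> (- (2 ^ n)) \<odot> S t)"
        using S by (simp only: l_zero a_closed scale_closed)
      also have "\<dots> = ((2 * t) ^ n \<odot> a n \<oplus> S (2 * t)) \<oplus> (- (2 ^ n)) \<odot> (t ^ n \<odot> a n \<oplus> S t)"
        using S a by (simp add: scale_add_right a_ac)
      finally show ?thesis .
    qed
    also have "\<dots> = \<zero>" by (simp only: split scale_zero_right r_zero zero_closed)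
    finally show ?thesis .
  qed
  then have b: "?b i = \<zero>" if "i < n" for i
    using Suc.IH[of ?b i] a that by simp
  have low: "a i = \<zero>" if "i < n" for i
    using b[OF that] a scale_eq_zero_iff[of "a i" "2 ^ i - 2 ^ n"] that by simp
  have "S 1 = \<zero>"
    unfolding S_def using low by (simp cong: finsum_cong add: Pi_def simp_implies_def)
  then have "a n = \<zero>" using split[of 1] a by simp
  with low Suc.prems(3) show ?case by (cases "i = n") auto
qed simp

lemma poly_deriv_zero_imp_const:
  assumes p: "poly_deriv V p (\<lambda>_. \<zero>)"
  shows "p t = p 0"
proof -
  obtain n a where na: "\<forall>i. a i \<in> carrier V" "\<forall>N\<ge>n. \<forall>t. p t = (\<Oplus>i\<in>{..<N}. t ^ i \<odot> a i)
    \<and> \<zero> = (\<Oplus>i\<in>{..<N}. (real i * t ^ (i - 1)) \<odot> a i)"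
    using poly_deriv_coefficients[OF p] by blast
  note a = na(1)[rule_format]
  have "(\<Oplus>i\<in>{..<n}. t ^ i \<odot> (real i \<odot> a i)) = \<zero>" for t
  proof -
    have *: "t ^ i * real i = t * (real i * t ^ (i - 1))" for i by (cases i) auto
    have "(\<Oplus>i\<in>{..<n}. t ^ i \<odot> (real i \<odot> a i)) =
        (\<Oplus>i\<in>{..<n}. t \<odot> ((real i * t ^ (i - 1)) \<odot> a i))"
      using a by (intro finsum_cong') (auto simp: scale_scale *)
    also have "\<dots> = t \<odot> (\<Oplus>i\<in>{..<n}. (real i * t ^ (i - 1)) \<odot> a i)"
      using a by (intro scale_finsum[symmetric]) auto
    also have "(\<Oplus>i\<in>{..<n}. (real i * t ^ (i - 1)) \<odot> a i) = \<zero>"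
      by (rule na(2)[rule_format, THEN conjunct2, symmetric]) simp
    finally show ?thesis by simp
  qed
  then have "real i \<odot> a i = \<zero>" if "i < n" for i
    using vanishing_polynomial[of "\<lambda>i. real i \<odot> a i" n i] a that by simp
  then have a0: "a i = \<zero>" if "i < n" "i > 0" for i
    using scale_eq_zero_iff[of "a i" "real i"] a that by auto
  have "(\<Oplus>i\<in>{..<n}. t ^ i \<odot> a i) = (\<Oplus>i\<in>{..<n}. 0 ^ i \<odot> a i)"
    using a a0 by (intro finsum_cong') (auto simp: neq0_conv power_0_left)
  then show ?thesis
    using na(2)[rule_format, of n t, THEN conjunct1] na(2)[rule_format, of n 0, THEN conjunct1] by simp
qed

lemma equal_derivatives:
  assumes p: "poly_deriv V p r" and q: "poly_deriv V q r" and q0: "q 0 = \<zero>"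
  shows "p t = p 0 \<oplus> q t"
proof -
  note c = poly_deriv_closed[OF p] poly_deriv_closed[OF q]
  have "poly_deriv V (\<lambda>t. p t \<oplus> (-1) \<odot> q t) (\<lambda>t. r t \<oplus> (-1) \<odot> r t)"
    by (intro poly_deriv.add p poly_deriv_scale q)
  then have "poly_deriv V (\<lambda>t. p t \<oplus> (-1) \<odot> q t) (\<lambda>t. \<zero>)"
    using c by (simp add: add_scale_minus_one)
  then have "p t \<oplus> (-1) \<odot> q t = p 0 \<oplus> (-1) \<odot> q 0"
    by (rule poly_deriv_zero_imp_const)
  then have e: "p t \<oplus> (-1) \<odot> q t = p 0" using c q0 by simp
  have "p t = p t \<oplus> (q t \<oplus> (-1) \<odot> q t)" using c by (simp add: add_scale_minus_one)
  also have "\<dots> = (p t \<oplus> (-1) \<odot> q t) \<oplus> q t" using c by (simp add: a_ac)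
  finally show ?thesis by (simp add: e)
qed

end

lemma (in gc_algebra) poly_deriv_mult:
  assumes "poly_deriv A p p'" "poly_deriv A q q'"
  shows "poly_deriv A (\<lambda>t. p t \<otimes> q t) (\<lambda>t. p' t \<otimes> q t \<oplus> p t \<otimes> q' t)"
  using assms(1)
proof induction
  case (monomial a n)
  note a = this
  show ?case using assms(2)
  proof induction
    case (monomial b m)
    have e: "real (n + m) * t ^ (n + m - 1) = real n * t ^ (n - 1) * t ^ m + t ^ n * (real m * t ^ (m - 1))" for t
      by (cases n; cases m) (auto simp: algebra_simps power_add)
    have "(\<lambda>t. t ^ (n + m) \<odot> (a \<otimes> b)) = (\<lambda>t. (t ^ n \<odot> a) \<otimes> (t ^ m \<odot> b))"
      using a monomial by (simp add: scale_mult_left scale_mult_right scale_scale power_add mult.commute)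
    moreover have "(\<lambda>t. (real (n + m) * t ^ (n + m - 1)) \<odot> (a \<otimes> b)) =
        (\<lambda>t. ((real n * t ^ (n - 1)) \<odot> a) \<otimes> (t ^ m \<odot> b) \<oplus>
          (t ^ n \<odot> a) \<otimes> ((real m * t ^ (m - 1)) \<odot> b))"
      unfolding e using a monomial
      by (simp add: scale_mult_left scale_mult_right scale_scale scale_add_left mult.commute)
    ultimately show ?case
      using poly_deriv.monomial[of "a \<otimes> b" A "n + m"] a monomial by (simp only: m_closed)
  next
    case (add p p' q q')
    note c = poly_deriv_closed[OF add(1)] poly_deriv_closed[OF add(2)]
    from poly_deriv.add[OF add.IH] show ?case using a c by (simp add: r_distr a_ac)
  qed
next
  case (add p p' r r')
  note c = poly_deriv_closed[OF add(1)] poly_deriv_closed[OF add(2)] poly_deriv_closed[OF assms(2)]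
  from poly_deriv.add[OF add.IH] show ?case using c by (simp add: l_distr a_ac)
qed

section \<open>Polynomial homotopies\<close>

text \<open>
  The algebra in which the value at time \<open>t\<close> of a homotopy \<open>p + dt q\<close> lives. Since \<open>dt\<close> anticommutes
  with odd elements, the product is \<open>(p + dt q)(p' + dt q') = pp' + dt (qp' + \<sigma>(p)q')\<close>, where \<open>\<sigma>\<close> is the
  sign involution of \<open>A\<close>. A triple \<open>(u, p, q)\<close> stands for the triangular matrix with diagonal \<open>u, p\<close> and
  corner \<open>q\<close>; such matrices form a ring under the usual product without any grading, and the homogeneous
  ones are those with \<open>u = \<sigma>(p)\<close>.
\<close>

definition homotopy_algebra :: "'a dg \<Rightarrow> ('a \<times> 'a \<times> 'a) dg" where
  "homotopy_algebra A = \<lparr>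
     carrier = carrier A \<times> carrier A \<times> carrier A,
     mult = (\<lambda>(u, p, q) (u', p', q'). (u \<otimes>\<^bsub>A\<^esub> u', p \<otimes>\<^bsub>A\<^esub> p', u \<otimes>\<^bsub>A\<^esub> q' \<oplus>\<^bsub>A\<^esub> q \<otimes>\<^bsub>A\<^esub> p')),
     one = (\<one>\<^bsub>A\<^esub>, \<one>\<^bsub>A\<^esub>, \<zero>\<^bsub>A\<^esub>),
     zero = (\<zero>\<^bsub>A\<^esub>, \<zero>\<^bsub>A\<^esub>, \<zero>\<^bsub>A\<^esub>),
     add = (\<lambda>(u, p, q) (u', p', q'). (u \<oplus>\<^bsub>A\<^esub> u', p \<oplus>\<^bsub>A\<^esub> p', q \<oplus>\<^bsub>A\<^esub> q')),
     smult = (\<lambda>r (u, p, q). (r \<odot>\<^bsub>A\<^esub> u, r \<odot>\<^bsub>A\<^esub> p, r \<odot>\<^bsub>A\<^esub> q)),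
     gr = (\<lambda>k. {(u, p, q). p \<in> gr A k \<and> q \<in> gr A (k - 1) \<and> u = ((-1) powi k) \<odot>\<^bsub>A\<^esub> p}),
     diff = undefined\<rparr>"

lemma homotopy_algebra_sel [simp]:
  "carrier (homotopy_algebra A) = carrier A \<times> carrier A \<times> carrier A"
  "(u, p, q) \<otimes>\<^bsub>homotopy_algebra A\<^esub> (u', p', q') =
    (u \<otimes>\<^bsub>A\<^esub> u', p \<otimes>\<^bsub>A\<^esub> p', u \<otimes>\<^bsub>A\<^esub> q' \<oplus>\<^bsub>A\<^esub> q \<otimes>\<^bsub>A\<^esub> p')"
  "\<one>\<^bsub>homotopy_algebra A\<^esub> = (\<one>\<^bsub>A\<^esub>, \<one>\<^bsub>A\<^esub>, \<zero>\<^bsub>A\<^esub>)"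
  "\<zero>\<^bsub>homotopy_algebra A\<^esub> = (\<zero>\<^bsub>A\<^esub>, \<zero>\<^bsub>A\<^esub>, \<zero>\<^bsub>A\<^esub>)"
  "(u, p, q) \<oplus>\<^bsub>homotopy_algebra A\<^esub> (u', p', q') = (u \<oplus>\<^bsub>A\<^esub> u', p \<oplus>\<^bsub>A\<^esub> p', q \<oplus>\<^bsub>A\<^esub> q')"
  "r \<odot>\<^bsub>homotopy_algebra A\<^esub> (u, p, q) = (r \<odot>\<^bsub>A\<^esub> u, r \<odot>\<^bsub>A\<^esub> p, r \<odot>\<^bsub>A\<^esub> q)"
  "(u, p, q) \<in> gr (homotopy_algebra A) k \<longleftrightarrow>
    p \<in> gr A k \<and> q \<in> gr A (k - 1) \<and> u = ((-1) powi k) \<odot>\<^bsub>A\<^esub> p"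
  by (simp_all add: homotopy_algebra_def)

lemma sign_powi: "(-1::real) powi k = (if even k then 1 else -1)"
  by (simp add: power_int_minus_left)

context gc_algebra
begin

lemma homotopy_algebra_real_vs: "real_vs (homotopy_algebra A)"
proof (intro real_vs.intro vectorspace.intro moduleI abelian_groupI)
  show "cring RR" by (rule class_cring.is_cring)
  show "field RR" by (rule class_field)
  fix x assume "x \<in> carrier (homotopy_algebra A)"
  then show "\<exists>y\<in>carrier (homotopy_algebra A). y \<oplus>\<^bsub>homotopy_algebra A\<^esub> x = \<zero>\<^bsub>homotopy_algebra A\<^esub>"
    by (cases x) (auto simp: a_comm add_scale_minus_one
        intro!: bexI[of _ "(-1) \<odot>\<^bsub>homotopy_algebra A\<^esub> x"])
qed (auto simp: a_ac scale_add_left scale_add_right scale_scale)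

text \<open>
  Graded commutativity in the corner of the matrices. Moving \<open>p\<close> past \<open>q'\<close> costs \<open>(-1)\<^sup>k\<^sup>(\<^sup>l\<^sup>-\<^sup>1\<^sup>)\<close>, which
  together with the sign \<open>(-1)\<^sup>k\<close> of the involution gives \<open>(-1)\<^sup>k\<^sup>l\<close>; likewise for \<open>q\<close> and \<open>p'\<close>.
\<close>

lemma homotopy_algebra_comm:
  assumes "p \<in> gr A k" "q \<in> gr A (k - 1)" "p' \<in> gr A l" "q' \<in> gr A (l - 1)"
  shows "((-1) powi k) \<odot> p \<otimes> q' \<oplus> q \<otimes> p' =
    ((-1) powi (k * l)) \<odot> (((-1) powi l) \<odot> p' \<otimes> q \<oplus> q' \<otimes> p)"
proof -
  note c = assms[THEN homogeneous_closed]
  show ?thesis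
    using c homogeneous_comm[OF assms(1,4)] homogeneous_comm[OF assms(2,3)]
    by (cases "even k"; cases "even l")
      (simp_all add: sign_powi scale_mult_left scale_add_right scale_scale a_comm)
qed

lemma homotopy_algebra_gc: "gc_algebra (homotopy_algebra A)"
proof -
  interpret H: real_vs "homotopy_algebra A" by (rule homotopy_algebra_real_vs)
  have ring: "ring (homotopy_algebra A)"
  proof (intro ringI monoidI H.abelian_group_axioms)
  qed (auto simp: m_assoc l_distr r_distr a_ac)
  show ?thesis
  proof (intro gc_algebra.intro homotopy_algebra_real_vs ring gc_algebra_axioms.intro)
    fix x y p q assume "x \<in> gr (homotopy_algebra A) p" "y \<in> gr (homotopy_algebra A) q"
    then show "x \<otimes>\<^bsub>homotopy_algebra A\<^esub> y =
        ((-1) powi (p * q)) \<odot>\<^bsub>homotopy_algebra A\<^esub> (y \<otimes>\<^bsub>homotopy_algebra A\<^esub> x)"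
      by (cases x; cases y) (auto simp: homotopy_algebra_comm homogeneous_closed scale_mult_left
          scale_mult_right scale_scale homogeneous_comm[of _ p _ q] mult.commute mult.left_commute)
  next
    fix x y p q assume xy: "x \<in> gr (homotopy_algebra A) p" "y \<in> gr (homotopy_algebra A) q"
    obtain a b where x: "x = (((-1) powi p) \<odot> a, a, b)" "a \<in> gr A p" "b \<in> gr A (p - 1)"
      using xy(1) by (cases x) auto
    obtain c e where y: "y = (((-1) powi q) \<odot> c, c, e)" "c \<in> gr A q" "e \<in> gr A (q - 1)"
      using xy(2) by (cases y) auto
    have "a \<otimes> e \<in> gr A (p + q - 1)" "b \<otimes> c \<in> gr A (p + q - 1)"
      using homogeneous_mult[OF x(2) y(3)] homogeneous_mult[OF x(3) y(2)] by (auto simp: algebra_simps)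
    then show "x \<otimes>\<^bsub>homotopy_algebra A\<^esub> y \<in> gr (homotopy_algebra A) (p + q)"
      using x y homogeneous_mult[OF x(2) y(2)]
      by (simp add: homogeneous_closed scale_mult_left scale_mult_right scale_scale homogeneous_add
          homogeneous_scale power_int_add mult.commute)
  qed (auto simp: scale_mult_left scale_mult_right scale_add_right scale_scale homogeneous_closed
      homogeneous_zero homogeneous_add homogeneous_scale homogeneous_one mult.commute)
qed

end

lemma (in cdga) diff_one: "diff A \<one> = \<zero>"
proof -
  have "diff A \<one> = diff A \<one> \<oplus> diff A \<one>"
    using leibniz[OF one_degree one_closed] by simp
  then show ?thesis by (metis add.r_cancel_one' d_closed one_closed)
qed

lemma cdga_homD:
  assumes "f \<in> cdga_hom B A"
  shows "y \<in> carrier B \<Longrightarrow> f y \<in> carrier A"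
    "y \<in> carrier B \<Longrightarrow> y' \<in> carrier B \<Longrightarrow> f (y \<oplus>\<^bsub>B\<^esub> y') = f y \<oplus>\<^bsub>A\<^esub> f y'"
    "y \<in> carrier B \<Longrightarrow> f (r \<odot>\<^bsub>B\<^esub> y) = r \<odot>\<^bsub>A\<^esub> f y"
    "y \<in> carrier B \<Longrightarrow> y' \<in> carrier B \<Longrightarrow> f (y \<otimes>\<^bsub>B\<^esub> y') = f y \<otimes>\<^bsub>A\<^esub> f y'"
    "f \<one>\<^bsub>B\<^esub> = \<one>\<^bsub>A\<^esub>"
    "y \<in> gr B k \<Longrightarrow> f y \<in> gr A k"
    "y \<in> carrier B \<Longrightarrow> f (diff B y) = diff A (f y)"
    "f \<in> LinearCombinations.module_hom RR B A"
  using assms unfolding cdga_hom_def Ring.ring_hom_def LinearCombinations.module_hom_def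
  by (auto simp: image_subset_iff)

text \<open>
  Values \<open>b\<close> of an algebra map \<open>M \<rightarrow> B\<close> and \<open>h\<close> of a polynomial homotopy on the generators. The
  assumptions concern degrees only; compatibility with the differentials is a property of single
  elements of \<open>M\<close>, because during the recursion it is known only on part of \<open>M\<close>.
\<close>

locale homotopy_data = M: cdga M + B: cdga B + A: cdga A
  for M :: "'m dg" and B :: "'b dg" and A :: "'a dg" +
  fixes \<phi> :: "'b \<Rightarrow> 'a" and \<psi> :: "'m \<Rightarrow> 'a" and X :: "'m set"
    and b :: "'m \<Rightarrow> 'b" and h :: "'m \<Rightarrow> real \<Rightarrow> 'a \<times> 'a \<times> 'a"
  assumes free: "free_gc_algebra_on M X"
    and \<phi>: "\<phi> \<in> cdga_hom B A" and \<psi>: "\<psi> \<in> cdga_hom M A"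
    and b_degree: "x \<in> X \<Longrightarrow> x \<in> gr M k \<Longrightarrow> b x \<in> gr B k"
    and h_degree: "x \<in> X \<Longrightarrow> x \<in> gr M k \<Longrightarrow> h x t \<in> gr (homotopy_algebra A) k"
begin

sublocale f: graded_assignment M B X b
  by (intro graded_assignment.intro graded_assignment_axioms.intro M.cdga_axioms B.gc_algebra_axioms)
    (auto intro: free b_degree)

lemma path_assignment: "graded_assignment M (homotopy_algebra A) X (\<lambda>x. h x t)"
  by (intro graded_assignment.intro graded_assignment_axioms.intro M.cdga_axioms A.homotopy_algebra_gc)
    (auto intro: free h_degree)

abbreviation f where "f \<equiv> f.lift"

definition homotopy :: "real \<Rightarrow> 'm \<Rightarrow> 'a \<times> 'a \<times> 'a" where
  "homotopy t = free_lift M X (homotopy_algebra A) (\<lambda>x. h x t)"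

definition u :: "'m \<Rightarrow> real \<Rightarrow> 'a" where "u m t = fst (homotopy t m)"
definition p :: "'m \<Rightarrow> real \<Rightarrow> 'a" where "p m t = fst (snd (homotopy t m))"
definition q :: "'m \<Rightarrow> real \<Rightarrow> 'a" where "q m t = snd (snd (homotopy t m))"

lemma homotopy_eq: "homotopy t m = (u m t, p m t, q m t)"
  by (simp add: u_def p_def q_def)

lemma path_closed:
  assumes "m \<in> carrier M" shows "u m t \<in> carrier A" "p m t \<in> carrier A" "q m t \<in> carrier A"
  using graded_assignment.lift_closed[OF path_assignment assms, of t]
  unfolding homotopy_def[symmetric] homotopy_eq by auto

lemma path_degree:
  assumes "m \<in> gr M k"
  shows "p m t \<in> gr A k" "q m t \<in> gr A (k - 1)" "u m t = ((-1) powi k) \<odot>\<^bsub>A\<^esub> p m t"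
  using graded_assignment.lift_degree[OF path_assignment assms, of t]
  unfolding homotopy_def[symmetric] homotopy_eq by auto

lemma path_add:
  assumes "m \<in> carrier M" "m' \<in> carrier M"
  shows "p (m \<oplus>\<^bsub>M\<^esub> m') t = p m t \<oplus>\<^bsub>A\<^esub> p m' t" "q (m \<oplus>\<^bsub>M\<^esub> m') t = q m t \<oplus>\<^bsub>A\<^esub> q m' t"
  using graded_assignment.lift_add[OF path_assignment assms, of t]
  unfolding homotopy_def[symmetric] homotopy_eq by auto

lemma path_scale:
  assumes "m \<in> carrier M"
  shows "p (r \<odot>\<^bsub>M\<^esub> m) t = r \<odot>\<^bsub>A\<^esub> p m t" "q (r \<odot>\<^bsub>M\<^esub> m) t = r \<odot>\<^bsub>A\<^esub> q m t"
  using graded_assignment.lift_scale[OF path_assignment assms, of t r]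
  unfolding homotopy_def[symmetric] homotopy_eq by auto

lemma path_mult:
  assumes "m \<in> carrier M" "m' \<in> carrier M"
  shows "p (m \<otimes>\<^bsub>M\<^esub> m') t = p m t \<otimes>\<^bsub>A\<^esub> p m' t"
    "q (m \<otimes>\<^bsub>M\<^esub> m') t = u m t \<otimes>\<^bsub>A\<^esub> q m' t \<oplus>\<^bsub>A\<^esub> q m t \<otimes>\<^bsub>A\<^esub> p m' t"
  using graded_assignment.lift_mult[OF path_assignment assms, of t]
  unfolding homotopy_def[symmetric] homotopy_eq by auto

lemma path_one: "p \<one>\<^bsub>M\<^esub> t = \<one>\<^bsub>A\<^esub>" "q \<one>\<^bsub>M\<^esub> t = \<zero>\<^bsub>A\<^esub>"
  using graded_assignment.lift_one[OF path_assignment, of t]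
  unfolding homotopy_def[symmetric] homotopy_eq by auto

lemma path_generator: "x \<in> X \<Longrightarrow> h x t = (u x t, p x t, q x t)"
  using graded_assignment.lift_generator[OF path_assignment, of x t]
  unfolding homotopy_def[symmetric] homotopy_eq by auto

text \<open>
  The equations for \<open>m\<close> that say that \<open>f\<close> is a chain map and \<open>p + dt q\<close> is a chain map into polynomial
  forms, whose differential is \<open>d(p + dt q) = dp + dt (p' - dq)\<close>, and that the homotopy starts at
  \<open>\<phi> \<circ> f\<close> and ends at \<open>\<psi>\<close>.
\<close>

definition compatible :: "'m \<Rightarrow> bool" where
  "compatible m \<longleftrightarrow> f (diff M m) = diff B (f m) \<and>
     (\<forall>t. p (diff M m) t = diff A (p m t)) \<and> (\<exists>q'. poly_deriv A (q m) q') \<and>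
     poly_deriv A (p m) (\<lambda>t. q (diff M m) t \<oplus>\<^bsub>A\<^esub> diff A (q m t)) \<and>
     p m 0 = \<phi> (f m) \<and> p m 1 = \<psi> m"

lemmas hom_facts = cdga_homD(1-5)[OF \<phi>] cdga_homD(1-5)[OF \<psi>]

lemma path_zero: "p \<zero>\<^bsub>M\<^esub> t = \<zero>\<^bsub>A\<^esub>" "q \<zero>\<^bsub>M\<^esub> t = \<zero>\<^bsub>A\<^esub>"
  using path_scale[of "\<zero>\<^bsub>M\<^esub>" 0 t] path_closed[of "\<zero>\<^bsub>M\<^esub>" t] by auto

lemma compatible_one: "compatible \<one>\<^bsub>M\<^esub>"
proof -
  have "p \<one>\<^bsub>M\<^esub> = (\<lambda>t. \<one>\<^bsub>A\<^esub>)" "q \<one>\<^bsub>M\<^esub> = (\<lambda>t. \<zero>\<^bsub>A\<^esub>)" "q \<zero>\<^bsub>M\<^esub> = (\<lambda>t. \<zero>\<^bsub>A\<^esub>)"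
    using path_one path_zero by auto
  then show ?thesis
    unfolding compatible_def
    using A.poly_deriv_const[of "\<one>\<^bsub>A\<^esub>"] A.poly_deriv_const[of "\<zero>\<^bsub>A\<^esub>"]
    by (auto simp: M.diff_one B.diff_one A.diff_one
        f.lift_one f.lift_zero path_zero hom_facts)
qed

lemma compatible_add:
  assumes c: "m \<in> carrier M" "m' \<in> carrier M" and m: "compatible m" and m': "compatible m'"
  shows "compatible (m \<oplus>\<^bsub>M\<^esub> m')"
proof -
  have e: "p (m \<oplus>\<^bsub>M\<^esub> m') = (\<lambda>t. p m t \<oplus>\<^bsub>A\<^esub> p m' t)" "q (m \<oplus>\<^bsub>M\<^esub> m') = (\<lambda>t. q m t \<oplus>\<^bsub>A\<^esub> q m' t)"
    using path_add[OF c] by auto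
  have d: "diff M (m \<oplus>\<^bsub>M\<^esub> m') = diff M m \<oplus>\<^bsub>M\<^esub> diff M m'" using c by (rule M.d_add)
  obtain r r' where r: "poly_deriv A (q m) r" "poly_deriv A (q m') r'"
    using m m' unfolding compatible_def by blast
  have "poly_deriv A (\<lambda>t. p m t \<oplus>\<^bsub>A\<^esub> p m' t) (\<lambda>t. (q (diff M m) t \<oplus>\<^bsub>A\<^esub> diff A (q m t))
      \<oplus>\<^bsub>A\<^esub> (q (diff M m') t \<oplus>\<^bsub>A\<^esub> diff A (q m' t)))"
    using m m' unfolding compatible_def by (intro poly_deriv.add) auto
  then have "poly_deriv A (p (m \<oplus>\<^bsub>M\<^esub> m'))
      (\<lambda>t. q (diff M (m \<oplus>\<^bsub>M\<^esub> m')) t \<oplus>\<^bsub>A\<^esub> diff A (q (m \<oplus>\<^bsub>M\<^esub> m') t))"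
    unfolding e d using c by (simp add: path_add path_closed A.d_add A.a_ac)
  moreover have "\<exists>r. poly_deriv A (q (m \<oplus>\<^bsub>M\<^esub> m')) r" unfolding e using poly_deriv.add[OF r] by blast
  ultimately show ?thesis
    using m m' c unfolding compatible_def
    by (auto simp: d path_add path_closed f.lift_add f.lift_closed A.d_add B.d_add hom_facts)
qed

lemma compatible_scale:
  assumes c: "m \<in> carrier M" and m: "compatible m"
  shows "compatible (r \<odot>\<^bsub>M\<^esub> m)"
proof -
  have e: "p (r \<odot>\<^bsub>M\<^esub> m) = (\<lambda>t. r \<odot>\<^bsub>A\<^esub> p m t)" "q (r \<odot>\<^bsub>M\<^esub> m) = (\<lambda>t. r \<odot>\<^bsub>A\<^esub> q m t)"
    using path_scale[OF c] by auto
  have d: "diff M (r \<odot>\<^bsub>M\<^esub> m) = r \<odot>\<^bsub>M\<^esub> diff M m" using c by (rule M.d_scale)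
  have "poly_deriv A (\<lambda>t. r \<odot>\<^bsub>A\<^esub> p m t) (\<lambda>t. r \<odot>\<^bsub>A\<^esub> (q (diff M m) t \<oplus>\<^bsub>A\<^esub> diff A (q m t)))"
    using m unfolding compatible_def by (intro A.poly_deriv_scale) auto
  then have "poly_deriv A (p (r \<odot>\<^bsub>M\<^esub> m)) (\<lambda>t. q (diff M (r \<odot>\<^bsub>M\<^esub> m)) t \<oplus>\<^bsub>A\<^esub> diff A (q (r \<odot>\<^bsub>M\<^esub> m) t))"
    unfolding e d using c by (simp add: path_scale path_closed A.d_scale A.scale_add_right)
  moreover have "\<exists>r'. poly_deriv A (q (r \<odot>\<^bsub>M\<^esub> m)) r'"
    unfolding e using m A.poly_deriv_scale unfolding compatible_def by blast
  ultimately show ?thesis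
    using m c unfolding compatible_def
    by (auto simp: d path_scale path_closed f.lift_scale f.lift_closed A.d_scale B.d_scale hom_facts)
qed

text \<open>
  The Leibniz rule for \<open>p + dt q\<close>. The terms with \<open>\<plusminus>dp\<close> occur once in \<open>q\<close> of \<open>d(ym)\<close> and once in \<open>d\<close> of
  \<open>q\<close> of \<open>ym\<close>, with opposite signs, and cancel; what remains is the product rule for \<open>p\<^sub>yp\<^sub>m\<close>.
\<close>

lemma compatible_mult:
  assumes y: "y \<in> gr M k" and c: "m \<in> carrier M" and cy: "compatible y" and cm: "compatible m"
  shows "compatible (y \<otimes>\<^bsub>M\<^esub> m)"
proof -
  define e :: real where "e = (-1) powi k"
  have ee: "e * e = 1" by (simp add: e_def sign_powi)
  have e1: "(-1) powi (k + 1) = - e" "(-1) powi (k - 1) = - e" by (simp_all add: e_def sign_powi)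
  have yc: "y \<in> carrier M" using y by (rule M.gr_closed)
  have dy: "diff M y \<in> gr M (k + 1)" using y by (rule M.diff_degree)
  note py = path_degree[OF y, folded e_def]
  have d: "diff M (y \<otimes>\<^bsub>M\<^esub> m) = diff M y \<otimes>\<^bsub>M\<^esub> m \<oplus>\<^bsub>M\<^esub> e \<odot>\<^bsub>M\<^esub> (y \<otimes>\<^bsub>M\<^esub> diff M m)"
    unfolding e_def using M.leibniz[OF y c] .
  note cl = yc c M.d_closed[OF yc] M.d_closed[OF c] path_closed[OF yc] path_closed[OF c]
    path_closed[OF M.d_closed[OF yc]] path_closed[OF M.d_closed[OF c]]
  have pq: "p (y \<otimes>\<^bsub>M\<^esub> m) = (\<lambda>t. p y t \<otimes>\<^bsub>A\<^esub> p m t)"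
    "q (y \<otimes>\<^bsub>M\<^esub> m) = (\<lambda>t. e \<odot>\<^bsub>A\<^esub> (p y t \<otimes>\<^bsub>A\<^esub> q m t) \<oplus>\<^bsub>A\<^esub> q y t \<otimes>\<^bsub>A\<^esub> p m t)"
    using path_mult[OF yc c] py(3) cl by (auto simp: A.scale_mult_left)
  have Y: "f (diff M y) = diff B (f y)" "\<And>t. p (diff M y) t = diff A (p y t)"
      "poly_deriv A (p y) (\<lambda>t. q (diff M y) t \<oplus>\<^bsub>A\<^esub> diff A (q y t))" "p y 0 = \<phi> (f y)" "p y 1 = \<psi> y"
    and Z: "f (diff M m) = diff B (f m)" "\<And>t. p (diff M m) t = diff A (p m t)"
      "poly_deriv A (p m) (\<lambda>t. q (diff M m) t \<oplus>\<^bsub>A\<^esub> diff A (q m t))" "p m 0 = \<phi> (f m)" "p m 1 = \<psi> m"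
    using cy cm unfolding compatible_def by auto
  obtain r r' where r: "poly_deriv A (q y) r" "poly_deriv A (q m) r'"
    using cy cm unfolding compatible_def by blast
  have udy: "u (diff M y) t = (- e) \<odot>\<^bsub>A\<^esub> diff A (p y t)" for t
    using path_degree(3)[OF dy] by (simp add: e1 Y(2))
  have 1: "f (diff M (y \<otimes>\<^bsub>M\<^esub> m)) = diff B (f (y \<otimes>\<^bsub>M\<^esub> m))"
    using B.leibniz[OF f.lift_degree[OF y] f.lift_closed[OF c], folded e_def] cl
    by (simp add: d f.lift_add f.lift_scale f.lift_mult Y(1) Z(1))
  have 2: "p (diff M (y \<otimes>\<^bsub>M\<^esub> m)) t = diff A (p (y \<otimes>\<^bsub>M\<^esub> m) t)" for t
    using A.leibniz[OF py(1) path_closed(2)[OF c], folded e_def] cl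
    by (simp add: d path_add path_scale path_mult Y(2) Z(2))
  have 3: "\<exists>r. poly_deriv A (q (y \<otimes>\<^bsub>M\<^esub> m)) r"
    unfolding pq(2) using Y(3) Z(3) r
    by (intro exI) (rule poly_deriv.add A.poly_deriv_scale A.poly_deriv_mult | assumption)+
  have 4: "poly_deriv A (p (y \<otimes>\<^bsub>M\<^esub> m)) (\<lambda>t. q (diff M (y \<otimes>\<^bsub>M\<^esub> m)) t \<oplus>\<^bsub>A\<^esub> diff A (q (y \<otimes>\<^bsub>M\<^esub> m) t))"
  proof -
    have "(q (diff M y) t \<oplus>\<^bsub>A\<^esub> diff A (q y t)) \<otimes>\<^bsub>A\<^esub> p m t \<oplus>\<^bsub>A\<^esub> p y t \<otimes>\<^bsub>A\<^esub> (q (diff M m) t \<oplus>\<^bsub>A\<^esub> diff A (q m t))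
      = q (diff M (y \<otimes>\<^bsub>M\<^esub> m)) t \<oplus>\<^bsub>A\<^esub> diff A (q (y \<otimes>\<^bsub>M\<^esub> m) t)" (is "?l = ?r") for t
    proof -
      have q1: "q (diff M (y \<otimes>\<^bsub>M\<^esub> m)) t =
          ((- e) \<odot>\<^bsub>A\<^esub> (diff A (p y t) \<otimes>\<^bsub>A\<^esub> q m t) \<oplus>\<^bsub>A\<^esub> q (diff M y) t \<otimes>\<^bsub>A\<^esub> p m t) \<oplus>\<^bsub>A\<^esub>
          (p y t \<otimes>\<^bsub>A\<^esub> q (diff M m) t \<oplus>\<^bsub>A\<^esub> e \<odot>\<^bsub>A\<^esub> (q y t \<otimes>\<^bsub>A\<^esub> diff A (p m t)))"
        using cl by (simp add: d path_add path_scale path_mult udy py(3) Z(2) A.scale_mult_left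
          A.scale_add_right A.scale_scale ee)
      have q2: "diff A (q (y \<otimes>\<^bsub>M\<^esub> m) t) =
          (e \<odot>\<^bsub>A\<^esub> (diff A (p y t) \<otimes>\<^bsub>A\<^esub> q m t) \<oplus>\<^bsub>A\<^esub> p y t \<otimes>\<^bsub>A\<^esub> diff A (q m t)) \<oplus>\<^bsub>A\<^esub>
          (diff A (q y t) \<otimes>\<^bsub>A\<^esub> p m t \<oplus>\<^bsub>A\<^esub> (- e) \<odot>\<^bsub>A\<^esub> (q y t \<otimes>\<^bsub>A\<^esub> diff A (p m t)))"
        using cl A.leibniz[OF py(1) path_closed(3)[OF c], folded e_def] A.leibniz[OF py(2) path_closed(2)[OF c]]
        by (simp add: pq(2) A.d_add A.d_scale e1 A.scale_add_right A.scale_scale ee)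
      have cancel: "((- e) \<odot>\<^bsub>A\<^esub> v \<oplus>\<^bsub>A\<^esub> v1) \<oplus>\<^bsub>A\<^esub> (v2 \<oplus>\<^bsub>A\<^esub> e \<odot>\<^bsub>A\<^esub> w) \<oplus>\<^bsub>A\<^esub> ((e \<odot>\<^bsub>A\<^esub> v \<oplus>\<^bsub>A\<^esub> v3) \<oplus>\<^bsub>A\<^esub> (v4 \<oplus>\<^bsub>A\<^esub> (- e) \<odot>\<^bsub>A\<^esub> w))
          = (v1 \<oplus>\<^bsub>A\<^esub> v4) \<oplus>\<^bsub>A\<^esub> (v2 \<oplus>\<^bsub>A\<^esub> v3)"
        if "v \<in> carrier A" "w \<in> carrier A" "v1 \<in> carrier A" "v2 \<in> carrier A" "v3 \<in> carrier A" "v4 \<in> carrier A"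
        for v w v1 v2 v3 v4
      proof -
        have z: "(- e) \<odot>\<^bsub>A\<^esub> x \<oplus>\<^bsub>A\<^esub> e \<odot>\<^bsub>A\<^esub> x = \<zero>\<^bsub>A\<^esub>" if "x \<in> carrier A" for x
          using that A.scale_add_left[of x "- e" e] by simp
        have "((- e) \<odot>\<^bsub>A\<^esub> v \<oplus>\<^bsub>A\<^esub> v1) \<oplus>\<^bsub>A\<^esub> (v2 \<oplus>\<^bsub>A\<^esub> e \<odot>\<^bsub>A\<^esub> w) \<oplus>\<^bsub>A\<^esub> ((e \<odot>\<^bsub>A\<^esub> v \<oplus>\<^bsub>A\<^esub> v3) \<oplus>\<^bsub>A\<^esub> (v4 \<oplus>\<^bsub>A\<^esub> (- e) \<odot>\<^bsub>A\<^esub> w))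
          = (((- e) \<odot>\<^bsub>A\<^esub> v \<oplus>\<^bsub>A\<^esub> e \<odot>\<^bsub>A\<^esub> v) \<oplus>\<^bsub>A\<^esub> ((- e) \<odot>\<^bsub>A\<^esub> w \<oplus>\<^bsub>A\<^esub> e \<odot>\<^bsub>A\<^esub> w)) \<oplus>\<^bsub>A\<^esub> ((v1 \<oplus>\<^bsub>A\<^esub> v4) \<oplus>\<^bsub>A\<^esub> (v2 \<oplus>\<^bsub>A\<^esub> v3))"
          using that by (simp add: A.a_ac)
        then show ?thesis using that by (simp add: z)
      qed
      show ?thesis
        unfolding q1 q2 using cl by (subst cancel) (auto simp: A.l_distr A.r_distr)
    qed
    then show ?thesis unfolding pq(1) using A.poly_deriv_mult[OF Y(3) Z(3)] by simp
  qed
  have 5: "p (y \<otimes>\<^bsub>M\<^esub> m) 0 = \<phi> (f (y \<otimes>\<^bsub>M\<^esub> m))" "p (y \<otimes>\<^bsub>M\<^esub> m) 1 = \<psi> (y \<otimes>\<^bsub>M\<^esub> m)"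
    using cl by (simp_all add: path_mult f.lift_mult f.lift_closed hom_facts Y Z)
  show ?thesis unfolding compatible_def using 1 2 3 4 5 by blast
qed

lemma compatible_subalgebra:
  assumes Y: "Y \<subseteq> X" and gen: "\<And>y. y \<in> Y \<Longrightarrow> compatible y"
    and m: "m \<in> tensor_eval M ` carrier (tensor_algebra Y)"
  shows "compatible m"
  using m Y
proof (induction rule: f.subalgebra_induct)
  case one show ?case by (rule compatible_one)
next
  case (add m m') then show ?case by (intro compatible_add)
next
  case (scale r m) then show ?case by (intro compatible_scale)
next
  case (mult y m)
  then obtain k where "y \<in> gr M k" using Y free unfolding free_gc_algebra_on_def by blast
  then show ?case using mult gen by (intro compatible_mult)
qed

text \<open>For a cocycle \<open>z\<close> the equations become \<open>p' = dq\<close>, so \<open>p(1) - p(0) = d \<integral>q\<close>.\<close>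

lemma homotopy_on_cocycle:
  assumes z: "compatible z" "z \<in> cocycles M"
  obtains Q where "poly_deriv A Q (q z)" "Q 0 = \<zero>\<^bsub>A\<^esub>" "\<And>t. p z t = \<phi> (f z) \<oplus>\<^bsub>A\<^esub> diff A (Q t)"
proof -
  have zc: "z \<in> carrier M" "diff M z = \<zero>\<^bsub>M\<^esub>" using z(2) by (auto simp: cocycles_def)
  obtain r where "poly_deriv A (q z) r" using z(1) unfolding compatible_def by blast
  then obtain Q where Q: "poly_deriv A Q (q z)" "Q 0 = \<zero>\<^bsub>A\<^esub>"
    using A.polynomial_antiderivative by blast
  have "poly_deriv A (p z) (\<lambda>t. diff A (q z t))"
    using z(1) zc unfolding compatible_def by (simp add: path_zero path_closed)
  moreover have "poly_deriv A (\<lambda>t. diff A (Q t)) (\<lambda>t. diff A (q z t))"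
    by (rule A.poly_deriv_linear[OF Q(1) A.vectorspace_axioms A.d_hom])
  ultimately have "p z t = p z 0 \<oplus>\<^bsub>A\<^esub> diff A (Q t)" for t
    by (rule A.equal_derivatives) (simp add: Q(2))
  then show thesis using that[OF Q] z(1) unfolding compatible_def by simp
qed

end

section \<open>Lifting a minimal algebra through a map\<close>

text \<open>
  The algebra \<open>M\<close> is generated in degrees at most \<open>j\<close>, so a map \<open>M \<rightarrow> B\<close> takes values in the subring
  generated by the elements of degree at most \<open>j\<close>. Obstructions to the lifting need to vanish only
  there.
\<close>

locale lifting_problem = M: cdga M + B: cdga B + A: cdga A
  for M :: "'m dg" and B :: "'b dg" and A :: "'a dg" +
  fixes \<phi> :: "'b \<Rightarrow> 'a" and \<psi> :: "'m \<Rightarrow> 'a" and X :: "'m set" and r :: "'m rel" and j :: int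
  assumes free: "free_gc_algebra_on M X"
    and \<phi>: "\<phi> \<in> cdga_hom B A" and \<psi>: "\<psi> \<in> cdga_hom M A"
    and wo: "well_order_on X r"
    and d_lower: "x \<in> X \<Longrightarrow> diff M x \<in> tensor_eval M ` carrier (tensor_algebra (underS r x))"
    and low: "X \<subseteq> (\<Union>p\<in>{..j}. gr M p)" and j: "j \<ge> 0"
    and surj: "\<lbrakk>s \<le> j; c \<in> cocycles A; c \<in> gr A s\<rbrakk> \<Longrightarrow>
      \<exists>z a. z \<in> cocycles B \<and> z \<in> gr B s \<and> a \<in> carrier A \<and> c = diff A a \<oplus>\<^bsub>A\<^esub> \<phi> z"
    and obstruction: "\<lbrakk>s \<le> j; w \<in> cocycles B; w \<in> gr B (s + 1);
      w \<in> generate_ring B (\<Union>p\<in>{..j}. gr B p); \<exists>a\<in>carrier A. \<phi> w = diff A a\<rbrakk> \<Longrightarrow>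
      \<exists>b\<in>carrier B. w = diff B b"
begin

text \<open>
  Zero is homogeneous of every degree. Continuing partial data by zero therefore gives algebra maps on
  all of \<open>M\<close>, of which only the restriction to the subalgebra on smaller generators is meaningful.
\<close>

definition restrict_b :: "'m set \<Rightarrow> ('m \<Rightarrow> 'b) \<Rightarrow> 'm \<Rightarrow> 'b" where
  "restrict_b Y b x = (if x \<in> Y then b x else \<zero>\<^bsub>B\<^esub>)"

definition restrict_h :: "'m set \<Rightarrow> ('m \<Rightarrow> real \<Rightarrow> 'a \<times> 'a \<times> 'a) \<Rightarrow> 'm \<Rightarrow> real \<Rightarrow> 'a \<times> 'a \<times> 'a" where
  "restrict_h Y h x = (if x \<in> Y then h x else (\<lambda>t. \<zero>\<^bsub>homotopy_algebra A\<^esub>))"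

abbreviation map_of_data :: "('m \<Rightarrow> 'b) \<Rightarrow> 'm \<Rightarrow> 'b" where
  "map_of_data b \<equiv> free_lift M X B b"

abbreviation path_of_data :: "('m \<Rightarrow> real \<Rightarrow> 'a \<times> 'a \<times> 'a) \<Rightarrow> real \<Rightarrow> 'm \<Rightarrow> 'a \<times> 'a \<times> 'a" where
  "path_of_data h t \<equiv> free_lift M X (homotopy_algebra A) (\<lambda>x. h x t)"

text \<open>The conditions on the values \<open>b\<^sub>0, h\<^sub>0\<close> at \<open>x\<close> when \<open>b\<close> and \<open>h\<close> are known on smaller generators.\<close>

definition admissible ::
  "('m \<Rightarrow> 'b) \<Rightarrow> ('m \<Rightarrow> real \<Rightarrow> 'a \<times> 'a \<times> 'a) \<Rightarrow> 'm \<Rightarrow> 'b \<Rightarrow> (real \<Rightarrow> 'a \<times> 'a \<times> 'a) \<Rightarrow> bool" where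
  "admissible b h x b0 h0 \<longleftrightarrow>
     (let f = map_of_data (restrict_b (underS r x) b);
          H = path_of_data (restrict_h (underS r x) h);
          p = (\<lambda>t. fst (snd (h0 t))); q = (\<lambda>t. snd (snd (h0 t))) in
      (\<forall>k. x \<in> gr M k \<longrightarrow> b0 \<in> gr B k \<and> (\<forall>t. h0 t \<in> gr (homotopy_algebra A) k)) \<and>
      f (diff M x) = diff B b0 \<and>
      (\<forall>t. fst (snd (H t (diff M x))) = diff A (p t)) \<and> (\<exists>q'. poly_deriv A q q') \<and>
      poly_deriv A p (\<lambda>t. snd (snd (H t (diff M x))) \<oplus>\<^bsub>A\<^esub> diff A (q t)) \<and>
      p 0 = \<phi> b0 \<and> p 1 = \<psi> x)"

lemma underS_subset: "underS r x \<subseteq> X"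
  using wo unfolding underS_def well_order_on_def linear_order_on_def partial_order_on_def
    preorder_on_def refl_on_def by auto

lemma underS_trans: "y \<in> underS r x \<Longrightarrow> underS r y \<subseteq> underS r x"
  using wo unfolding underS_def well_order_on_def linear_order_on_def partial_order_on_def
    preorder_on_def by (auto elim: transE dest: antisymD)

lemma restricted_data:
  assumes "\<And>y. y \<in> Y \<Longrightarrow> admissible b h y (b y) (h y)" and "Y \<subseteq> X"
  shows "homotopy_data M B A \<phi> \<psi> X (restrict_b Y b) (restrict_h Y h)"
proof (intro homotopy_data.intro homotopy_data_axioms.intro M.cdga_axioms B.cdga_axioms A.cdga_axioms
    free \<phi> \<psi>)
  fix x k t assume x: "x \<in> X" "x \<in> gr M k"
  show "restrict_b Y b x \<in> gr B k"
    using assms(1)[of x] x unfolding restrict_b_def admissible_def Let_def by auto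
  have "\<zero>\<^bsub>homotopy_algebra A\<^esub> \<in> gr (homotopy_algebra A) k" by simp
  then show "restrict_h Y h x t \<in> gr (homotopy_algebra A) k"
    using assms(1)[of x] x unfolding restrict_h_def admissible_def Let_def by auto
qed

text \<open>
  Admissibility speaks of the maps determined by the data below \<open>x\<close>. Since \<open>dx\<close> is a polynomial in
  smaller generators, these agree at \<open>dx\<close> with the maps determined by any data extending them.
\<close>

lemma admissible_imp_compatible:
  assumes D: "homotopy_data M B A \<phi> \<psi> X b h" and x: "x \<in> X"
    and eq: "\<And>y. y \<in> underS r x \<Longrightarrow> b y = b1 y \<and> h y = h1 y"
    and D1: "homotopy_data M B A \<phi> \<psi> X (restrict_b (underS r x) b1) (restrict_h (underS r x) h1)"
    and adm: "admissible b1 h1 x (b x) (h x)"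
  shows "homotopy_data.compatible M B A \<phi> \<psi> X b h x"
proof -
  interpret D: homotopy_data M B A \<phi> \<psi> X b h by fact
  interpret D1: homotopy_data M B A \<phi> \<psi> X "restrict_b (underS r x) b1" "restrict_h (underS r x) h1"
    by fact
  have f: "D.f (diff M x) = D1.f (diff M x)"
    by (rule D.f.lift_cong[OF D1.f.graded_assignment_axioms underS_subset _ d_lower[OF x]])
      (simp add: restrict_b_def eq)
  have H: "D.homotopy t (diff M x) = path_of_data (restrict_h (underS r x) h1) t (diff M x)" for t
    unfolding D.homotopy_def
    by (rule graded_assignment.lift_cong[OF D.path_assignment D1.path_assignment underS_subset _ d_lower[OF x]])
      (simp add: restrict_h_def eq)
  have pq: "D.p x = (\<lambda>t. fst (snd (h x t)))" "D.q x = (\<lambda>t. snd (snd (h x t)))"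
    using D.path_generator[OF x] by auto
  show ?thesis
    using adm
    unfolding D.compatible_def admissible_def Let_def f pq D.f.lift_generator[OF x]
    by (simp add: D.p_def D.q_def H)
qed

lemma lower_compatible:
  assumes x: "x \<in> X" and adm: "\<And>y. y \<in> underS r x \<Longrightarrow> admissible b h y (b y) (h y)"
    and m: "m \<in> tensor_eval M ` carrier (tensor_algebra (underS r x))"
  shows "homotopy_data.compatible M B A \<phi> \<psi> X (restrict_b (underS r x) b) (restrict_h (underS r x) h) m"
proof -
  have D: "homotopy_data M B A \<phi> \<psi> X (restrict_b (underS r x) b) (restrict_h (underS r x) h)"
    by (rule restricted_data) (use adm underS_subset in auto)
  show ?thesis
  proof (rule homotopy_data.compatible_subalgebra[OF D underS_subset _ m])
    fix y assume y: "y \<in> underS r x"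
    show "homotopy_data.compatible M B A \<phi> \<psi> X (restrict_b (underS r x) b) (restrict_h (underS r x) h) y"
    proof (rule admissible_imp_compatible[OF D])
      show "y \<in> X" using y underS_subset by auto
      show "homotopy_data M B A \<phi> \<psi> X (restrict_b (underS r y) b) (restrict_h (underS r y) h)"
        by (rule restricted_data) (use adm y underS_trans underS_subset in auto)
      show "admissible b h y (restrict_b (underS r x) b y) (restrict_h (underS r x) h y)"
        using adm[OF y] y by (simp add: restrict_b_def restrict_h_def)
      show "restrict_b (underS r x) b z = b z \<and> restrict_h (underS r x) h z = h z" if "z \<in> underS r y" for z
        using that underS_trans[OF y] by (auto simp: restrict_b_def restrict_h_def)
    qed
  qed
qed

end

text \<open>
  A scalar multiple is a product with \<open>r\<cdot>1\<close>, which has degree \<open>0 \<le> j\<close>.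
\<close>

lemma (in graded_assignment) lift_generate_ring:
  assumes X: "X \<subseteq> (\<Union>p\<in>{..j}. gr M p)" and j: "j \<ge> (0::int)" and m: "m \<in> carrier M"
  shows "lift m \<in> generate_ring C (\<Union>p\<in>{..j}. gr C p)"
proof -
  have m: "m \<in> tensor_eval M ` carrier (tensor_algebra X)"
    using m free unfolding free_gc_algebra_on_def by simp
  show ?thesis using m order_refl[of X]
  proof (induction rule: subalgebra_induct)
    case one show ?case by (simp add: lift_one generate_ring.one)
  next
    case (add m m') then show ?case by (simp add: lift_add generate_ring.eng_add)
  next
    case (scale s m)
    have "s \<odot>\<^bsub>C\<^esub> \<one>\<^bsub>C\<^esub> \<in> gr C 0" by (rule C.homogeneous_scale[OF C.homogeneous_one])
    then have "s \<odot>\<^bsub>C\<^esub> \<one>\<^bsub>C\<^esub> \<in> (\<Union>p\<in>{..j}. gr C p)" using j by auto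
    moreover have "s \<odot>\<^bsub>C\<^esub> lift m = (s \<odot>\<^bsub>C\<^esub> \<one>\<^bsub>C\<^esub>) \<otimes>\<^bsub>C\<^esub> lift m"
      using lift_closed[OF scale(1)] by (simp add: C.scale_mult_left)
    ultimately show ?case
      using scale by (simp add: lift_scale generate_ring.eng_mult generate_ring.incl)
  next
    case (mult y m)
    then obtain p where "p \<le> j" "y \<in> gr M p" using X by auto
    then have "lift y \<in> (\<Union>p\<in>{..j}. gr C p)" using lift_degree by auto
    then show ?case
      using mult generator_closed by (simp add: lift_mult generate_ring.eng_mult generate_ring.incl)
  qed
qed

context lifting_problem
begin

text \<open>
  The step of the recursion. Let \<open>f\<close> and \<open>p + dt q\<close> be the maps given by the data below \<open>x\<close>. The
  homotopy joins \<open>\<phi>(f(dx))\<close> to \<open>\<psi>(dx) = d(\<psi>x)\<close>, so \<open>\<phi>\<close> sends the cocycle \<open>w = f(dx)\<close> to an exact element,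
  and \<open>w = db\<^sub>2\<close> by hypothesis. The two ends \<open>\<phi>(b\<^sub>2)\<close> and \<open>\<psi>x\<close> of the path to be constructed differ by
  \<open>\<integral>q\<close> and a cocycle \<open>c\<close> of \<open>A\<close>. As \<open>H(\<phi>)\<close> is surjective in the degree of \<open>x\<close>, one can write
  \<open>c = \<phi>(z) + da\<close>; then \<open>b\<^sub>2 + z\<close> is the value of \<open>f\<close> at \<open>x\<close>, and the summand \<open>da\<close> is absorbed by the path
  \<open>t \<mapsto> t\<cdot>da\<close>, which comes from the constant \<open>dt a\<close>.
\<close>

lemma admissible_exists:
  assumes x: "x \<in> X" and adm: "\<And>y. y \<in> underS r x \<Longrightarrow> admissible b h y (b y) (h y)"
  shows "\<exists>b0 h0. admissible b h x b0 h0"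
proof -
  have D: "homotopy_data M B A \<phi> \<psi> X (restrict_b (underS r x) b) (restrict_h (underS r x) h)"
    by (rule restricted_data) (use adm underS_subset in auto)
  interpret D: homotopy_data M B A \<phi> \<psi> X "restrict_b (underS r x) b" "restrict_h (underS r x) h"
    by (rule D)
  note F = cdga_homD[OF \<phi>] and G = cdga_homD[OF \<psi>]
  have adm_iff: "admissible b h x b0 h0 \<longleftrightarrow>
      (\<forall>k. x \<in> gr M k \<longrightarrow> b0 \<in> gr B k \<and> (\<forall>t. h0 t \<in> gr (homotopy_algebra A) k)) \<and>
      D.f (diff M x) = diff B b0 \<and>
      (\<forall>t. D.p (diff M x) t = diff A (fst (snd (h0 t)))) \<and> (\<exists>q'. poly_deriv A (\<lambda>t. snd (snd (h0 t))) q') \<and>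
      poly_deriv A (\<lambda>t. fst (snd (h0 t))) (\<lambda>t. D.q (diff M x) t \<oplus>\<^bsub>A\<^esub> diff A (snd (snd (h0 t)))) \<and>
      fst (snd (h0 0)) = \<phi> b0 \<and> fst (snd (h0 1)) = \<psi> x" for b0 h0
    unfolding admissible_def Let_def D.p_def D.q_def D.homotopy_def by simp
  obtain k where k: "k \<le> j" "x \<in> gr M k" using x low by auto
  show ?thesis
  \<comment> \<open>A zero generator would have every degree; the degree of a nonzero one is unique.\<close>
  proof (cases "x = \<zero>\<^bsub>M\<^esub>")
    case True
    have "poly_deriv A (\<lambda>t. \<zero>\<^bsub>A\<^esub>) (\<lambda>t. \<zero>\<^bsub>A\<^esub>)" using A.poly_deriv_const[of "\<zero>\<^bsub>A\<^esub>"] by simp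
    moreover have "diff M x = \<zero>\<^bsub>M\<^esub>" "\<psi> x = \<zero>\<^bsub>A\<^esub>" "\<phi> \<zero>\<^bsub>B\<^esub> = \<zero>\<^bsub>A\<^esub>"
      using lin_hom_zero[OF B.vectorspace_axioms A.vectorspace_axioms F(8)]
        lin_hom_zero[OF M.vectorspace_axioms A.vectorspace_axioms G(8)] by (simp_all add: True)
    ultimately have "admissible b h x \<zero>\<^bsub>B\<^esub> (\<lambda>t. \<zero>\<^bsub>homotopy_algebra A\<^esub>)"
      unfolding adm_iff by (auto simp: D.f.lift_zero D.path_zero)
    then show ?thesis by blast
  next
    case False
    have kuniq: "l = k" if "x \<in> gr M l" for l
      using M.component_homogeneous[OF that, of l] M.component_homogeneous[OF k(2), of l] False
      by (simp split: if_splits)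
    have xc: "x \<in> carrier M" using k(2) M.gr_closed by auto
    have dx: "diff M x \<in> gr M (k + 1)" "diff M x \<in> carrier M" "diff M x \<in> cocycles M"
      using k(2) xc M.diff_degree M.diff_cocycle by auto
    have comp: "D.compatible (diff M x)" by (rule lower_compatible[OF x adm d_lower[OF x]])
    define w where "w = D.f (diff M x)"
    have w: "w \<in> gr B (k + 1)" "w \<in> carrier B" "w \<in> cocycles B"
      "w \<in> generate_ring B (\<Union>p\<in>{..j}. gr B p)"
    proof -
      show "w \<in> gr B (k + 1)" unfolding w_def by (rule D.f.lift_degree[OF dx(1)])
      then show wc: "w \<in> carrier B" by (rule B.gr_closed)
      have "diff B w = D.f (diff M (diff M x))" using comp unfolding D.compatible_def w_def by simp
      then show "w \<in> cocycles B" using wc by (simp add: cocycles_def M.diff_diff[OF xc] D.f.lift_zero)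
      show "w \<in> generate_ring B (\<Union>p\<in>{..j}. gr B p)"
        unfolding w_def by (rule D.f.lift_generate_ring[OF low j dx(2)])
    qed
    obtain Q0 where Q0: "poly_deriv A Q0 (D.q (diff M x))" "Q0 0 = \<zero>\<^bsub>A\<^esub>"
      "\<And>t. D.p (diff M x) t = \<phi> w \<oplus>\<^bsub>A\<^esub> diff A (Q0 t)"
      using D.homotopy_on_cocycle[OF comp dx(3)] unfolding w_def by blast
    have Q0c: "Q0 t \<in> carrier A" for t using A.poly_deriv_closed[OF Q0(1)] by simp
    have \<phi>w: "\<phi> w \<in> gr A (k + 1)" "\<phi> w \<in> carrier A" using w F A.gr_closed by auto
    \<comment> \<open>The antiderivative may be taken homogeneous, because the integrand is.\<close>
    define Q where "Q t = A.component k (Q0 t)" for t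
    have Qd: "Q t \<in> gr A k" "Q t \<in> carrier A" for t unfolding Q_def using A.component_degree Q0c by auto
    have Q: "poly_deriv A Q (D.q (diff M x))" "Q 0 = \<zero>\<^bsub>A\<^esub>"
    proof -
      have "A.component k (D.q (diff M x) t) = D.q (diff M x) t" for t
        using A.component_homogeneous[OF D.path_degree(2)[OF dx(1)], of k t] by simp
      then show "poly_deriv A Q (D.q (diff M x))"
        using A.poly_deriv_linear[OF Q0(1) A.vectorspace_axioms A.component_hom[of k]] by (simp add: Q_def[abs_def])
      show "Q 0 = \<zero>\<^bsub>A\<^esub>" unfolding Q_def Q0(2) using A.component_homogeneous[OF A.gr_zero] by simp
    qed
    have move: "u = v \<oplus>\<^bsub>A\<^esub> v' \<Longrightarrow> u \<oplus>\<^bsub>A\<^esub> (-1) \<odot>\<^bsub>A\<^esub> v' = v"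
      if "v \<in> carrier A" "v' \<in> carrier A" for u v v'
      using that A.add_scale_minus_one[of v'] by (simp add: A.a_assoc)
    have pQ: "D.p (diff M x) t = \<phi> w \<oplus>\<^bsub>A\<^esub> diff A (Q t)" for t
    proof -
      have "D.p (diff M x) t = diff A (Q0 t) \<oplus>\<^bsub>A\<^esub> \<phi> w"
        using Q0(3) Q0c \<phi>w(2) by (simp add: A.a_comm)
      then have "diff A (Q0 t) = D.p (diff M x) t \<oplus>\<^bsub>A\<^esub> (-1) \<odot>\<^bsub>A\<^esub> \<phi> w"
        using move[OF _ \<phi>w(2)] Q0c by simp
      also have "D.p (diff M x) t \<oplus>\<^bsub>A\<^esub> (-1) \<odot>\<^bsub>A\<^esub> \<phi> w \<in> gr A (k + 1)"
        by (intro A.gr_add A.gr_scale \<phi>w D.path_degree(1)[OF dx(1)])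
      finally have "diff A (Q t) = diff A (Q0 t)"
        using A.homogeneous_primitive(2)[OF Q0c] unfolding Q_def by simp
      then show ?thesis using Q0(3) by simp
    qed
    have \<psi>x: "\<psi> x \<in> carrier A" "\<psi> x \<in> gr A k" "\<psi> (diff M x) = diff A (\<psi> x)"
      using xc k(2) G by auto
    have end1: "diff A (\<psi> x) = \<phi> w \<oplus>\<^bsub>A\<^esub> diff A (Q 1)"
      using comp pQ[of 1] \<psi>x(3) unfolding D.compatible_def by simp
    define c0 where "c0 = \<psi> x \<oplus>\<^bsub>A\<^esub> (-1) \<odot>\<^bsub>A\<^esub> Q 1"
    have c0: "c0 \<in> carrier A" "c0 \<in> gr A k" "diff A c0 = \<phi> w"
    proof -
      show "c0 \<in> carrier A" "c0 \<in> gr A k" unfolding c0_def using \<psi>x Qd A.gr_add A.gr_scale by auto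
      show "diff A c0 = \<phi> w" unfolding c0_def
        using move[OF \<phi>w(2) _ end1] \<psi>x Qd by (simp add: A.d_add A.d_scale)
    qed
    then have "\<exists>a\<in>carrier A. \<phi> w = diff A a" by (metis)
    then obtain b1 where b1: "b1 \<in> carrier B" "w = diff B b1"
      using obstruction[OF k(1) w(3,1,4)] by blast
    define b2 where "b2 = B.component k b1"
    have b2: "b2 \<in> gr B k" "b2 \<in> carrier B" "diff B b2 = w"
      using B.homogeneous_primitive[OF b1(1), of k] w(1) b1 B.gr_closed unfolding b2_def by auto
    define c where "c = c0 \<oplus>\<^bsub>A\<^esub> (-1) \<odot>\<^bsub>A\<^esub> \<phi> b2"
    have \<phi>b2: "\<phi> b2 \<in> gr A k" "\<phi> b2 \<in> carrier A" "diff A (\<phi> b2) = \<phi> w" using b2 F by auto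
    have c: "c \<in> carrier A" "c \<in> gr A k" "c \<in> cocycles A"
      unfolding c_def cocycles_def using c0 \<phi>b2 A.gr_add A.gr_scale
      by (auto simp: A.d_add A.d_scale A.add_scale_minus_one \<phi>w)
    obtain z a1 where z: "z \<in> cocycles B" "z \<in> gr B k" "a1 \<in> carrier A" "c = diff A a1 \<oplus>\<^bsub>A\<^esub> \<phi> z"
      using surj[OF k(1) c(3,2)] by blast
    have zc: "z \<in> carrier B" "diff B z = \<zero>\<^bsub>B\<^esub>" using z(1) by (auto simp: cocycles_def)
    have \<phi>z: "\<phi> z \<in> gr A k" "\<phi> z \<in> carrier A" using z zc F by auto
    have "diff A a1 = c \<oplus>\<^bsub>A\<^esub> (-1) \<odot>\<^bsub>A\<^esub> \<phi> z" using move[OF _ \<phi>z(2) z(4)] z(3) by simp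
    then have da1: "diff A a1 \<in> gr A ((k - 1) + 1)" using A.gr_add A.gr_scale c \<phi>z by simp
    define a where "a = A.component (k - 1) a1"
    have a: "a \<in> gr A (k - 1)" "a \<in> carrier A" "diff A a = diff A a1"
      using A.homogeneous_primitive[OF z(3) da1] A.gr_closed unfolding a_def by auto
    have da: "diff A a \<in> gr A k" using A.diff_degree[OF a(1)] by simp
    define b0 where "b0 = b2 \<oplus>\<^bsub>B\<^esub> z"
    define P where "P t = (\<phi> b0 \<oplus>\<^bsub>A\<^esub> Q t) \<oplus>\<^bsub>A\<^esub> t ^ 1 \<odot>\<^bsub>A\<^esub> diff A a" for t
    define h0 where "h0 t = (((-1) powi k) \<odot>\<^bsub>A\<^esub> P t, P t, a)" for t
    have b0: "b0 \<in> gr B k" "b0 \<in> carrier B" "diff B b0 = w" "\<phi> b0 \<in> gr A k" "\<phi> b0 \<in> carrier A"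
      "\<phi> b0 = \<phi> b2 \<oplus>\<^bsub>A\<^esub> \<phi> z"
      unfolding b0_def using b2 z zc \<phi>b2 \<phi>z F
      by (auto simp: B.gr_add B.d_add A.gr_add)
    have P: "P t \<in> gr A k" "P t \<in> carrier A" for t
    proof -
      show "P t \<in> gr A k" unfolding P_def by (intro A.gr_add A.gr_scale b0(4) Qd(1) da)
      then show "P t \<in> carrier A" by (rule A.gr_closed)
    qed
    have "diff A (P t) = diff A (\<phi> b0) \<oplus>\<^bsub>A\<^esub> diff A (Q t)" for t
      unfolding P_def using b0(5) Qd(2) a(2) by (simp add: A.d_add A.d_scale A.diff_diff)
    then have dP: "D.p (diff M x) t = diff A (P t)" for t
      using pQ[of t] F(7)[OF b0(2)] b0(3) by simp
    have P01: "P 0 = \<phi> b0" "P 1 = \<psi> x"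
    proof -
      show "P 0 = \<phi> b0" unfolding P_def using b0(5) Q(2) a(2) by simp
      have regroup: "(u \<oplus>\<^bsub>A\<^esub> (-1) \<odot>\<^bsub>A\<^esub> v) \<oplus>\<^bsub>A\<^esub> v = u" if "u \<in> carrier A" "v \<in> carrier A" for u v
        using that A.add_scale_minus_one[of v] by (simp add: A.a_assoc A.a_comm[of "(-1) \<odot>\<^bsub>A\<^esub> v" v])
      have "c0 = c \<oplus>\<^bsub>A\<^esub> \<phi> b2" "\<psi> x = c0 \<oplus>\<^bsub>A\<^esub> Q 1"
        unfolding c_def using regroup[OF c0(1) \<phi>b2(2)] regroup[OF \<psi>x(1) Qd(2)[of 1]] by (simp_all add: c0_def)
      then have "\<psi> x = ((diff A a \<oplus>\<^bsub>A\<^esub> \<phi> z) \<oplus>\<^bsub>A\<^esub> \<phi> b2) \<oplus>\<^bsub>A\<^esub> Q 1" using z(4) a(3) by simp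
      then show "P 1 = \<psi> x" unfolding P_def b0(6)
        using \<phi>b2(2) \<phi>z(2) Qd(2) a(2) by (simp add: A.a_ac)
    qed
    have "poly_deriv A (\<lambda>t. (\<phi> b0 \<oplus>\<^bsub>A\<^esub> Q t) \<oplus>\<^bsub>A\<^esub> t ^ 1 \<odot>\<^bsub>A\<^esub> diff A a)
        (\<lambda>t. (\<zero>\<^bsub>A\<^esub> \<oplus>\<^bsub>A\<^esub> D.q (diff M x) t) \<oplus>\<^bsub>A\<^esub> (real 1 * t ^ (1 - 1)) \<odot>\<^bsub>A\<^esub> diff A a)"
      by (intro poly_deriv.add poly_deriv.monomial Q(1) A.poly_deriv_const b0(5)) (use a(2) in simp)
    then have PD: "poly_deriv A P (\<lambda>t. D.q (diff M x) t \<oplus>\<^bsub>A\<^esub> diff A a)"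
      using D.path_closed(3)[OF dx(2)] a(2) by (simp add: P_def[abs_def])
    have "admissible b h x b0 h0"
      unfolding adm_iff
    proof (intro conjI allI impI)
      fix l t assume "x \<in> gr M l"
      then have l: "l = k" by (rule kuniq)
      show "b0 \<in> gr B l" "h0 t \<in> gr (homotopy_algebra A) l"
        using b0(1) P a(1) by (simp_all add: l h0_def)
    next
      show "\<exists>q'. poly_deriv A (\<lambda>t. snd (snd (h0 t))) q'"
        using A.poly_deriv_const[OF a(2)] by (auto simp: h0_def)
    qed (use b0(3) dP P01 PD in \<open>simp_all add: h0_def w_def\<close>)
    then show ?thesis by blast
  qed
qed

text \<open>
  Well-founded recursion along the order of the generators; the data chosen at \<open>x\<close> are admissible
  with respect to those chosen below \<open>x\<close>. Both the map and the homotopy are determined by their values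
  on generators, so nothing has to be checked at limits.
\<close>

lemma lift_up_to_homotopy:
  obtains f where "f \<in> cdga_hom M B"
    "\<And>m. m \<in> carrier M \<Longrightarrow> f m \<in> generate_ring B (\<Union>p\<in>{..j}. gr B p)"
    "\<And>z. z \<in> cocycles M \<Longrightarrow> \<exists>a\<in>carrier A. \<psi> z = diff A a \<oplus>\<^bsub>A\<^esub> \<phi> (f z)"
proof -
  define R where "R = r - Id"
  have R: "(y, x) \<in> R \<longleftrightarrow> y \<in> underS r x" for x y by (auto simp: R_def underS_def)
  have "wf R" using wo unfolding R_def well_order_on_def by simp
  have "\<exists>g. \<forall>x. x \<in> X \<longrightarrow> admissible (fst \<circ> g) (snd \<circ> g) x (fst (g x)) (snd (g x))"
  proof (rule dependent_wf_choice[OF \<open>wf R\<close>])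
    fix g g' :: "'m \<Rightarrow> 'b \<times> (real \<Rightarrow> 'a \<times> 'a \<times> 'a)" and x v
    assume "\<And>y. (y, x) \<in> R \<Longrightarrow> g y = g' y"
    then have "restrict_b (underS r x) (fst \<circ> g) = restrict_b (underS r x) (fst \<circ> g')"
      "restrict_h (underS r x) (snd \<circ> g) = restrict_h (underS r x) (snd \<circ> g')"
      by (auto simp: R restrict_b_def restrict_h_def fun_eq_iff)
    then show "(x \<in> X \<longrightarrow> admissible (fst \<circ> g) (snd \<circ> g) x (fst v) (snd v)) =
        (x \<in> X \<longrightarrow> admissible (fst \<circ> g') (snd \<circ> g') x (fst v) (snd v))"
      unfolding admissible_def by simp
  next
    fix g :: "'m \<Rightarrow> 'b \<times> (real \<Rightarrow> 'a \<times> 'a \<times> 'a)" and x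
    assume IH: "\<And>y. (y, x) \<in> R \<Longrightarrow> y \<in> X \<longrightarrow> admissible (fst \<circ> g) (snd \<circ> g) y (fst (g y)) (snd (g y))"
    show "\<exists>v. x \<in> X \<longrightarrow> admissible (fst \<circ> g) (snd \<circ> g) x (fst v) (snd v)"
    proof (cases "x \<in> X")
      case True
      have "admissible (fst \<circ> g) (snd \<circ> g) y ((fst \<circ> g) y) ((snd \<circ> g) y)" if "y \<in> underS r x" for y
        using IH[of y] that underS_subset R by auto
      from admissible_exists[OF True this]
      obtain b0 h0 where "admissible (fst \<circ> g) (snd \<circ> g) x b0 h0" by blast
      then show ?thesis by (intro exI[of _ "(b0, h0)"]) simp
    qed simp
  qed
  then obtain g where g: "\<And>x. x \<in> X \<Longrightarrow> admissible (fst \<circ> g) (snd \<circ> g) x (fst (g x)) (snd (g x))" by blast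
  define b where "b = fst \<circ> g"
  define h where "h = snd \<circ> g"
  have adm: "admissible b h x (b x) (h x)" if "x \<in> X" for x using g[OF that] by (simp add: b_def h_def)
  have D: "homotopy_data M B A \<phi> \<psi> X b h"
  proof (intro homotopy_data.intro homotopy_data_axioms.intro M.cdga_axioms B.cdga_axioms A.cdga_axioms
      free \<phi> \<psi>)
    fix x k t assume "x \<in> X" "x \<in> gr M k"
    then show "b x \<in> gr B k" "h x t \<in> gr (homotopy_algebra A) k"
      using adm[of x] unfolding admissible_def Let_def by auto
  qed
  interpret D: homotopy_data M B A \<phi> \<psi> X b h by (rule D)
  have "D.compatible x" if x: "x \<in> X" for x
    by (rule admissible_imp_compatible[OF D x _ restricted_data adm[OF x]])
      (use adm underS_subset in auto)
  then have comp: "D.compatible m" if "m \<in> carrier M" for m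
    using D.compatible_subalgebra[of X m] that free unfolding free_gc_algebra_on_def by simp
  show thesis
  proof (rule that[of D.f])
    have "D.f (diff M m) = diff B (D.f m)" if "m \<in> carrier M" for m
      using comp[OF that] unfolding D.compatible_def by simp
    then show "D.f \<in> cdga_hom M B"
      unfolding cdga_hom_def Ring.ring_hom_def
      by (auto simp: D.f.lift_closed D.f.lift_add D.f.lift_mult D.f.lift_one D.f.lift_hom D.f.lift_degree)
    fix z assume z: "z \<in> cocycles M"
    then have zc: "z \<in> carrier M" by (simp add: cocycles_def)
    obtain Q where Q: "poly_deriv A Q (D.q z)" "\<And>t. D.p z t = \<phi> (D.f z) \<oplus>\<^bsub>A\<^esub> diff A (Q t)"
      using D.homotopy_on_cocycle[OF comp[OF zc] z] by blast
    have "\<psi> z = D.p z 1" using comp[OF zc] unfolding D.compatible_def by simp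
    also have "\<dots> = diff A (Q 1) \<oplus>\<^bsub>A\<^esub> \<phi> (D.f z)"
      using Q A.poly_deriv_closed[OF Q(1), of 1] cdga_homD(1)[OF \<phi> D.f.lift_closed[OF zc]]
      by (simp add: A.a_comm)
    finally show "\<exists>a\<in>carrier A. \<psi> z = diff A a \<oplus>\<^bsub>A\<^esub> \<phi> (D.f z)"
      using A.poly_deriv_closed[OF Q(1), of 1] by blast
  qed (rule D.f.lift_generate_ring[OF low j])
qed

end

section \<open>The cohomology ring\<close>

lemma coh_map_cdga_hom:
  assumes C: "cdga C" and D: "cdga D" and f: "f \<in> cdga_hom C D"
  shows "x \<in> carrier C \<Longrightarrow> coh_map D f (coh_class C x) = coh_class D (f x)"
    "coh_map D f \<in> LinearCombinations.module_hom RR (cohomology C) (cohomology D)"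
    "x \<in> cocycles C \<Longrightarrow> f x \<in> cocycles D"
    "coh_map D f ` carrier (Hdeg k C) = (\<lambda>z. coh_class D (f z)) ` (cocycles C \<inter> gr C k)"
proof -
  interpret C: cdga C by fact
  interpret D: cdga D by fact
  note F = cdga_homD[OF f]
  show 1: "coh_map D f (coh_class C x) = coh_class D (f x)" if "x \<in> carrier C" for x
    using F(7) that by (intro coh_map_class C.diff_space_axioms D.diff_space_axioms F(8))
  show "coh_map D f \<in> LinearCombinations.module_hom RR (cohomology C) (cohomology D)"
    using F(7) by (intro coh_map_hom C.diff_space_axioms D.diff_space_axioms F(8))
  show "f x \<in> cocycles D" if "x \<in> cocycles C"
    using that F(1)[of x] F(7)[of x] lin_hom_zero[OF C.vectorspace_axioms D.vectorspace_axioms F(8)]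
    by (simp add: cocycles_def)
  show "coh_map D f ` carrier (Hdeg k C) = (\<lambda>z. coh_class D (f z)) ` (cocycles C \<inter> gr C k)"
    unfolding cohomology_sel image_image
    by (rule image_cong[OF refl]) (simp add: 1 C.cocycle_closed)
qed

context cdga
begin

lemma cocycle_mult: assumes "x \<in> cocycles A" "y \<in> cocycles A" shows "x \<otimes> y \<in> cocycles A"
proof -
  have y: "y \<in> carrier A" "diff A y = \<zero>" and x: "x \<in> carrier A" "diff A x = \<zero>"
    using assms by (auto simp: cocycles_def)
  have "diff A (z \<otimes> y) = diff A z \<otimes> y" if "z \<in> carrier A" for z
    using that
  proof (induction rule: homogeneous_induct)
    case (homogeneous z k)
    then show ?case using leibniz[OF homogeneous y(1)] y gr_closed by simp
  qed (use y in \<open>simp_all add: d_add l_distr\<close>)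
  then show ?thesis using x y by (simp add: cocycles_def)
qed

lemma exact_mult_cocycle:
  assumes u: "u \<in> carrier A" and y: "y \<in> cocycles A"
  shows "\<exists>a\<in>carrier A. diff A u \<otimes> y = diff A a"
proof -
  have yc: "y \<in> carrier A" "diff A y = \<zero>" using y by (auto simp: cocycles_def)
  show ?thesis using u
  proof (induction rule: homogeneous_induct)
    case zero show ?case using yc by (intro bexI[of _ "\<zero>"]) auto
  next
    case (add u v)
    then obtain a b where "a \<in> carrier A" "diff A u \<otimes> y = diff A a" "b \<in> carrier A"
      "diff A v \<otimes> y = diff A b" by blast
    then show ?case using add yc by (intro bexI[of _ "a \<oplus> b"]) (auto simp: d_add l_distr)
  next
    case (homogeneous u k)
    then show ?case using leibniz[OF homogeneous yc(1)] yc gr_closed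
      by (intro bexI[of _ "u \<otimes> y"]) auto
  qed
qed

text \<open>The sign in the Leibniz rule depends on the degree, so \<open>x\<close> has to be split into components here;
  these are again cocycles.\<close>

lemma cocycle_mult_exact:
  assumes x: "x \<in> cocycles A" and v: "v \<in> carrier A"
  shows "\<exists>a\<in>carrier A. x \<otimes> diff A v = diff A a"
proof -
  have xc: "x \<in> carrier A" using x by (rule cocycle_closed)
  obtain F where F: "finite F" "x = (\<Oplus>k\<in>F. component k x)" using sum_of_components[OF xc] .
  have k: "component k x \<otimes> diff A v = diff A (((-1) powi k) \<odot> (component k x \<otimes> v))" for k
  proof -
    have "diff A (component k x) = \<zero>"
      using cocycle_component[OF x] by (simp add: cocycles_def)
    then have "diff A (component k x \<otimes> v) = ((-1) powi k) \<odot> (component k x \<otimes> diff A v)"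
      using leibniz[OF component_degree[OF xc, of k] v] xc v by simp
    then show ?thesis using xc v by (simp add: d_scale scale_scale sign_powi)
  qed
  have "(\<Oplus>k\<in>F. component k x) \<otimes> diff A v = (\<Oplus>k\<in>F. component k x \<otimes> diff A v)"
    by (rule finsum_ldistr) (use F xc v in auto)
  also have "\<dots> = (\<Oplus>k\<in>F. diff A (((-1) powi k) \<odot> (component k x \<otimes> v)))"
    by (simp only: k)
  also have "\<dots> = diff A (\<Oplus>k\<in>F. ((-1) powi k) \<odot> (component k x \<otimes> v))"
    by (rule lin_hom_finsum[OF vectorspace_axioms vectorspace_axioms d_hom F(1), symmetric])
      (use xc v in auto)
  finally have "x \<otimes> diff A v = diff A (\<Oplus>k\<in>F. ((-1) powi k) \<odot> (component k x \<otimes> v))"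
    unfolding F(2)[symmetric] .
  moreover have "(\<Oplus>k\<in>F. ((-1) powi k) \<odot> (component k x \<otimes> v)) \<in> carrier A"
    by (rule finsum_closed) (use xc v in auto)
  ultimately show ?thesis by blast
qed

text \<open>
  Well-definedness of the product: the defining union over representatives has equal members.
\<close>

lemma coh_class_mult:
  assumes x: "x \<in> cocycles A" and y: "y \<in> cocycles A"
  shows "coh_class A x \<otimes>\<^bsub>cohomology A\<^esub> coh_class A y = coh_class A (x \<otimes> y)"
proof -
  have c: "x \<in> carrier A" "y \<in> carrier A" using x y by (auto simp: cocycle_closed)
  have eq: "coh_class A (a \<otimes> b) = coh_class A (x \<otimes> y)"
    if ab: "a \<in> coh_class A x" "b \<in> coh_class A y" for a b
  proof -
    obtain u v where uv: "u \<in> carrier A" "a = diff A u \<oplus> x" "v \<in> carrier A" "b = diff A v \<oplus> y"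
      using ab by (auto simp: mem_coh_class)
    have b: "b \<in> cocycles A" using uv y by (simp add: cocycle_add diff_cocycle)
    obtain s t where st: "s \<in> carrier A" "diff A u \<otimes> b = diff A s" "t \<in> carrier A" "x \<otimes> diff A v = diff A t"
      using exact_mult_cocycle[OF uv(1) b] cocycle_mult_exact[OF x uv(3)] by blast
    have "a \<otimes> b = diff A u \<otimes> b \<oplus> (x \<otimes> diff A v \<oplus> x \<otimes> y)"
      unfolding uv(2) using b uv c by (simp add: l_distr cocycle_closed) (simp add: uv(4) r_distr)
    also have "\<dots> = diff A (s \<oplus> t) \<oplus> x \<otimes> y"
      using st c by (simp add: d_add a_assoc)
    finally show ?thesis using st c by (intro coh_class_eqI[of "s \<oplus> t"]) auto
  qed
  have "coh_class A x \<otimes>\<^bsub>cohomology A\<^esub> coh_class A y =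
      (\<Union>a\<in>coh_class A x. \<Union>b\<in>coh_class A y. coh_class A (a \<otimes> b))"
    by (simp add: cohomology_def rcoset_mult_def coh_class_def)
  also have "\<dots> = (\<Union>a\<in>coh_class A x. \<Union>b\<in>coh_class A y. coh_class A (x \<otimes> y))"
    by (intro SUP_cong refl eq)
  also have "\<dots> = coh_class A (x \<otimes> y)"
    using self_mem_coh_class[OF c(1)] self_mem_coh_class[OF c(2)] by auto
  finally show ?thesis .
qed

lemma one_cocycle: "\<one> \<in> cocycles A"
  by (simp add: cocycles_def diff_one)

lemma gen_subring_scale:
  assumes j: "j \<ge> 0" and X: "X \<in> gen_subring j A" "X \<in> carrier (cohomology A)"
  shows "r \<odot>\<^bsub>cohomology A\<^esub> X \<in> gen_subring j A"
proof -
  obtain x where x: "x \<in> cocycles A" "X = coh_class A x" using X(2) by (auto simp: cohomology_sel)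
  have r1: "r \<odot> \<one> \<in> cocycles A" "r \<odot> \<one> \<in> gr A 0"
    using cocycle_scale[OF one_cocycle] gr_scale[OF one_degree] by auto
  then have "coh_class A (r \<odot> \<one>) \<in> gr (cohomology A) 0" unfolding cohomology_sel by blast
  then have "coh_class A (r \<odot> \<one>) \<in> gen_subring j A"
    unfolding gen_subring_def using j by (intro generate_ring.incl) auto
  then have "coh_class A (r \<odot> \<one>) \<otimes>\<^bsub>cohomology A\<^esub> X \<in> gen_subring j A"
    using X(1) unfolding gen_subring_def by (rule generate_ring.eng_mult)
  moreover have "coh_class A (r \<odot> \<one>) \<otimes>\<^bsub>cohomology A\<^esub> X = r \<odot>\<^bsub>cohomology A\<^esub> X"
    using x by (simp add: coh_class_mult[OF r1(1) x(1)] coh_class_scale cocycle_closed scale_mult_left)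
  ultimately show ?thesis by simp
qed

lemma gen_subring_subspace:
  assumes j: "j \<ge> 0"
  shows "VectorSpace.subspace RR (gen_subring j A \<inter> gr (cohomology A) k) (cohomology A)"
proof -
  interpret H: real_vs "cohomology A" by (rule real_vs.intro[OF cohomology_vectorspace])
  have S: "LinearCombinations.submodule RR (gr (cohomology A) k) (cohomology A)"
    using gr_cohomology_subspace by (simp add: VectorSpace.subspace_def)
  have grc: "X \<in> gr (cohomology A) k \<Longrightarrow> X \<in> carrier (cohomology A)" for X k
    by (auto simp: cohomology_sel)
  show ?thesis
  proof (rule H.subspaceI)
    have "\<one>\<^bsub>cohomology A\<^esub> \<in> carrier (cohomology A)"
      unfolding cohomology_sel(1,2) using one_cocycle by blast
    moreover have "\<one>\<^bsub>cohomology A\<^esub> \<in> gen_subring j A"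
      unfolding gen_subring_def by (rule generate_ring.one)
    ultimately have one: "\<one>\<^bsub>cohomology A\<^esub> \<in> carrier (cohomology A)" "\<one>\<^bsub>cohomology A\<^esub> \<in> gen_subring j A" .
    from gen_subring_scale[OF j one(2,1), of 0] one(1)
    have "\<zero>\<^bsub>cohomology A\<^esub> \<in> gen_subring j A" by simp
    then show "\<zero>\<^bsub>cohomology A\<^esub> \<in> gen_subring j A \<inter> gr (cohomology A) k"
      using S by (simp add: LinearCombinations.submodule_def)
    show "r \<odot>\<^bsub>cohomology A\<^esub> X \<in> gen_subring j A \<inter> gr (cohomology A) k"
      if "X \<in> gen_subring j A \<inter> gr (cohomology A) k" for r X
      using gen_subring_scale[OF j, of X r] that grc S by (auto simp: LinearCombinations.submodule_def)
  qed (use grc S in \<open>auto simp: LinearCombinations.submodule_def gen_subring_def generate_ring.eng_add\<close>)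
qed

end

text \<open>
  The image of \<open>H(\<psi>)\<close> is a subring of \<open>H(A)\<close>, and it contains the generators by surjectivity in degrees
  at most \<open>j\<close>.
\<close>

lemma (in cdga) gen_subring_cocycles_in_image:
  assumes M: "cdga M" and \<psi>: "\<psi> \<in> cdga_hom M A" and iso: "\<And>s. s \<le> j \<Longrightarrow> H_iso s M A \<psi>"
    and "X \<in> gen_subring j A"
  shows "\<exists>m\<in>cocycles M. X = coh_class A (\<psi> m)"
proof -
  interpret M: cdga M by fact
  note F = cdga_homD[OF \<psi>]
  note z = coh_map_cdga_hom(3)[OF M cdga_axioms \<psi>]
  show ?thesis using assms(4) unfolding gen_subring_def
  proof induction
    case one show ?case
      using M.one_cocycle F(5) by (intro bexI[of _ "\<one>\<^bsub>M\<^esub>"]) (auto simp: cohomology_sel)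
  next
    case (incl X)
    then obtain s where s: "s \<le> j" "X \<in> carrier (Hdeg s A)" by (auto simp: Hdeg_def)
    then have "X \<in> coh_map A \<psi> ` carrier (Hdeg s M)"
      using iso[OF s(1)] unfolding H_iso_def lin_iso_def bij_betw_def by simp
    then obtain m where m: "m \<in> cocycles M" "X = coh_map A \<psi> (coh_class M m)" by (auto simp: cohomology_sel)
    then show ?case
      using coh_map_cdga_hom(1)[OF M cdga_axioms \<psi>] M.cocycle_closed by blast
  next
    case (a_inv X)
    then obtain m where m: "m \<in> cocycles M" "X = coh_class A (\<psi> m)" by blast
    then show ?case
      by (intro bexI[of _ "(-1) \<odot>\<^bsub>M\<^esub> m"])
        (auto simp: coh_class_neg z F(3) M.cocycle_closed M.cocycle_scale)
  next
    case (eng_add X Y)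
    then obtain m m' where m: "m \<in> cocycles M" "X = coh_class A (\<psi> m)" "m' \<in> cocycles M" "Y = coh_class A (\<psi> m')"
      by blast
    then show ?case
      by (intro bexI[of _ "m \<oplus>\<^bsub>M\<^esub> m'"])
        (auto simp: coh_class_add z cocycle_closed F(2) M.cocycle_closed M.cocycle_add)
  next
    case (eng_mult X Y)
    then obtain m m' where m: "m \<in> cocycles M" "X = coh_class A (\<psi> m)" "m' \<in> cocycles M" "Y = coh_class A (\<psi> m')"
      by blast
    then show ?case
      by (intro bexI[of _ "m \<otimes>\<^bsub>M\<^esub> m'"])
        (auto simp: coh_class_mult z F(4) M.cocycle_closed M.cocycle_mult)
  qed
qed

text \<open>
  A preimage under \<open>H(\<psi>)\<close> need not be homogeneous, but its component of degree \<open>k\<close> is again a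
  preimage.
\<close>

lemma (in cdga) gen_subring_degree_in_image:
  assumes M: "cdga M" and \<psi>: "\<psi> \<in> cdga_hom M A" and iso: "\<And>s. s \<le> j \<Longrightarrow> H_iso s M A \<psi>"
  shows "gen_subring j A \<inter> gr (cohomology A) k \<subseteq> coh_map A \<psi> ` carrier (Hdeg k M)"
proof
  interpret M: cdga M by fact
  note F = cdga_homD[OF \<psi>]
  fix X assume X: "X \<in> gen_subring j A \<inter> gr (cohomology A) k"
  obtain m where m: "m \<in> cocycles M" "X = coh_class A (\<psi> m)"
    using gen_subring_cocycles_in_image[OF M \<psi> iso] X by blast
  obtain a where a: "a \<in> cocycles A" "a \<in> gr A k" "X = coh_class A a" using X by (auto simp: cohomology_sel)
  have mc: "m \<in> carrier M" using m(1) by (rule M.cocycle_closed)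
  have ac: "a \<in> carrier A" using a(1) by (rule cocycle_closed)
  obtain u where u: "u \<in> carrier A" "a = diff A u \<oplus> \<psi> m"
    using a(3) m(2) coh_class_eq_iff[OF ac F(1)[OF mc]] by auto
  have "a = component k (diff A u) \<oplus> component k (\<psi> m)"
    using component_homogeneous[OF a(2), of k] u F(1)[OF mc] by (simp add: component_add)
  also have "component k (diff A u) = diff A (component (k - 1) u)"
    using component_diff[OF u(1), of "k - 1"] by simp
  also have "component k (\<psi> m) = \<psi> (M.component k m)"
    using component_of_graded_hom[OF M.graded_vectorspace_axioms graded_vectorspace_axioms F(8) _ mc, of 0 k] F(6)
    by simp
  finally have "X = coh_class A (\<psi> (M.component k m))"
    unfolding a(3) using u mc F(1) by (intro coh_class_eqI[of "component (k - 1) u"]) auto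
  also have "\<dots> = coh_map A \<psi> (coh_class M (M.component k m))"
    using mc by (intro coh_map_cdga_hom(1)[OF M cdga_axioms \<psi>, symmetric]) simp
  finally show "X \<in> coh_map A \<psi> ` carrier (Hdeg k M)"
    using M.cocycle_component[OF m(1)] M.component_degree[OF mc] by (auto simp: cohomology_sel)
qed

section \<open>Maps to the cohomology algebra\<close>

text \<open>On \<open>H(A)\<close> the differential vanishes, so a class of \<open>B\<close> determines an element of \<open>H(A)\<close>.\<close>

definition class_value :: "('b \<Rightarrow> 'c) \<Rightarrow> 'b set \<Rightarrow> 'c" where
  "class_value \<phi> X = the_elem (\<phi> ` X)"

locale map_to_cohomology = B: cdga B + A: cdga A
  for B :: "'b dg" and A :: "'a dg" and \<phi> :: "'b \<Rightarrow> 'a set" +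
  assumes \<phi>: "\<phi> \<in> cdga_hom B (cohomology A)"
begin

sublocale H: real_vs "cohomology A"
  by (rule real_vs.intro[OF A.cohomology_vectorspace])

lemma image_of_class:
  assumes x: "x \<in> carrier B" shows "\<phi> ` coh_class B x = {\<phi> x}"
proof -
  note F = cdga_homD[OF \<phi>]
  have "\<phi> y = \<phi> x" if y: "y \<in> coh_class B x" for y
  proof -
    obtain b where b: "b \<in> carrier B" "y = diff B b \<oplus>\<^bsub>B\<^esub> x" using y by (auto simp: B.mem_coh_class)
    then have "\<phi> y = \<zero>\<^bsub>cohomology A\<^esub> \<oplus>\<^bsub>cohomology A\<^esub> \<phi> x"
      using F(2,7) x by (simp add: cohomology_sel)
    then show ?thesis using F(1)[OF x] by simp
  qed
  then have "\<phi> ` coh_class B x \<subseteq> {\<phi> x}" by (intro image_subsetI singletonI) simp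
  moreover have "\<phi> x \<in> \<phi> ` coh_class B x" by (rule imageI[OF B.self_mem_coh_class[OF x]])
  ultimately show ?thesis by (intro equalityI) simp_all
qed

lemma class_value_eq: "x \<in> carrier B \<Longrightarrow> class_value \<phi> (coh_class B x) = \<phi> x"
  by (simp add: class_value_def image_of_class)

lemma class_value_hom: "class_value \<phi> \<in> LinearCombinations.module_hom RR (cohomology B) (cohomology A)"
proof -
  note F = cdga_homD[OF \<phi>]
  show ?thesis
    by (rule module_homI) (auto simp: cohomology_sel(1)[of B] B.coh_class_add B.coh_class_scale B.cocycle_closed
        class_value_eq F)
qed

lemma coh_map_to_cohomology:
  assumes "X \<in> carrier (cohomology B)"
  shows "coh_map (cohomology A) \<phi> X = {class_value \<phi> X}"
proof -
  obtain x where "x \<in> cocycles B" and X: "X = coh_class B x"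
    using assms by (auto simp: cohomology_sel)
  then have x: "x \<in> carrier B" by (simp add: B.cocycle_closed)
  have h: "coboundaries (cohomology A) +>\<^bsub>cohomology A\<^esub> h = {h}" if "h \<in> carrier (cohomology A)" for h
  proof -
    have "coboundaries (cohomology A) = {\<zero>\<^bsub>cohomology A\<^esub>}"
      using H.zero_closed by (auto simp: coboundaries_def cohomology_sel(3,6))
    then show ?thesis using that by (simp add: a_r_coset_def')
  qed
  have "coh_map (cohomology A) \<phi> X = (\<Union>h\<in>\<phi> ` X. coboundaries (cohomology A) +>\<^bsub>cohomology A\<^esub> h)"
    by (simp add: coh_map_def)
  then show ?thesis
    using cdga_homD(1)[OF \<phi> x] by (simp add: x X image_of_class class_value_eq h)
qed

lemma generate_ring_image:
  assumes "x \<in> generate_ring B (\<Union>p\<in>{..j}. gr B p)"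
  shows "\<phi> x \<in> gen_subring j A"
proof -
  note F = cdga_homD[OF \<phi>]
  have c: "y \<in> carrier B" if "y \<in> generate_ring B (\<Union>p\<in>{..j}. gr B p)" for y
    using B.generate_ring_in_carrier[OF _ that] B.gr_closed by blast
  show ?thesis using assms unfolding gen_subring_def
  proof induction
    case one show ?case by (simp add: F(5) generate_ring.one)
  next
    case (incl x) then show ?case using F(6) by (intro generate_ring.incl) auto
  next
    case (a_inv x)
    have "\<phi> (\<ominus>\<^bsub>B\<^esub> x) = \<ominus>\<^bsub>cohomology A\<^esub> \<phi> x"
      using c[OF a_inv(1)] F(1,3) by (simp add: B.neg_eq_scale H.neg_eq_scale)
    then show ?case using a_inv by (simp add: generate_ring.a_inv)
  next
    case (eng_add x y) then show ?case using c by (simp add: F(2) generate_ring.eng_add)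
  next
    case (eng_mult x y) then show ?case using c by (simp add: F(4) generate_ring.eng_mult)
  qed
qed

text \<open>
  The second factor of the target has zero differential, so the coboundaries of the target are the
  pairs \<open>(da, 0)\<close>.
\<close>

lemma pair_kills_class:
  assumes \<phi>A: "\<phi>A \<in> cdga_hom B A" and w: "w \<in> carrier B" and "\<phi> w = \<zero>\<^bsub>cohomology A\<^esub>"
    and "\<exists>a\<in>carrier A. \<phi>A w = diff A a"
  shows "coh_map (dc_target A) (dc_map \<phi>A \<phi>) (coh_class B w) = coboundaries (dc_target A)"
proof -
  note F = cdga_homD[OF \<phi>A]
  let ?D = "dc_target A"
  have cb: "coboundaries ?D = {(diff A a, \<zero>\<^bsub>cohomology A\<^esub>) | a. a \<in> carrier A}"
  proof -
    have "coboundaries ?D = diff ?D ` carrier ?D" by (rule coboundaries_def)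
    also have "\<dots> = {(diff A a, \<zero>\<^bsub>cohomology A\<^esub>) | a. a \<in> carrier A}"
      using H.zero_closed by (auto simp: dg_prod_def cohomology_sel(3,6) image_iff)
    finally show ?thesis .
  qed
  have coset: "coboundaries ?D +>\<^bsub>?D\<^esub> (diff A a, \<zero>\<^bsub>cohomology A\<^esub>) = coboundaries ?D"
    if a: "a \<in> carrier A" for a
  proof (rule Set.set_eqI, rule iffI)
    fix x assume "x \<in> coboundaries ?D +>\<^bsub>?D\<^esub> (diff A a, \<zero>\<^bsub>cohomology A\<^esub>)"
    then obtain a' where "a' \<in> carrier A" "x = (diff A a' \<oplus>\<^bsub>A\<^esub> diff A a, \<zero>\<^bsub>cohomology A\<^esub>)"
      unfolding a_r_coset_def' cb by (auto simp: dg_prod_def)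
    then show "x \<in> coboundaries ?D" unfolding cb using a
      by (auto simp: A.d_add[symmetric])
  next
    fix x assume "x \<in> coboundaries ?D"
    then obtain a' where a': "a' \<in> carrier A" "x = (diff A a', \<zero>\<^bsub>cohomology A\<^esub>)" unfolding cb by blast
    have "diff A a' = diff A (a' \<oplus>\<^bsub>A\<^esub> (-1) \<odot>\<^bsub>A\<^esub> a) \<oplus>\<^bsub>A\<^esub> diff A a"
      using a a' A.add_scale_minus_one[of "diff A a"]
      by (simp add: A.d_add A.d_scale A.a_assoc A.a_comm[of "(-1) \<odot>\<^bsub>A\<^esub> diff A a" "diff A a"])
    moreover have "a' \<oplus>\<^bsub>A\<^esub> (-1) \<odot>\<^bsub>A\<^esub> a \<in> carrier A" using a a' by simp
    ultimately show "x \<in> coboundaries ?D +>\<^bsub>?D\<^esub> (diff A a, \<zero>\<^bsub>cohomology A\<^esub>)"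
      unfolding a_r_coset_def' cb a'(2) by (force simp: dg_prod_def)
  qed
  have "coboundaries ?D +>\<^bsub>?D\<^esub> dc_map \<phi>A \<phi> x = coboundaries ?D" if x: "x \<in> coh_class B w" for x
  proof -
    obtain b where b: "b \<in> carrier B" "x = diff B b \<oplus>\<^bsub>B\<^esub> w" using x by (auto simp: B.mem_coh_class)
    obtain a where a: "a \<in> carrier A" "\<phi>A w = diff A a" using assms(4) by blast
    have "\<phi> x = \<phi> w" using image_of_class[OF w] x by blast
    moreover have "\<phi>A x = diff A (\<phi>A b \<oplus>\<^bsub>A\<^esub> a)"
      using b a w F by (simp add: A.d_add)
    ultimately show ?thesis using coset[of "\<phi>A b \<oplus>\<^bsub>A\<^esub> a"] F(1)[OF b(1)] a assms(3) by simp
  qed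
  then have "coh_map ?D (dc_map \<phi>A \<phi>) (coh_class B w) = (\<Union>x\<in>coh_class B w. coboundaries ?D)"
    unfolding coh_map_def by (intro SUP_cong refl)
  then show ?thesis using B.self_mem_coh_class[OF w] by auto
qed

end

section \<open>The inequality\<close>

text \<open>
  Symmetry compares the two kernels: the isomorphism of long exact sequences carries the kernel of
  \<open>H(\<phi>\<^sub>A)\<close> onto that of \<open>H(\<phi>\<^sub>H)\<close>.
\<close>

lemma kernel_dim_le:
  assumes A: "cdga A" and B: "cdga B" and fd: "vectorspace.fin_dim RR (cohomology B)"
    and \<phi>A: "\<phi>A \<in> cdga_hom B A" and \<phi>H: "\<phi>H \<in> cdga_hom B (cohomology A)"
    and les: "les_isomorphic B A \<phi>A B (cohomology A) \<phi>H"
  shows "vdim ((cohomology B)\<lparr>carrier := {X \<in> gr (cohomology B) k. class_value \<phi>H X = \<zero>\<^bsub>cohomology A\<^esub>}\<rparr>)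
    \<le> H_ker_dim k B A \<phi>A"
proof -
  interpret map_to_cohomology B A \<phi>H
    by (intro map_to_cohomology.intro map_to_cohomology_axioms.intro A B \<phi>H)
  interpret HB: real_vs "cohomology B" by (rule real_vs.intro[OF B.cohomology_vectorspace])
  have Hdeg_eq: "Hdeg k B = (cohomology B)\<lparr>carrier := gr (cohomology B) k\<rparr>" by (simp add: Hdeg_def)
  have vs: "vectorspace RR (Hdeg k B)"
    unfolding Hdeg_eq by (rule HB.subspace_is_vs[OF B.gr_cohomology_subspace])
  interpret HBk: real_vs "Hdeg k B" by (rule real_vs.intro[OF vs])
  note hA = coh_map_cdga_hom(2)[OF B A \<phi>A]
  obtain \<alpha> \<beta> where \<alpha>: "lin_iso (Hdeg k B) (Hdeg k B) \<alpha>"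
    and \<beta>: "lin_iso (Hdeg k A) (Hdeg k (cohomology A)) \<beta>"
    and sq: "\<And>x. x \<in> carrier (Hdeg k B) \<Longrightarrow> \<beta> (coh_map A \<phi>A x) = coh_map (cohomology A) \<phi>H (\<alpha> x)"
    using les unfolding les_isomorphic_def by blast
  let ?KA = "{x \<in> carrier (Hdeg k B). coh_map A \<phi>A x = \<zero>\<^bsub>cohomology A\<^esub>}"
  let ?KH = "{X \<in> gr (cohomology B) k. class_value \<phi>H X = \<zero>\<^bsub>cohomology A\<^esub>}"
  have car: "carrier (Hdeg k B) = gr (cohomology B) k" "carrier (Hdeg k A) = gr (cohomology A) k"
    by (simp_all add: Hdeg_def)
  have sub: "gr (cohomology B) k \<subseteq> carrier (cohomology B)" by (auto simp: cohomology_sel)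
  \<comment> \<open>The differential of \<open>H(A)\<close> vanishes, so the zero class of \<open>H(H(A))\<close> is the singleton of zero.\<close>
  have \<beta>0: "\<beta> \<zero>\<^bsub>cohomology A\<^esub> = {\<zero>\<^bsub>cohomology A\<^esub>}"
  proof -
    have z: "\<zero>\<^bsub>cohomology A\<^esub> \<in> carrier (Hdeg k A)"
      unfolding car using A.gr_cohomology_subspace by (simp add: VectorSpace.subspace_def LinearCombinations.submodule_def)
    have x0: "coh_map A \<phi>A \<zero>\<^bsub>cohomology B\<^esub> = \<zero>\<^bsub>cohomology A\<^esub>"
      by (rule lin_hom_zero[OF B.cohomology_vectorspace A.cohomology_vectorspace hA])
    have zB: "\<zero>\<^bsub>cohomology B\<^esub> \<in> carrier (Hdeg k B)"
      unfolding car using B.gr_cohomology_subspace by (simp add: VectorSpace.subspace_def LinearCombinations.submodule_def)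
    have "\<alpha> \<zero>\<^bsub>cohomology B\<^esub> = \<zero>\<^bsub>cohomology B\<^esub>"
      using lin_hom_zero[OF vs vs, of \<alpha>] \<alpha> by (simp add: lin_iso_def Hdeg_def)
    then have "\<beta> \<zero>\<^bsub>cohomology A\<^esub> = coh_map (cohomology A) \<phi>H \<zero>\<^bsub>cohomology B\<^esub>"
      using sq[OF zB] x0 by simp
    also have "\<dots> = {\<zero>\<^bsub>cohomology A\<^esub>}"
      using coh_map_to_cohomology[OF HB.zero_closed]
        lin_hom_zero[OF B.cohomology_vectorspace A.cohomology_vectorspace class_value_hom] by simp
    finally show ?thesis .
  qed
  have KA: "VectorSpace.subspace RR ?KA (Hdeg k B)"
  proof (rule HBk.subspaceI)
    show "\<zero>\<^bsub>Hdeg k B\<^esub> \<in> ?KA"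
      using HBk.zero_closed lin_hom_zero[OF B.cohomology_vectorspace A.cohomology_vectorspace hA]
      by (simp add: Hdeg_def)
    have add: "x \<oplus>\<^bsub>Hdeg k B\<^esub> y = x \<oplus>\<^bsub>cohomology B\<^esub> y" "s \<odot>\<^bsub>Hdeg k B\<^esub> x = s \<odot>\<^bsub>cohomology B\<^esub> x" for x y s
      by (simp_all add: Hdeg_def)
    show "x \<oplus>\<^bsub>Hdeg k B\<^esub> y \<in> ?KA" if "x \<in> ?KA" "y \<in> ?KA" for x y
      using that HBk.a_closed[of x y] LinearCombinations.module_hom_add[OF hA, of x y] sub
      by (auto simp: add car)
    show "s \<odot>\<^bsub>Hdeg k B\<^esub> x \<in> ?KA" if "x \<in> ?KA" for x s
      using that HBk.scale_closed[of x s] LinearCombinations.module_hom_smult[OF hA, of s x] sub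
      by (auto simp: add car)
  qed auto
  have KH: "VectorSpace.subspace RR ?KH (cohomology B)"
  proof (rule HB.subspaceI)
    have S: "LinearCombinations.submodule RR (gr (cohomology B) k) (cohomology B)"
      using B.gr_cohomology_subspace by (simp add: VectorSpace.subspace_def)
    note m = S[unfolded LinearCombinations.submodule_def]
    show "\<zero>\<^bsub>cohomology B\<^esub> \<in> ?KH"
      using m lin_hom_zero[OF B.cohomology_vectorspace A.cohomology_vectorspace class_value_hom] by auto
    show "X \<oplus>\<^bsub>cohomology B\<^esub> Y \<in> ?KH" if "X \<in> ?KH" "Y \<in> ?KH" for X Y
      using that m sub LinearCombinations.module_hom_add[OF class_value_hom, of X Y] by auto
    show "s \<odot>\<^bsub>cohomology B\<^esub> X \<in> ?KH" if "X \<in> ?KH" for s X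
      using that m sub LinearCombinations.module_hom_smult[OF class_value_hom, of s X] by auto
  qed (use sub in auto)
  have incl: "?KH \<subseteq> \<alpha> ` ?KA"
  proof
    fix Y assume Y: "Y \<in> ?KH"
    then obtain X where X: "X \<in> carrier (Hdeg k B)" "Y = \<alpha> X"
      using \<alpha> unfolding lin_iso_def bij_betw_def car by blast
    have Yc: "Y \<in> carrier (cohomology B)" using Y sub by auto
    have "\<beta> (coh_map A \<phi>A X) = \<beta> \<zero>\<^bsub>cohomology A\<^esub>"
      using sq[OF X(1)] coh_map_to_cohomology[OF Yc] Y by (simp add: X(2)[symmetric] \<beta>0)
    moreover have "coh_map A \<phi>A X \<in> carrier (Hdeg k A)"
    proof -
      obtain x where x: "x \<in> cocycles B" "x \<in> gr B k" "X = coh_class B x" using X(1) by (auto simp: cohomology_sel)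
      show ?thesis
        using coh_map_cdga_hom(1)[OF B A \<phi>A B.cocycle_closed[OF x(1)]] coh_map_cdga_hom(3)[OF B A \<phi>A x(1)]
          cdga_homD(6)[OF \<phi>A x(2)]
        by (auto simp: cohomology_sel x(3))
    qed
    moreover have "\<zero>\<^bsub>cohomology A\<^esub> \<in> carrier (Hdeg k A)"
      unfolding car using A.gr_cohomology_subspace by (simp add: VectorSpace.subspace_def LinearCombinations.submodule_def)
    ultimately have "coh_map A \<phi>A X = \<zero>\<^bsub>cohomology A\<^esub>"
      using \<beta> unfolding lin_iso_def bij_betw_def by (auto dest: inj_onD)
    then show "Y \<in> \<alpha> ` ?KA" using X by blast
  qed
  have \<alpha>h: "\<alpha> \<in> LinearCombinations.module_hom RR (Hdeg k B) (Hdeg k B)" using \<alpha> by (simp add: lin_iso_def)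
  have fdk: "vectorspace.fin_dim RR (Hdeg k B)"
    unfolding Hdeg_eq by (rule HB.fin_dim_subspace[OF B.gr_cohomology_subspace fd])
  have "vdim ((Hdeg k B)\<lparr>carrier := \<alpha> ` ?KA\<rparr>) \<le> vdim ((Hdeg k B)\<lparr>carrier := ?KA\<rparr>)"
    using rank_nullity_on_subspace[OF vs vs \<alpha>h KA fdk] by linarith
  moreover have "vdim ((Hdeg k B)\<lparr>carrier := ?KH\<rparr>) \<le> vdim ((Hdeg k B)\<lparr>carrier := \<alpha> ` ?KA\<rparr>)"
  proof (rule HBk.dim_subspace_mono[OF _ subspace_image[OF vs vs \<alpha>h KA] incl fdk])
    show "VectorSpace.subspace RR ?KH (Hdeg k B)"
      by (rule HBk.subspaceI) (use KH in \<open>auto simp: Hdeg_def VectorSpace.subspace_def LinearCombinations.submodule_def\<close>)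
  qed
  ultimately show ?thesis by (simp add: H_ker_dim_def Hdeg_def)
qed

text \<open>
  The hypotheses on the diagram make the lifting problem for \<open>\<phi>\<^sub>A\<close> solvable. Only degree \<open>j + 1\<close> needs an
  argument: there \<open>\<phi>\<^sub>H\<close> sends the obstruction to \<open>\<langle>H\<^sup>\<le>\<^sup>j(A)\<rangle> \<inter> H\<^sup>j\<^sup>+\<^sup>1(A) = 0\<close>, so that injectivity of \<open>H(\<phi>)\<close>
  applies although \<open>H(\<phi>\<^sub>A)\<close> need not be injective in this degree.
\<close>

lemma controlled_lifting_problem:
  assumes A: "cdga A" and B: "cdga B" and M: "cdga M"
    and \<phi>A: "\<phi>A \<in> cdga_hom B A" and \<phi>H: "\<phi>H \<in> cdga_hom B (cohomology A)" and \<psi>: "\<psi> \<in> cdga_hom M A"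
    and j: "j \<ge> 0" and zero: "gen_subring j A \<inter> gr (cohomology A) (j + 1) = {\<zero>\<^bsub>cohomology A\<^esub>}"
    and ctrl: "controlled j A B \<phi>A \<phi>H"
    and free: "free_gc_algebra_on M X" and wo: "well_order_on X r"
    and lower: "\<And>x. x \<in> X \<Longrightarrow> diff M x \<in> tensor_eval M ` carrier (tensor_algebra (underS r x))"
    and low: "X \<subseteq> (\<Union>p\<in>{..j}. gr M p)"
  shows "lifting_problem M B A \<phi>A \<psi> X r j"
proof -
  interpret map_to_cohomology B A \<phi>H
    by (intro map_to_cohomology.intro map_to_cohomology_axioms.intro A B \<phi>H)
  note F = cdga_homD[OF \<phi>A]
  note cm = coh_map_cdga_hom(1)[OF B A \<phi>A]
  have bij: "bij_betw (coh_map A \<phi>A) (carrier (Hdeg s B)) (carrier (Hdeg s A))" if "s \<le> j" for s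
    using ctrl that unfolding controlled_def H_iso_def lin_iso_def by blast
  have z0: "coh_class B \<zero>\<^bsub>B\<^esub> \<in> carrier (Hdeg s B)" for s
    using B.cocycle_zero by (auto simp: cohomology_sel)
  have \<phi>0: "\<phi>A \<zero>\<^bsub>B\<^esub> = \<zero>\<^bsub>A\<^esub>" "\<phi>H \<zero>\<^bsub>B\<^esub> = \<zero>\<^bsub>cohomology A\<^esub>"
    using lin_hom_zero[OF B.vectorspace_axioms A.vectorspace_axioms F(8)]
      lin_hom_zero[OF B.vectorspace_axioms A.cohomology_vectorspace cdga_homD(8)[OF \<phi>H]] by auto
  show ?thesis
  proof (intro lifting_problem.intro lifting_problem_axioms.intro A B M free \<phi>A \<psi> wo lower low j)
    fix s c assume s: "s \<le> j" and c: "c \<in> cocycles A" "c \<in> gr A s"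
    then have "coh_class A c \<in> carrier (Hdeg s A)" by (auto simp: cohomology_sel)
    then have "coh_class A c \<in> coh_map A \<phi>A ` carrier (Hdeg s B)"
      using bij[OF s] unfolding bij_betw_def by simp
    then obtain z where z: "z \<in> cocycles B" "z \<in> gr B s" "coh_class A c = coh_map A \<phi>A (coh_class B z)"
      by (auto simp: cohomology_sel)
    have zc: "z \<in> carrier B" by (rule B.cocycle_closed[OF z(1)])
    have "coh_class A c = coh_class A (\<phi>A z)" using z(3) cm[OF zc] by simp
    then show "\<exists>z a. z \<in> cocycles B \<and> z \<in> gr B s \<and> a \<in> carrier A \<and> c = diff A a \<oplus>\<^bsub>A\<^esub> \<phi>A z"
      using A.coh_class_eq_iff[OF A.cocycle_closed[OF c(1)] F(1)[OF zc]] z by blast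
  next
    fix s w
    assume s: "s \<le> j" and w: "w \<in> cocycles B" "w \<in> gr B (s + 1)"
      and wg: "w \<in> generate_ring B (\<Union>p\<in>{..j}. gr B p)" and ex: "\<exists>a\<in>carrier A. \<phi>A w = diff A a"
    have wc: "w \<in> carrier B" by (rule B.cocycle_closed[OF w(1)])
    have wH: "coh_class B w \<in> carrier (Hdeg (s + 1) B)" using w by (auto simp: cohomology_sel)
    have "coh_class B w = coh_class B \<zero>\<^bsub>B\<^esub>"
    proof (cases "s < j")
      case True
      have "coh_class A (\<phi>A w) = coboundaries A"
        using A.coh_class_eq_zero_iff[OF F(1)[OF wc]] ex by simp
      then have eq: "coh_map A \<phi>A (coh_class B w) = coh_map A \<phi>A (coh_class B \<zero>\<^bsub>B\<^esub>)"
        using cm[OF wc] cm[OF B.zero_closed] by (simp add: \<phi>0 A.coh_class_zero)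
      have inj: "inj_on (coh_map A \<phi>A) (carrier (Hdeg (s + 1) B))"
        using bij[of "s + 1"] True unfolding bij_betw_def by simp
      show ?thesis by (rule inj_onD[OF inj eq wH z0])
    next
      case False
      then have sj: "s = j" using s by simp
      have "\<phi>H w \<in> gen_subring j A \<inter> gr (cohomology A) (j + 1)"
        using generate_ring_image[OF wg] cdga_homD(6)[OF \<phi>H w(2)] by (simp add: sj)
      then have "\<phi>H w = \<zero>\<^bsub>cohomology A\<^esub>" using zero by simp
      then have kw: "coh_map (dc_target A) (dc_map \<phi>A \<phi>H) (coh_class B w) = coboundaries (dc_target A)"
        by (rule pair_kills_class[OF \<phi>A wc _ ex])
      have k0: "coh_map (dc_target A) (dc_map \<phi>A \<phi>H) (coh_class B \<zero>\<^bsub>B\<^esub>) = coboundaries (dc_target A)"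
        by (rule pair_kills_class[OF \<phi>A B.zero_closed \<phi>0(2)]) (auto simp: \<phi>0 intro: bexI[of _ "\<zero>\<^bsub>A\<^esub>"])
      have inj: "inj_on (coh_map (dc_target A) (dc_map \<phi>A \<phi>H)) (carrier (Hdeg (s + 1) B))"
        using ctrl unfolding controlled_def H_inj_def sj by blast
      show ?thesis by (rule inj_onD[OF inj _ wH z0]) (simp only: kw k0)
    qed
    then show "\<exists>b\<in>carrier B. w = diff B b"
      using B.coh_class_eq_zero_iff[OF wc] by (simp add: B.coh_class_zero)
  qed
qed

theorem theorem6p18:
  fixes A :: "'a dg" and B :: "'b dg" and M :: "'m dg"
    and \<phi>A :: "'b \<Rightarrow> 'a" and \<phi>H :: "'b \<Rightarrow> 'a set" and \<psi> :: "'m \<Rightarrow> 'a"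
    and n :: nat and j k :: int
  assumes "poincare_duality_cdga (2 * int n) A"
    and "j \<ge> 1"
    and "gen_subring j A \<inter> gr (cohomology A) (j + 1) = {\<zero>\<^bsub>cohomology A\<^esub>}"
    and "dc_diagram (2 * int n) A B \<phi>A \<phi>H"
    and "controlled j A B \<phi>A \<phi>H"
    and "minimal_model j A M \<psi>"
    and "k > j"
  shows "0 \<le> int (H_rank k M A \<psi>) - int (d_inv j k A) \<and>
         int (H_rank k M A \<psi>) - int (d_inv j k A) \<le> int (H_ker_dim k B A \<phi>A)"
proof -
  have j: "j \<ge> 0" using assms(2) by simp
  have A: "cdga A" and fdA: "vectorspace.fin_dim RR (cohomology A)"
    using assms(1) by (auto simp: poincare_duality_cdga_def connected_cdga_def)
  have B: "cdga B" and fdB: "vectorspace.fin_dim RR (cohomology B)"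
    and \<phi>A: "\<phi>A \<in> cdga_hom B A" and \<phi>H: "\<phi>H \<in> cdga_hom B (cohomology A)"
    and les: "les_isomorphic B A \<phi>A B (cohomology A) \<phi>H"
    using assms(4) by (auto simp: dc_diagram_def connected_cdga_def)
  have M: "cdga M" and \<psi>: "\<psi> \<in> cdga_hom M A" and iso: "\<And>s. s \<le> j \<Longrightarrow> H_iso s M A \<psi>"
    using assms(6) by (auto simp: minimal_model_def connected_cdga_def)
  obtain X r where X: "free_gc_algebra_on M X" "X \<subseteq> (\<Union>p\<in>{..j}. gr M p)" "well_order_on X r"
    "\<And>x. x \<in> X \<Longrightarrow> diff M x \<in> tensor_eval M ` carrier (tensor_algebra (underS r x))"
    using assms(6) unfolding minimal_model_def minimal_generators_def by blast
  interpret map_to_cohomology B A \<phi>H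
    by (intro map_to_cohomology.intro map_to_cohomology_axioms.intro A B \<phi>H)
  interpret M: cdga M by (rule M)
  interpret HB: real_vs "cohomology B" by (rule real_vs.intro[OF B.cohomology_vectorspace])
  note F = cdga_homD[OF \<phi>A]
  obtain f where f: "f \<in> cdga_hom M B"
    "\<And>m. m \<in> carrier M \<Longrightarrow> f m \<in> generate_ring B (\<Union>p\<in>{..j}. gr B p)"
    "\<And>z. z \<in> cocycles M \<Longrightarrow> \<exists>a\<in>carrier A. \<psi> z = diff A a \<oplus>\<^bsub>A\<^esub> \<phi>A (f z)"
    using lifting_problem.lift_up_to_homotopy[OF controlled_lifting_problem[OF A B M \<phi>A \<phi>H \<psi> j assms(3,5)
        X(1,3,4,2)]] by blast
  note fh = cdga_homD[OF f(1)] and fz = coh_map_cdga_hom(3)[OF M B f(1)]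
  \<comment> \<open>\<open>H(\<phi>\<^sub>A)\<close> maps \<open>I\<close> onto the image of \<open>H(\<psi>)\<close>, while \<open>\<phi>\<^sub>H\<close> maps it into \<open>\<langle>H\<^sup>\<le>\<^sup>j(A)\<rangle>\<close>.\<close>
  define I where "I = coh_map B f ` carrier (Hdeg k M)"
  have I_eq: "I = (\<lambda>z. coh_class B (f z)) ` (cocycles M \<inter> gr M k)"
    unfolding I_def by (rule coh_map_cdga_hom(4)[OF M B f(1)])
  have HM: "carrier (Hdeg k M) = gr (cohomology M) k" by (simp add: Hdeg_def)
  note hom_\<psi> = coh_map_cdga_hom(2)[OF M A \<psi>]
  have I: "VectorSpace.subspace RR I (cohomology B)"
    unfolding I_def HM
    by (rule subspace_image[OF M.cohomology_vectorspace B.cohomology_vectorspace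
        coh_map_cdga_hom(2)[OF M B f(1)] M.gr_cohomology_subspace])
  have lower: "d_inv j k A \<le> H_rank k M A \<psi>"
    unfolding d_inv_def H_rank_def
    by (rule H.dim_subspace_mono[OF A.gen_subring_subspace[OF j] _ A.gen_subring_degree_in_image[OF M \<psi> iso] fdA])
      (unfold HM, rule subspace_image[OF M.cohomology_vectorspace A.cohomology_vectorspace hom_\<psi>
        M.gr_cohomology_subspace])
  have image: "coh_map A \<phi>A ` I = coh_map A \<psi> ` carrier (Hdeg k M)"
  proof -
    have "coh_map A \<phi>A (coh_class B (f z)) = coh_class A (\<psi> z)" if z: "z \<in> cocycles M" for z
    proof -
      have fz: "f z \<in> carrier B" by (rule fh(1)[OF M.cocycle_closed[OF z]])
      obtain a where a: "a \<in> carrier A" "\<psi> z = diff A a \<oplus>\<^bsub>A\<^esub> \<phi>A (f z)" using f(3)[OF z] by blast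
      have "coh_map A \<phi>A (coh_class B (f z)) = coh_class A (\<phi>A (f z))"
        by (rule coh_map_cdga_hom(1)[OF B A \<phi>A fz])
      also have "\<dots> = coh_class A (\<psi> z)"
        by (rule A.coh_class_eqI[OF a(1) F(1)[OF fz] a(2), symmetric])
      finally show ?thesis .
    qed
    then show ?thesis
      unfolding I_eq coh_map_cdga_hom(4)[OF M A \<psi>] image_image by (intro image_cong refl) simp
  qed
  have "H_rank k M A \<psi> \<le> vdim ((cohomology B)\<lparr>carrier := I\<rparr>)"
    using rank_nullity_on_subspace[OF B.cohomology_vectorspace A.cohomology_vectorspace
        coh_map_cdga_hom(2)[OF B A \<phi>A] I fdB]
    unfolding H_rank_def image by linarith
  also have "\<dots> = vdim ((cohomology A)\<lparr>carrier := class_value \<phi>H ` I\<rparr>)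
      + vdim ((cohomology B)\<lparr>carrier := {Y \<in> I. class_value \<phi>H Y = \<zero>\<^bsub>cohomology A\<^esub>}\<rparr>)"
    by (rule rank_nullity_on_subspace[OF B.cohomology_vectorspace A.cohomology_vectorspace class_value_hom I fdB,
        symmetric])
  also have "\<dots> \<le> d_inv j k A + H_ker_dim k B A \<phi>A"
  proof (rule add_mono)
    have "class_value \<phi>H ` I \<subseteq> gen_subring j A \<inter> gr (cohomology A) k"
    proof -
      have "class_value \<phi>H (coh_class B (f z)) \<in> gen_subring j A \<inter> gr (cohomology A) k"
        if "z \<in> cocycles M" "z \<in> gr M k" for z
        using M.cocycle_closed[OF that(1)] generate_ring_image[OF f(2)] cdga_homD(6)[OF \<phi>H fh(6)[OF that(2)]]
        by (simp add: class_value_eq fh(1))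
      then show ?thesis by (auto simp: I_eq)
    qed
    then show "vdim ((cohomology A)\<lparr>carrier := class_value \<phi>H ` I\<rparr>) \<le> d_inv j k A"
      unfolding d_inv_def
      by (rule H.dim_subspace_mono[OF subspace_image[OF B.cohomology_vectorspace A.cohomology_vectorspace
          class_value_hom I] A.gen_subring_subspace[OF j] _ fdA])
    have Ik: "I \<subseteq> gr (cohomology B) k" using fz fh(6) by (auto simp: I_eq cohomology_sel)
    have ker: "VectorSpace.subspace RR {Y \<in> W. class_value \<phi>H Y = \<zero>\<^bsub>cohomology A\<^esub>} (cohomology B)"
      if W: "VectorSpace.subspace RR W (cohomology B)" for W
    proof (rule HB.subspaceI)
      note m = W[unfolded VectorSpace.subspace_def LinearCombinations.submodule_def]
      show "\<zero>\<^bsub>cohomology B\<^esub> \<in> {Y \<in> W. class_value \<phi>H Y = \<zero>\<^bsub>cohomology A\<^esub>}"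
        using m lin_hom_zero[OF B.cohomology_vectorspace A.cohomology_vectorspace class_value_hom] by auto
      fix Y Z s
      assume Y: "Y \<in> {Y \<in> W. class_value \<phi>H Y = \<zero>\<^bsub>cohomology A\<^esub>}"
      show "s \<odot>\<^bsub>cohomology B\<^esub> Y \<in> {Y \<in> W. class_value \<phi>H Y = \<zero>\<^bsub>cohomology A\<^esub>}"
        using m Y LinearCombinations.module_hom_smult[OF class_value_hom, of s Y] by auto
      assume Z: "Z \<in> {Y \<in> W. class_value \<phi>H Y = \<zero>\<^bsub>cohomology A\<^esub>}"
      show "Y \<oplus>\<^bsub>cohomology B\<^esub> Z \<in> {Y \<in> W. class_value \<phi>H Y = \<zero>\<^bsub>cohomology A\<^esub>}"
        using m Y Z LinearCombinations.module_hom_add[OF class_value_hom, of Y Z] by auto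
    qed (use W in \<open>auto simp: VectorSpace.subspace_def LinearCombinations.submodule_def\<close>)
    have "vdim ((cohomology B)\<lparr>carrier := {Y \<in> I. class_value \<phi>H Y = \<zero>\<^bsub>cohomology A\<^esub>}\<rparr>)
        \<le> vdim ((cohomology B)\<lparr>carrier := {Y \<in> gr (cohomology B) k. class_value \<phi>H Y = \<zero>\<^bsub>cohomology A\<^esub>}\<rparr>)"
      by (rule HB.dim_subspace_mono[OF ker[OF I] ker[OF B.gr_cohomology_subspace] _ fdB]) (use Ik in auto)
    also have "\<dots> \<le> H_ker_dim k B A \<phi>A" by (rule kernel_dim_le[OF A B fdB \<phi>A \<phi>H les])
    finally show "vdim ((cohomology B)\<lparr>carrier := {Y \<in> I. class_value \<phi>H Y = \<zero>\<^bsub>cohomology A\<^esub>}\<rparr>)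
      \<le> H_ker_dim k B A \<phi>A" .
  qed
  finally show ?thesis using lower by linarith
qed

end
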